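(* Let $F$ be any field with $\operatorname{char}F\ne2$, let $n\ge1$, let $d\ge 2$ be an even integer, and let $g(x)=\sum_{0\le t\le d/2}a_{d-2t}x^{d-2t}\in F[x]$ with $a_d=1$. Then $\dim_F\mathrm{Z}(\mathfrak{H}_n^g)_{\bar 0}\le|\widehat{\mathscr{P}^c_n}|$, where $\mathfrak{H}_n^g$ is the cyclotomic Sergeev algebra over $F$ and $\mathrm{Z}(\mathfrak{H}_n^g)_{\bar 0}$ is the even part of its center.
   Context: **Cyclotomic Sergeev algebra.** The affine Sergeev algebra $\mathfrak{H}_n$ over $F$ is the $F$-superalgebra generated by even generators $s_1,\ldots,s_{n-1},x_1,\ldots,x_n$ and odd generators $c_1,\ldots,c_n$ subject to: $s_i^2=1$, $s_is_j=s_js_i$ for $|i-j|>1$, $s_is_{i+1}s_i=s_{i+1}s_is_{i+1}$; $x_ix_j=x_jx_i$; $c_i^2=1$, $c_ic_j=-c_jc_i$ for $i\ne j$; $s_ix_i=x_{i+1}s_i-(1+c_ic_{i+1})$; $s_ix_j=x_js_i$ for $j\ne i,i+1$; $s_ic_i=c_{i+1}s_i$, $s_ic_{i+1}=c_is_i$, $s_ic_j=c_js_i$ for $j\neq i,i+1$; $x_ic_i=-c_ix_i$, $x_ic_j=c_jx_i$ for $i\ne j$. Then $\mathfrak{H}_n^g:=\mathfrak{H}_n/I_g$, with $I_g$ the two-sided ideal generated by $g(x_1)$; its level is $d$. $\mathrm{Z}(A)$ is the usual (non-super) center of $A$. **Index set.** An opposite partition is a composition $\lambda=(\lambda_1\le\cdots\le\lambda_k)$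 (positive parts); a color datum for it is a function $c:\{1,\dots,k\}\to\{1,\dots,d-1\}$ with $c(i)\ge c(i+1)$ whenever $\lambda_i=\lambda_{i+1}$. $\mathscr{P}^c_n$ is the set of pairs $\beta=(\lambda,\mu)$ where, for some $0\le s\le n$, $\lambda$ is an opposite partition of $s$ with a color datum $c$ and $\mu$ is a partition of $n-s$. For $\beta=(\lambda,\mu)$ with $\lambda=(\lambda_1,\dots,\lambda_k)$, $\mu=(\mu_1,\dots,\mu_l)$, let $\overline\beta=(\lambda_1,\dots,\lambda_k,\mu_1,\dots,\mu_l)$ and $\epsilon=(c(1),\dots,c(k),0,\dots,0)$ ($l$ zeros). $\widehat{\mathscr{P}^c_n}$ is the set of $\beta\in\mathscr{P}^c_n$ such that $\overline\beta_i\neq\overline\beta_j$ whenever $i\ne j$ and $\epsilon_i=\epsilon_j$ is even, and such that $\#\{1\le i\le k+l:\epsilon_i\text{ even}\}$ is even. *)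

theory Defs
  imports
    "HOL-Library.Poly_Mapping"
    "HOL-Computational_Algebra.Polynomial"
    "HOL-Algebra.QuotRing"
    "Jordan_Normal_Form.VS_Connect"
begin

section \<open>Superalgebras and their quotients\<close>

record ('f, 'b) superalgebra = "('f, 'b) module" +
  even_part :: "'b set"
  odd_part :: "'b set"

text \<open>The intended \<open>I\<close> is a two-sided ideal generated by homogeneous elements; the union in the
  scalar multiplication then ranges over copies of one and the same coset.\<close>

definition quot_superalgebra ::
    "('f, 'b, 'm) superalgebra_scheme \<Rightarrow> 'b set \<Rightarrow> ('f, 'b set) superalgebra" where
  "quot_superalgebra A I =
    \<lparr>carrier = carrier (A Quot I), mult = mult (A Quot I), one = one (A Quot I),
     zero = zero (A Quot I), add = add (A Quot I),
     smult = (\<lambda>a X. \<Union>x\<in>X. I +>\<^bsub>A\<^esub> (a \<odot>\<^bsub>A\<^esub> x)),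
     even_part = (\<lambda>x. I +>\<^bsub>A\<^esub> x) ` even_part A,
     odd_part = (\<lambda>x. I +>\<^bsub>A\<^esub> x) ` odd_part A\<rparr>"

definition algebra_center :: "('b, 'm) monoid_scheme \<Rightarrow> 'b set" where
  "algebra_center A = {z \<in> carrier A. \<forall>y \<in> carrier A. z \<otimes>\<^bsub>A\<^esub> y = y \<otimes>\<^bsub>A\<^esub> z}"

text \<open>The even part of the ordinary (non-super) center, as a vector space.\<close>

definition even_center :: "('f, 'b, 'm) superalgebra_scheme \<Rightarrow> ('f, 'b, 'm) superalgebra_scheme" where
  "even_center A = A\<lparr>carrier := algebra_center A \<inter> even_part A\<rparr>"

definition algebra_eval :: "('f::zero, 'b, 'm) module_scheme \<Rightarrow> 'f poly \<Rightarrow> 'b \<Rightarrow> 'b" where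
  "algebra_eval A g x = (\<Oplus>\<^bsub>A\<^esub>i\<in>{..degree g}. coeff g i \<odot>\<^bsub>A\<^esub> (x [^]\<^bsub>A\<^esub> i))"


section \<open>The affine and cyclotomic Sergeev algebras\<close>

text \<open>Words under concatenation, written additively so that the convolution product on
  finitely supported functions is the product of the free algebra.\<close>

datatype 'a free_word = Word (letters: "'a list")

instantiation free_word :: (type) monoid_add
begin

definition zero_free_word :: "'a free_word" where
  "0 = Word []"

definition plus_free_word :: "'a free_word \<Rightarrow> 'a free_word \<Rightarrow> 'a free_word" where
  "v + w = Word (letters v @ letters w)"

instance
  by standard (simp_all add: zero_free_word_def plus_free_word_def)

end

datatype sergeev_gen = gS nat | gX nat | gC nat

definition sergeev_gens :: "nat \<Rightarrow> sergeev_gen set" where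
  "sergeev_gens n = gS ` {1..n-1} \<union> gX ` {1..n} \<union> gC ` {1..n}"

definition odd_letters :: "sergeev_gen free_word \<Rightarrow> nat" where
  "odd_letters w = length (filter (\<lambda>l. l \<in> range gC) (letters w))"

type_synonym 'f sergeev_free = "sergeev_gen free_word \<Rightarrow>\<^sub>0 'f"

definition free_carrier :: "nat \<Rightarrow> ('f::field) sergeev_free set" where
  "free_carrier n = {p. \<forall>w \<in> Poly_Mapping.keys p. set (letters w) \<subseteq> sergeev_gens n}"

definition free_sergeev :: "nat \<Rightarrow> ('f::field, 'f sergeev_free) superalgebra" where
  "free_sergeev n =
    \<lparr>carrier = free_carrier n, mult = (*), one = 1, zero = 0, add = (+),
     smult = (\<lambda>a p. Poly_Mapping.single 0 a * p),
     even_part = {p \<in> free_carrier n. \<forall>w \<in> Poly_Mapping.keys p. even (odd_letters w)},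
     odd_part = {p \<in> free_carrier n. \<forall>w \<in> Poly_Mapping.keys p. odd (odd_letters w)}\<rparr>"

abbreviation gen :: "sergeev_gen \<Rightarrow> ('f::field) sergeev_free" where
  "gen l \<equiv> Poly_Mapping.single (Word [l]) 1"

abbreviation "gs i \<equiv> gen (gS i)"
abbreviation "gx i \<equiv> gen (gX i)"
abbreviation "gc i \<equiv> gen (gC i)"

inductive sergeev_rel :: "nat \<Rightarrow> ('f::field) sergeev_free \<Rightarrow> 'f sergeev_free \<Rightarrow> bool" for n where
  s_sq: "i \<in> {1..n-1} \<Longrightarrow> sergeev_rel n (gs i * gs i) 1"
| s_comm: "\<lbrakk>i \<in> {1..n-1}; j \<in> {1..n-1}; \<bar>int i - int j\<bar> > 1\<rbrakk> \<Longrightarrow>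
    sergeev_rel n (gs i * gs j) (gs j * gs i)"
| s_braid: "\<lbrakk>i \<in> {1..n-1}; i + 1 \<in> {1..n-1}\<rbrakk> \<Longrightarrow>
    sergeev_rel n (gs i * gs (i+1) * gs i) (gs (i+1) * gs i * gs (i+1))"
| x_comm: "\<lbrakk>i \<in> {1..n}; j \<in> {1..n}\<rbrakk> \<Longrightarrow> sergeev_rel n (gx i * gx j) (gx j * gx i)"
| c_sq: "i \<in> {1..n} \<Longrightarrow> sergeev_rel n (gc i * gc i) 1"
| c_anticomm: "\<lbrakk>i \<in> {1..n}; j \<in> {1..n}; i \<noteq> j\<rbrakk> \<Longrightarrow> sergeev_rel n (gc i * gc j) (- (gc j * gc i))"
| s_x: "i \<in> {1..n-1} \<Longrightarrow> sergeev_rel n (gs i * gx i) (gx (i+1) * gs i - (1 + gc i * gc (i+1)))"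
| s_x_comm: "\<lbrakk>i \<in> {1..n-1}; j \<in> {1..n}; j \<noteq> i; j \<noteq> i + 1\<rbrakk> \<Longrightarrow>
    sergeev_rel n (gs i * gx j) (gx j * gs i)"
| s_c: "i \<in> {1..n-1} \<Longrightarrow> sergeev_rel n (gs i * gc i) (gc (i+1) * gs i)"
| s_c_Suc: "i \<in> {1..n-1} \<Longrightarrow> sergeev_rel n (gs i * gc (i+1)) (gc i * gs i)"
| s_c_comm: "\<lbrakk>i \<in> {1..n-1}; j \<in> {1..n}; j \<noteq> i; j \<noteq> i + 1\<rbrakk> \<Longrightarrow>
    sergeev_rel n (gs i * gc j) (gc j * gs i)"
| x_c: "i \<in> {1..n} \<Longrightarrow> sergeev_rel n (gx i * gc i) (- (gc i * gx i))"
| x_c_comm: "\<lbrakk>i \<in> {1..n}; j \<in> {1..n}; i \<noteq> j\<rbrakk> \<Longrightarrow> sergeev_rel n (gx i * gc j) (gc j * gx i)"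

definition sergeev_ideal :: "nat \<Rightarrow> ('f::field) sergeev_free set" where
  "sergeev_ideal n = Idl\<^bsub>free_sergeev n\<^esub> {p - q | p q. sergeev_rel n p q}"

definition affine_sergeev :: "nat \<Rightarrow> ('f::field, 'f sergeev_free set) superalgebra" where
  "affine_sergeev n = quot_superalgebra (free_sergeev n) (sergeev_ideal n)"

definition affine_x :: "nat \<Rightarrow> nat \<Rightarrow> ('f::field) sergeev_free set" where
  "affine_x n i = sergeev_ideal n +>\<^bsub>free_sergeev n\<^esub> gx i"

definition cyclotomic_ideal :: "nat \<Rightarrow> ('f::field) poly \<Rightarrow> 'f sergeev_free set set" where
  "cyclotomic_ideal n g =
    Idl\<^bsub>affine_sergeev n\<^esub> {algebra_eval (affine_sergeev n) g (affine_x n 1)}"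

definition cyclotomic_sergeev ::
    "nat \<Rightarrow> 'f poly \<Rightarrow> ('f::field, 'f sergeev_free set set) superalgebra" where
  "cyclotomic_sergeev n g = quot_superalgebra (affine_sergeev n) (cyclotomic_ideal n g)"


section \<open>The index set\<close>

definition opposite_partition :: "nat \<Rightarrow> nat list \<Rightarrow> bool" where
  "opposite_partition s l \<longleftrightarrow> sorted l \<and> (\<forall>p \<in> set l. 0 < p) \<and> sum_list l = s"

definition std_partition :: "nat \<Rightarrow> nat list \<Rightarrow> bool" where
  "std_partition s m \<longleftrightarrow> sorted_wrt (\<ge>) m \<and> (\<forall>p \<in> set m. 0 < p) \<and> sum_list m = s"

definition color_datum :: "nat \<Rightarrow> nat list \<Rightarrow> nat list \<Rightarrow> bool" where
  "color_datum d l clr \<longleftrightarrow> length clr = length l \<and> set clr \<subseteq> {1..d-1} \<and>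
    (\<forall>i. Suc i < length l \<longrightarrow> l ! i = l ! Suc i \<longrightarrow> clr ! i \<ge> clr ! Suc i)"

text \<open>A triple \<open>(l, clr, m)\<close> is the pair of the opposite partition \<open>l\<close> equipped with the color
  datum \<open>clr\<close> (a list indexed like \<open>l\<close>, from 0), and the partition \<open>m\<close>.\<close>

definition colored_partitions :: "nat \<Rightarrow> nat \<Rightarrow> (nat list \<times> nat list \<times> nat list) set" where
  "colored_partitions d n = {(l, clr, m). \<exists>s\<le>n.
    opposite_partition s l \<and> color_datum d l clr \<and> std_partition (n - s) m}"

fun all_parts :: "nat list \<times> nat list \<times> nat list \<Rightarrow> nat list" where
  "all_parts (l, clr, m) = l @ m"

fun all_colors :: "nat list \<times> nat list \<times> nat list \<Rightarrow> nat list" where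
  "all_colors (l, clr, m) = clr @ replicate (length m) 0"

definition hat_colored_partitions ::
    "nat \<Rightarrow> nat \<Rightarrow> (nat list \<times> nat list \<times> nat list) set" where
  "hat_colored_partitions d n = {\<beta> \<in> colored_partitions d n.
    (\<forall>i < length (all_parts \<beta>). \<forall>j < length (all_parts \<beta>).
      i \<noteq> j \<longrightarrow> all_colors \<beta> ! i = all_colors \<beta> ! j \<longrightarrow> even (all_colors \<beta> ! i) \<longrightarrow>
      all_parts \<beta> ! i \<noteq> all_parts \<beta> ! j) \<and>
    even (card {i. i < length (all_parts \<beta>) \<and> even (all_colors \<beta> ! i)})}"

end

theory Submission
  imports Defs "HOL-Combinatorics.Permutations" "HOL-Combinatorics.Cycles"
begin

text \<open>Let the algebra act on the vector space with basis \<open>x^a c^S w\<close>, where \<open>a < d\<close>, \<open>S\<close> is a set of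
  indices and \<open>w\<close> a permutation. The words \<open>x^a c^S w\<close> span the quotient, and applying them to the
  cyclic vector gives the basis up to terms of lower degree in \<open>x\<close>, so the leading term \<open>F\<close> of a
  nonzero even central element is nonzero. It commutes with the graded generators. Commuting with \<open>x\<close>
  lets exponents be moved along the cycles of \<open>w\<close> and commuting with \<open>c\<close> moves Clifford letters, so
  \<open>F\<close> is determined by its coefficients at elements whose exponents are maximal away from one root per
  cycle; there parity fixes \<open>S\<close>. Commuting with \<open>s\<close> makes these coefficients depend only on the
  multiset of pairs (cycle length, color), up to sign, and kills them when two cycles with the same even
  color have equal lengths. Hence evaluating at one representative for each colored partition is
  injective on the even center.\<close>

section \<open>Linear operators on finitely supported functions\<close>

text \<open>That the monomials \<open>x^a c^S w\<close> with \<open>a < d\<close> form a basis is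
  not assumed: an action on them must be built and its relations verified. Reducing modulo
  \<open>g\<close> throughout would make this unmanageable, so the operators live on all exponents.
  There \<open>opx\<close>, \<open>opc\<close>, \<open>ops\<close> satisfy the affine relations
  exactly, and \<open>opX 1 = opx 1 - G 1 * rho\<close> subtracts \<open>g(x_1)\<close> where the
  exponent \<open>d - 1\<close> would be exceeded. The price is that commutation of
  \<open>opX 1\<close> and \<open>opX 2\<close> is available only on exponents below
  \<open>d\<close>, and their commutator has to be computed in closed form. Evenness of
  \<open>g\<close> and \<open>d\<close> enters here: \<open>G j\<close> commutes with the Clifford
  letters, \<open>rho\<close> anticommutes with \<open>c_1\<close>. In the graded algebra all
  generators act monomially from both sides, and centrality becomes a comparison of single
  coefficients. Colors are the numbers \<open>d - 1 - a r\<close> at the roots \<open>r\<close>; as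
  \<open>d\<close> is even, an even color means an odd exponent, and this turns out to mean that
  \<open>c_r\<close> occurs. Hence the number of even colors is \<open>card S\<close>, which is
  even. Characteristic different from 2 lets \<open>z = - z\<close> kill a coefficient.\<close>

abbreviation coef :: "('b \<Rightarrow>\<^sub>0 'f::zero) \<Rightarrow> 'b \<Rightarrow> 'f" where
  "coef \<equiv> Poly_Mapping.lookup"

abbreviation keys :: "('b \<Rightarrow>\<^sub>0 'f::zero) \<Rightarrow> 'b set" where
  "keys \<equiv> Poly_Mapping.keys"

definition scl :: "'f::field \<Rightarrow> ('b \<Rightarrow>\<^sub>0 'f) \<Rightarrow> ('b \<Rightarrow>\<^sub>0 'f)" where
  "scl a v = Poly_Mapping.map ((*) a) v"

lemma coef_scl [simp]: "coef (scl a v) k = a * coef v k"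
  by (cases "coef v k = 0") (simp_all add: scl_def Poly_Mapping.map.rep_eq when_def)

lemma scl_simps [simp]:
  "scl a 0 = 0" "scl 0 v = 0" "scl 1 v = v" "scl a (scl b v) = scl (a * b) v"
  "scl (-1) v = - v" "scl a (- v) = - scl a v" "scl (- a) v = - scl a v"
  by (rule poly_mapping_eqI; simp add: mult.assoc)+

lemma scl_add: "scl a (v + w) = scl a v + scl a w" "scl (a + b) v = scl a v + scl b v"
  by (rule poly_mapping_eqI; simp add: lookup_add algebra_simps)+

lemma scl_diff: "scl a (v - w) = scl a v - scl a w"
  by (rule poly_mapping_eqI; simp add: lookup_minus algebra_simps)

lemma scl_sum: "scl a (sum f A) = (\<Sum>x\<in>A. scl a (f x))"
  by (rule poly_mapping_eqI; simp add: lookup_sum sum_distrib_left)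

lemma scl_single [simp]: "scl a (Poly_Mapping.single k b) = Poly_Mapping.single k (a * b)"
  by (rule poly_mapping_eqI; simp add: lookup_single when_def)

lemma poly_mapping_expansion:
  assumes "finite A" "keys v \<subseteq> A"
  shows "v = (\<Sum>k\<in>A. Poly_Mapping.single k (coef v k))"
proof (rule poly_mapping_eqI)
  fix j
  have "(\<Sum>k\<in>A. if k = j then coef v k else 0) = (if j \<in> A then coef v j else 0)"
    using assms(1) by (simp add: sum.delta)
  thus "coef v j = coef (\<Sum>k\<in>A. Poly_Mapping.single k (coef v k)) j"
    using assms(2) by (auto simp: lookup_sum lookup_single when_def in_keys_iff subset_iff split: if_splits)
qed

abbreviation bas :: "'b \<Rightarrow> 'b \<Rightarrow>\<^sub>0 'f::field" where
  "bas k \<equiv> Poly_Mapping.single k 1"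

text \<open>Linear endomorphisms get a type of their own so that composition is the multiplication
  of a \<open>ring_1\<close>; operator identities then become calculations with
  \<open>algebra_simps\<close>, free of carrier conditions.\<close>

typedef (overloaded) ('b, 'f::field) lop =
  "{T :: ('b \<Rightarrow>\<^sub>0 'f) \<Rightarrow> ('b \<Rightarrow>\<^sub>0 'f). (\<forall>v w. T (v + w) = T v + T w) \<and> (\<forall>a v. T (scl a v) = scl a (T v))}"
  by (rule exI[of _ "\<lambda>v. v"]) simp

lifting_forget poly_mapping.lifting
setup_lifting type_definition_lop

lift_definition ap :: "('b, 'f::field) lop \<Rightarrow> ('b \<Rightarrow>\<^sub>0 'f) \<Rightarrow> ('b \<Rightarrow>\<^sub>0 'f)" is "\<lambda>T. T" .

lemma ap_add: "ap T (v + w) = ap T v + ap T w" by transfer simp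
lemma ap_scl: "ap T (scl a v) = scl a (ap T v)" by transfer simp
lemma ap_zero [simp]: "ap T 0 = 0" using ap_scl[of T 0 0] by simp
lemma ap_uminus: "ap T (- v) = - ap T v" using ap_scl[of T "-1" v] by simp
lemma ap_diff: "ap T (v - w) = ap T v - ap T w"
  using ap_add[of T v "- w"] by (simp add: ap_uminus)
lemma ap_sum: "ap T (sum f A) = (\<Sum>x\<in>A. ap T (f x))"
  by (induction A rule: infinite_finite_induct) (simp_all add: ap_add)
lemma ap_single: "ap T (Poly_Mapping.single k a) = scl a (ap T (bas k))"
  using ap_scl[of T a "bas k"] by simp

lemma ap_expansion:
  assumes "finite A" "keys v \<subseteq> A"
  shows "ap T v = (\<Sum>k\<in>A. scl (coef v k) (ap T (bas k)))"
proof -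
  have "ap T v = ap T (\<Sum>k\<in>A. Poly_Mapping.single k (coef v k))"
    using poly_mapping_expansion[OF assms] by simp
  thus ?thesis by (simp only: ap_sum ap_single[of T _ "coef v _"])
qed

instantiation lop :: (type, field) ring_1
begin
lift_definition zero_lop :: "('a, 'b) lop" is "\<lambda>v. 0" by simp
lift_definition one_lop :: "('a, 'b) lop" is "\<lambda>v. v" by simp
lift_definition plus_lop :: "('a, 'b) lop \<Rightarrow> ('a, 'b) lop \<Rightarrow> ('a, 'b) lop" is "\<lambda>S T v. S v + T v"
  by (simp add: scl_add algebra_simps)
lift_definition minus_lop :: "('a, 'b) lop \<Rightarrow> ('a, 'b) lop \<Rightarrow> ('a, 'b) lop" is "\<lambda>S T v. S v - T v"
  by (simp add: scl_diff algebra_simps)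
lift_definition uminus_lop :: "('a, 'b) lop \<Rightarrow> ('a, 'b) lop" is "\<lambda>S v. - S v"
  by (simp add: algebra_simps)
lift_definition times_lop :: "('a, 'b) lop \<Rightarrow> ('a, 'b) lop \<Rightarrow> ('a, 'b) lop" is "\<lambda>S T v. S (T v)"
  by simp
instance
proof
  show "(0 :: ('a, 'b) lop) \<noteq> 1"
  proof
    assume "(0 :: ('a, 'b) lop) = 1"
    hence "bas (undefined :: 'a) = (0 :: 'a \<Rightarrow>\<^sub>0 'b)"
      by transfer (metis)
    thus False by (metis lookup_single_eq lookup_zero zero_neq_one)
  qed
qed (transfer; simp add: fun_eq_iff algebra_simps; fail)+
end

lemma ap_simps [simp]:
  "ap 0 v = 0" "ap 1 v = v" "ap (S + T) v = ap S v + ap T v" "ap (S - T) v = ap S v - ap T v"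
  "ap (- S) v = - ap S v" "ap (S * T) v = ap S (ap T v)"
  by (transfer; simp)+

lemma ap_sum_lop: "ap (sum f A) v = (\<Sum>x\<in>A. ap (f x) v)"
  by (induction A rule: infinite_finite_induct) simp_all

lemma lop_eqI: "(\<And>k. ap S (bas k) = ap T (bas k)) \<Longrightarrow> S = T"
proof -
  assume h: "\<And>k. ap S (bas k) = ap T (bas k)"
  have "ap S v = ap T v" for v
    by (simp add: ap_expansion[OF finite_keys subset_refl, of _ v] h)
  thus "S = T" by transfer (simp add: fun_eq_iff)
qed

lift_definition scalar :: "'f::field \<Rightarrow> ('b, 'f) lop" is "\<lambda>a v. scl a v"
  by (simp add: scl_add mult.commute)

lemma ap_scalar [simp]: "ap (scalar a) v = scl a v" by transfer simp

lemma scalar_commute: "scalar a * T = T * scalar a"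
  by (rule lop_eqI) (simp only: ap_simps ap_scalar ap_scl)

lemma scalar_simps [simp]: "scalar 0 = 0" "scalar 1 = 1" "scalar (-1) = -1"
  "scalar (a * b) = scalar a * scalar b" "scalar (a + b) = scalar a + scalar b"
  by (rule lop_eqI; simp add: scl_add flip: scl_single)+

definition mk :: "('b \<Rightarrow> ('b \<Rightarrow>\<^sub>0 'f::field)) \<Rightarrow> ('b, 'f) lop" where
  "mk h = Abs_lop (\<lambda>v. \<Sum>k\<in>keys v. scl (coef v k) (h k))"

lemma mk_superset:
  assumes "finite A" "keys v \<subseteq> A"
  shows "(\<Sum>k\<in>keys v. scl (coef v k) (h k)) = (\<Sum>k\<in>A. scl (coef v k) (h k))"
  using assms by (intro sum.mono_neutral_left) (auto simp: in_keys_iff)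

lemma ap_mk: "ap (mk h) v = (\<Sum>k\<in>keys v. scl (coef v k) (h k))"
proof -
  let ?T = "\<lambda>v. \<Sum>k\<in>keys v. scl (coef v k) (h k)"
  have add: "?T (v + w) = ?T v + ?T w" for v w
  proof -
    let ?A = "keys v \<union> keys w"
    have "?T (v + w) = (\<Sum>k\<in>?A. scl (coef (v + w) k) (h k))"
      by (rule mk_superset) (simp_all add: Poly_Mapping.keys_add)
    also have "\<dots> = (\<Sum>k\<in>?A. scl (coef v k) (h k)) + (\<Sum>k\<in>?A. scl (coef w k) (h k))"
      by (simp add: lookup_add scl_add sum.distrib)
    also have "\<dots> = ?T v + ?T w"
      by (simp add: mk_superset[of ?A v] mk_superset[of ?A w])
    finally show ?thesis .
  qed
  have "?T (scl a v) = scl a (?T v)" for a v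
  proof -
    have "keys (scl a v) \<subseteq> keys v" by (auto simp: in_keys_iff)
    from mk_superset[OF _ this, of h] show ?thesis by (simp add: scl_sum)
  qed
  with add show ?thesis unfolding mk_def
    by (simp add: ap.rep_eq Abs_lop_inverse)
qed

lemma ap_mk_bas [simp]: "ap (mk h) (bas k) = h k"
  by (simp add: ap_mk)

section \<open>The graded operators\<close>

text \<open>\<open>(a, S, w)\<close> stands for the monomial \<open>x^a c^S w\<close>, with the
  letters of \<open>c^S\<close> in increasing order. Bounds on the exponents and the restriction to
  indices in \<open>{1..n}\<close> appear only with \<open>Bs\<close>.\<close>

type_synonym idx = "(nat \<Rightarrow> nat) \<times> nat set \<times> (nat \<Rightarrow> nat)"

abbreviation tp :: "nat \<Rightarrow> nat \<Rightarrow> nat" where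
  "tp i \<equiv> Transposition.transpose i (Suc i)"

text \<open>The number of exchanges that bring a letter \<open>c_i\<close> standing to the left of
  \<open>c^S\<close> to its place; only the parity matters.\<close>

definition nlt :: "nat set \<Rightarrow> nat \<Rightarrow> nat" where
  "nlt S i = card {j \<in> S. j < i}"

definition tog :: "nat set \<Rightarrow> nat \<Rightarrow> nat set" where
  "tog S i = {j. (j \<in> S) \<noteq> (j = i)}"

lemma tog_iff [simp]: "j \<in> tog S i \<longleftrightarrow> (j \<in> S) \<noteq> (j = i)"
  by (simp add: tog_def)

lemma tog_tog [simp]: "tog (tog S i) i = S" by auto
lemma tog_commute: "tog (tog S i) j = tog (tog S j) i" by auto

lemma even_nlt_tog: "even (nlt (tog S j) i) \<longleftrightarrow> (even (nlt S i) \<longleftrightarrow> \<not> j < i)"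
proof (cases "j < i")
  case True
  have fin: "finite {k \<in> S. k < i}" by (rule finite_subset[of _ "{..<i}"]) auto
  show ?thesis
  proof (cases "j \<in> S")
    case jS: True
    have "{k \<in> tog S j. k < i} = {k \<in> S. k < i} - {j}" using jS by auto
    moreover have "j \<in> {k \<in> S. k < i}" using jS True by auto
    ultimately have "nlt S i = Suc (nlt (tog S j) i)"
      unfolding nlt_def using fin by (metis card_Suc_Diff1)
    thus ?thesis using True by simp
  next
    case jS: False
    have "{k \<in> tog S j. k < i} = insert j {k \<in> S. k < i}" using jS True by auto
    thus ?thesis unfolding nlt_def using fin jS True by simp
  qed
next
  case False
  hence "{k \<in> tog S j. k < i} = {k \<in> S. k < i}" by auto
  thus ?thesis using False by (simp add: nlt_def)
qed

lemma nlt_Suc: "nlt S (Suc i) = nlt S i + (if i \<in> S then 1 else 0)"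
proof -
  have "{j \<in> S. j < Suc i} = (if i \<in> S then insert i {j \<in> S. j < i} else {j \<in> S. j < i})"
    by (auto simp: less_Suc_eq)
  moreover have "finite {j \<in> S. j < i}" by (rule finite_subset[of _ "{..<i}"]) auto
  ultimately show ?thesis by (simp add: nlt_def)
qed

lemma tp_apply: "tp i j = (if j = i then Suc i else if j = Suc i then i else j)"
  by (simp add: Transposition.transpose_def)

lemma nlt_tp_below:
  assumes "j \<le> i" shows "nlt (tp i -` S) j = nlt S j"
proof -
  have "{k \<in> tp i -` S. k < j} = {k \<in> S. k < j}" using assms by (auto simp: tp_apply)
  thus ?thesis by (simp add: nlt_def)
qed

lemma nlt_tp_Suc: "nlt (tp i -` S) (Suc i) = nlt S i + (if Suc i \<in> S then 1 else 0)"
  by (simp add: nlt_Suc nlt_tp_below)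

lemma nlt_tp_above:
  assumes "Suc i < j" shows "nlt (tp i -` S) j = nlt S j"
proof -
  have e: "{k \<in> tp i -` S. k < j} = tp i ` {k \<in> S. k < j}" using assms
    by (auto simp: tp_apply image_iff split: if_splits) 
  show ?thesis unfolding nlt_def e by (rule card_image) (auto intro: inj_on_subset[OF inj_transpose])
qed

definition opx :: "nat \<Rightarrow> (idx, 'f::field) lop" where
  "opx i = mk (\<lambda>(a, S, w). bas (a(i := Suc (a i)), S, w))"

text \<open>The letter \<open>c_i\<close> first passes \<open>x_i^(a i)\<close>, which costs
  \<open>(-1)^(a i)\<close>, and then the letters of \<open>c^S\<close> with smaller index.\<close>

definition opc :: "nat \<Rightarrow> (idx, 'f::field) lop" where
  "opc i = mk (\<lambda>(a, S, w). Poly_Mapping.single (a, tog S i, w) (if even (a i + nlt S i) then 1 else -1))"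

text \<open>The operator of \<open>s_i\<close> without the correction terms of the affine relation.
  Conjugation by \<open>s_i\<close> keeps the letters of \<open>c^S\<close> in increasing order
  unless both \<open>c_i\<close> and \<open>c_(i+1)\<close> occur.\<close>

definition opt :: "nat \<Rightarrow> (idx, 'f::field) lop" where
  "opt i = mk (\<lambda>(a, S, w). Poly_Mapping.single (a \<circ> tp i, tp i -` S, tp i \<circ> w)
     (if i \<in> S \<and> Suc i \<in> S then -1 else 1))"

lemma opx_bas [simp]: "ap (opx i) (Poly_Mapping.single (a, S, w) z) = Poly_Mapping.single (a(i := Suc (a i)), S, w) z"
  by (subst ap_single) (simp add: opx_def)

lemma opc_bas [simp]: "ap (opc i) (Poly_Mapping.single (a, S, w) z)
    = Poly_Mapping.single (a, tog S i, w) (if even (a i + nlt S i) then z else - z)"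
  by (subst ap_single) (simp add: opc_def)

lemma opt_bas [simp]: "ap (opt i) (Poly_Mapping.single (a, S, w) z) =
    Poly_Mapping.single (a \<circ> tp i, tp i -` S, tp i \<circ> w) (if i \<in> S \<and> Suc i \<in> S then - z else z)"
  by (subst ap_single) (simp add: opt_def)

lemma lop_idx_eqI: "(\<And>a S w. ap A (bas (a, S, w)) = ap B (bas (a, S, w))) \<Longrightarrow> A = B"
  by (rule lop_eqI) auto

lemma opx_commute: "opx i * opx j = opx j * opx i"
  by (rule lop_idx_eqI) (auto simp: fun_upd_twist)

lemma opc_sq: "opc i * opc i = 1"
  by (rule lop_idx_eqI) (simp add: even_nlt_tog)

lemma opc_anticommute: "i \<noteq> j \<Longrightarrow> opc i * opc j = - (opc j * opc i)"
  by (rule lop_idx_eqI)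
    (auto simp: even_nlt_tog tog_commute[of _ i j] single_uminus)

lemma opc_opx: "opc i * opx j = (if i = j then - (opx j * opc i) else opx j * opc i)"
  by (rule lop_idx_eqI) (auto simp: single_uminus)

lemma tp_tp [simp]: "tp i (tp i j) = j" by (simp add: tp_apply)
lemma comp_tp_tp [simp]: "f \<circ> tp i \<circ> tp i = f" "tp i \<circ> (tp i \<circ> g) = g" by auto
lemma vimage_tp_tp [simp]: "tp i -` tp i -` S = S" by auto

lemma upd_comp_tp: "a(j := v) \<circ> tp i = (a \<circ> tp i)(tp i j := v)"
  by (auto simp: fun_eq_iff tp_apply)

lemma tog_vimage_tp: "tp i -` tog S j = tog (tp i -` S) (tp i j)"
  by (auto simp: tp_apply split: if_splits)

lemma opt_opx: "opt i * opx j = opx (tp i j) * opt i"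
  by (rule lop_idx_eqI) (auto simp: upd_comp_tp)

lemma opt_opc: "opt i * opc j = opc (tp i j) * opt i"
proof (rule lop_idx_eqI)
  fix a S w
  have "j < i \<or> j = i \<or> j = Suc i \<or> Suc i < j" by linarith
  moreover have "tp i j = j" if "j < i \<or> Suc i < j" using that by (auto simp: tp_apply)
  ultimately show "ap (opt i * opc j) (bas (a, S, w)) = ap (opc (tp i j) * opt i) (bas (a, S, w))"
    by (elim disjE)
      (auto simp: tog_vimage_tp nlt_tp_below nlt_tp_Suc nlt_tp_above nlt_Suc)
qed

lemma opt_sq: "opt i * opt i = 1"
  by (rule lop_idx_eqI) (auto simp: tp_apply)

lemma opt_commute:
  assumes "Suc i < j"
  shows "opt i * opt j = opt j * opt i"
proof (rule lop_idx_eqI)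
  fix a :: "nat \<Rightarrow> nat" and S :: "nat set" and w :: "nat \<Rightarrow> nat"
  have tt: "tp i (tp j k) = tp j (tp i k)" for k using assms by (auto simp: tp_apply)
  have e: "a \<circ> tp j \<circ> tp i = a \<circ> tp i \<circ> tp j" "tp i -` tp j -` S = tp j -` tp i -` S"
    "tp i \<circ> (tp j \<circ> w) = tp j \<circ> (tp i \<circ> w)"
    by (auto simp: tt fun_eq_iff)
  have t: "tp i j = j" "tp i (Suc j) = Suc j" "tp j i = i" "tp j (Suc i) = Suc i"
    using assms by (auto simp: tp_apply)
  show "ap (opt i * opt j) (bas (a, S, w)) = ap (opt j * opt i) (bas (a, S, w))"
    by (simp add: e t)
qed

lemma opt_braid: "opt i * opt (Suc i) * opt i = opt (Suc i) * opt i * opt (Suc i)"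
proof (rule lop_idx_eqI)
  fix a :: "nat \<Rightarrow> nat" and S :: "nat set" and w :: "nat \<Rightarrow> nat"
  have tt: "tp i (tp (Suc i) (tp i k)) = tp (Suc i) (tp i (tp (Suc i) k))" for k by (auto simp: tp_apply)
  have e: "a \<circ> tp i \<circ> tp (Suc i) \<circ> tp i = a \<circ> tp (Suc i) \<circ> tp i \<circ> tp (Suc i)"
    "tp i -` tp (Suc i) -` tp i -` S = tp (Suc i) -` tp i -` tp (Suc i) -` S"
    "tp i \<circ> (tp (Suc i) \<circ> (tp i \<circ> w)) = tp (Suc i) \<circ> (tp i \<circ> (tp (Suc i) \<circ> w))"
    by (auto simp: tt fun_eq_iff)
  show "ap (opt i * opt (Suc i) * opt i) (bas (a, S, w)) = ap (opt (Suc i) * opt i * opt (Suc i)) (bas (a, S, w))"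
    by (simp add: e)
qed

section \<open>The affine operators\<close>

text \<open>The correction \<open>1 + c_i c_(i+1)\<close> in the relation between \<open>s_i\<close>
  and \<open>x_i\<close>; \<open>opm\<close> is the form it takes after \<open>x_i\<close>,
  \<open>x_(i+1)\<close> or \<open>s_i\<close> has passed it.\<close>

definition opp :: "nat \<Rightarrow> (idx, 'f::field) lop" where "opp i = 1 + opc i * opc (Suc i)"
definition opm :: "nat \<Rightarrow> (idx, 'f::field) lop" where "opm i = 1 - opc i * opc (Suc i)"

text \<open>\<open>opsy i b\<close> and \<open>opsx i b k\<close> are the normally ordered forms of \<open>s\<^sub>i x\<^sub>i\<^sub>+\<^sub>1^b\<close> and
  \<open>s\<^sub>i x\<^sub>i^k x\<^sub>i\<^sub>+\<^sub>1^b\<close>, applied to a vector on which \<open>s\<^sub>i\<close> acts by \<open>opt i\<close>.\<close>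

primrec opsy :: "nat \<Rightarrow> nat \<Rightarrow> (idx, 'f::field) lop" where
  "opsy i 0 = opt i"
| "opsy i (Suc b) = opx i * opsy i b + opm i * opx (Suc i) ^ b"

primrec opsx :: "nat \<Rightarrow> nat \<Rightarrow> nat \<Rightarrow> (idx, 'f::field) lop" where
  "opsx i b 0 = opsy i b"
| "opsx i b (Suc k) = opx (Suc i) * opsx i b k - opp i * opx i ^ k * opx (Suc i) ^ b"

text \<open>A basis vector is \<open>x_i^(a i) x_(i+1)^(a (i+1))\<close> applied to one in which
  both exponents are zero, where \<open>s_i\<close> acts as \<open>opt i\<close>. The affine
  relations then force this value.\<close>

definition ops :: "nat \<Rightarrow> (idx, 'f::field) lop" where
  "ops i = mk (\<lambda>(a, S, w). ap (opsx i (a (Suc i)) (a i)) (bas (a(i := 0, Suc i := 0), S, w)))"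

lemma ops_bas: "ap (ops i) (bas (a, S, w)) =
    ap (opsx i (a (Suc i)) (a i)) (bas (a(i := 0, Suc i := 0), S, w))"
  by (simp add: ops_def)

lemma ops_bas_0:
  assumes "a i = 0" "a (Suc i) = 0"
  shows "ap (ops i) (bas (a, S, w)) = ap (opt i) (bas (a, S, w))"
proof -
  have "a(i := 0, Suc i := 0) = a" using assms by auto
  thus ?thesis using assms by (simp add: ops_bas)
qed

lemma opx_pow_bas: "ap (opx i ^ k) (bas (a, S, w)) = bas (a(i := a i + k), S, w)"
proof (induction k)
  case (Suc k)
  have "(a(i := a i + k))(i := Suc (a i + k)) = a(i := a i + Suc k)" by auto
  thus ?case by (simp add: Suc del: fun_upd_apply) (simp add: fun_upd_def)
qed simp

lemma opx_pow_commute: "opx i ^ k * opx j = opx j * opx i ^ k"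
  by (simp add: power_commuting_commutes opx_commute)

lemma opx_left_commute: "opx i * (opx j * T) = opx j * (opx i * T)"
  by (simp only: mult.assoc[symmetric] opx_commute[of i j])

lemma opx_opc: "opx j * opc i = (if i = j then - (opc i * opx j) else opc i * opx j)"
  by (simp add: opc_opx)

lemma opx_opc_left: "opx j * (opc i * T) = (if i = j then - (opc i * (opx j * T)) else opc i * (opx j * T))"
proof -
  have "opx j * (opc i * T) = (opx j * opc i) * T" by (simp only: mult.assoc)
  thus ?thesis unfolding opx_opc by (simp add: mult.assoc)
qed

lemma opx_opm: "opx i * opm i = opp i * opx i" "opx (Suc i) * opm i = opp i * opx (Suc i)"
  "opx i * opp i = opm i * opx i" "opx (Suc i) * opp i = opm i * opx (Suc i)"
  "j \<noteq> i \<Longrightarrow> j \<noteq> Suc i \<Longrightarrow> opx j * opp i = opp i * opx j"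
  "j \<noteq> i \<Longrightarrow> j \<noteq> Suc i \<Longrightarrow> opx j * opm i = opm i * opx j"
  by (simp_all add: opp_def opm_def algebra_simps opx_opc opx_opc_left)

lemma opc_left_sq [simp]: "opc i * (opc i * T) = T"
  by (simp add: mult.assoc[symmetric] opc_sq)

lemma opc_swap: "opc (Suc i) * opc i = - (opc i * opc (Suc i))"
  by (rule opc_anticommute) simp

lemma opc_swap_left: "opc (Suc i) * (opc i * T) = - (opc i * (opc (Suc i) * T))"
  by (simp add: mult.assoc[symmetric] opc_swap)

lemma opc_opp: "opp i * opc i = - (opc (Suc i) * opp i)" "opm i * opc (Suc i) = - (opc i * opm i)"
  "opp i * opc (Suc i) = opc i * opp i" "opm i * opc i = opc (Suc i) * opm i"
  by (simp_all add: opp_def opm_def algebra_simps opc_sq opc_swap opc_swap_left)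

lemma opc_pair_commute:
  assumes "j \<noteq> i" "j \<noteq> Suc i"
  shows "opc i * opc (Suc i) * opc j = opc j * (opc i * opc (Suc i) :: (idx, 'f::field) lop)"
proof -
  have "opc i * opc (Suc i) * opc j = opc i * (opc (Suc i) * opc j :: (idx, 'f) lop)"
    by (simp only: mult.assoc)
  also have "opc (Suc i) * opc j = - (opc j * opc (Suc i) :: (idx, 'f) lop)"
    by (rule opc_anticommute) (use assms in simp)
  also have "opc i * - (opc j * opc (Suc i)) = - (opc i * opc j) * (opc (Suc i) :: (idx, 'f) lop)"
    by (simp only: mult.assoc mult_minus_left mult_minus_right)
  also have "- (opc i * opc j) = (opc j * opc i :: (idx, 'f) lop)"
    using assms by (simp add: opc_anticommute[of i j])
  finally show ?thesis by (simp only: mult.assoc)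
qed

lemma opc_opp_other:
  assumes "j \<noteq> i" "j \<noteq> Suc i"
  shows "opp i * opc j = opc j * opp i" "opm i * opc j = opc j * opm i"
  unfolding opp_def opm_def by (simp_all add: distrib_left distrib_right left_diff_distrib right_diff_distrib
    opc_pair_commute[OF assms])

text \<open>\<open>opsx\<close> peels off the powers of \<open>x_i\<close> first; this is the
  matching recursion in \<open>x_(i+1)\<close>, hence the consistency of the definition. The term
  created when \<open>x_(i+1)\<close> passes \<open>opm i\<close> cancels the one that comes from
  raising \<open>b\<close>.\<close>

lemma opsx_Suc: "opsx i (Suc b) k = opx i * opsx i b k + (opm i * opx i ^ k * opx (Suc i) ^ b :: (idx, 'f::field) lop)"
proof (induction k)
  case (Suc k)
  have "opsx i (Suc b) (Suc k) = opx (Suc i) * opx i * (opsx i b k :: (idx, 'f) lop)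
      + opx (Suc i) * opm i * opx i ^ k * opx (Suc i) ^ b - opp i * opx i ^ k * opx (Suc i) ^ Suc b"
    using Suc by (simp add: algebra_simps)
  also have "opx (Suc i) * opm i * (opx i :: (idx, 'f) lop) ^ k * opx (Suc i) ^ b = opp i * (opx (Suc i) * opx i ^ k) * opx (Suc i) ^ b"
    by (simp add: opx_opm mult.assoc)
  also have "\<dots> = opp i * opx i ^ k * opx (Suc i) ^ Suc b"
    by (simp add: opx_pow_commute[symmetric] mult.assoc)
  also have "opx (Suc i) * opx i * opsx i b k + (opp i :: (idx, 'f) lop) * opx i ^ k * opx (Suc i) ^ Suc b - opp i * opx i ^ k * opx (Suc i) ^ Suc b
      = opx i * (opx (Suc i) * opsx i b k - opp i * opx i ^ k * opx (Suc i) ^ b)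
        + opx i * opp i * opx i ^ k * opx (Suc i) ^ b"
    by (simp add: algebra_simps opx_left_commute[of i "Suc i"])
  finally show ?case by (simp add: opx_opm mult.assoc)
qed simp

lemma ops_opx: "ops i * opx i = opx (Suc i) * ops i - (opp i :: (idx, 'f::field) lop)"
proof (rule lop_idx_eqI)
  fix a S w
  have "ap (opx i ^ a i) (ap (opx (Suc i) ^ a (Suc i)) (bas (a(i := 0, Suc i := 0), S, w))) = (bas (a, S, w) :: idx \<Rightarrow>\<^sub>0 'f)"
    by (simp add: opx_pow_bas fun_upd_twist)
  thus "ap (ops i * opx i) (bas (a, S, w) :: idx \<Rightarrow>\<^sub>0 'f) = ap (opx (Suc i) * ops i - opp i) (bas (a, S, w))"
    by (simp add: ops_bas)
qed

lemma ops_opx_Suc: "ops i * opx (Suc i) = opx i * ops i + (opm i :: (idx, 'f::field) lop)"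
proof (rule lop_idx_eqI)
  fix a S w
  have "ap (opx i ^ a i) (ap (opx (Suc i) ^ a (Suc i)) (bas (a(i := 0, Suc i := 0), S, w))) = (bas (a, S, w) :: idx \<Rightarrow>\<^sub>0 'f)"
    by (simp add: opx_pow_bas fun_upd_twist)
  thus "ap (ops i * opx (Suc i)) (bas (a, S, w) :: idx \<Rightarrow>\<^sub>0 'f) = ap (opx i * ops i + opm i) (bas (a, S, w))"
    by (simp add: ops_bas opsx_Suc fun_upd_twist)
qed

text \<open>Basis vectors arise from those with zero exponents on \<open>I\<close> by applying
  \<open>opx i\<close>. If \<open>D\<close> is the difference of the two sides of a relation and can
  be moved past every \<open>opx i\<close>, only zero exponents remain to be checked, where
  \<open>ops\<close> is \<open>opt\<close>. The remaining relations of \<open>ops\<close> are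
  obtained in this way.\<close>

lemma lop_eq_0_by_generation:
  assumes "finite I" and comm: "\<And>i. i \<in> I \<Longrightarrow> \<exists>A. D * opx i = A * D"
    and base: "\<And>a S w. \<forall>i\<in>I. a i = 0 \<Longrightarrow> ap D (bas (a, S, w)) = 0"
  shows "D = 0"
proof (rule lop_idx_eqI)
  fix a S w
  show "ap D (bas (a, S, w)) = ap 0 (bas (a, S, w))"
  proof (induction "\<Sum>i\<in>I. a i" arbitrary: a)
    case 0
    thus ?case using base assms(1) by simp
  next
    case (Suc m)
    then obtain i where i: "i \<in> I" "a i \<noteq> 0" by (metis nat.simps(3) sum.neutral)
    then obtain k where k: "a i = Suc k" by (cases "a i") auto
    obtain A where A: "D * opx i = A * D" using comm i by blast
    have "(\<Sum>j\<in>I. (a(i := k)) j) = m"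
      using Suc(2) i k assms(1) by (simp add: sum.remove[of I i])
    from Suc(1)[of "a(i := k)"] this have "ap (A * D) (bas (a(i := k), S, w)) = 0" by simp
    moreover have "ap (D * opx i) (bas (a(i := k), S, w)) = ap D (bas (a, S, w))"
    proof -
      have "(a(i := k))(i := Suc k) = a" using k by auto
      thus ?thesis by simp
    qed
    ultimately show ?case using A by simp
  qed
qed

lemma ops_opx_other:
  assumes "j \<noteq> i" "j \<noteq> Suc i"
  shows "ops i * opx j = opx j * (ops i :: (idx, 'f::field) lop)"
proof -
  let ?D = "ops i * opx j - opx j * ops i :: (idx, 'f) lop"
  have "?D = 0"
  proof (rule lop_eq_0_by_generation[of "{i, Suc i}"])
    fix k assume "k \<in> {i, Suc i}"
    moreover have "?D * opx i = opx (Suc i) * ?D"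
    proof -
      have "?D * opx i = (ops i * opx i) * opx j - opx j * (ops i * opx i)"
        by (simp add: left_diff_distrib right_diff_distrib mult.assoc opx_commute[of i j] opx_commute[of "Suc i" j])
      also have "\<dots> = opx (Suc i) * ?D"
        by (simp add: opx_opm(5)[OF assms] ops_opx algebra_simps opx_left_commute opx_commute)
      finally show ?thesis .
    qed
    moreover have "?D * opx (Suc i) = opx i * ?D"
    proof -
      have "?D * opx (Suc i) = (ops i * opx (Suc i)) * opx j - opx j * (ops i * opx (Suc i))"
        by (simp add: left_diff_distrib right_diff_distrib mult.assoc opx_commute[of i j] opx_commute[of "Suc i" j])
      also have "\<dots> = opx i * ?D"
        by (simp add: opx_opm(6)[OF assms] ops_opx_Suc algebra_simps opx_left_commute opx_commute)
      finally show ?thesis .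
    qed
    ultimately show "\<exists>A. ?D * opx k = A * ?D" by blast
  next
    fix a :: "nat \<Rightarrow> nat" and S w assume "\<forall>k\<in>{i, Suc i}. a k = 0"
    thus "ap ?D (bas (a, S, w)) = 0"
      using assms by (auto simp: ops_bas_0 upd_comp_tp tp_apply)
  qed simp
  thus ?thesis by simp
qed

lemma ops_opc: "ops i * opc j = opc (tp i j) * (ops i :: (idx, 'f::field) lop)"
proof -
  let ?D = "ops i * opc j - opc (tp i j) * ops i :: (idx, 'f) lop"
  \<comment> \<open>The signs that arise when \<open>c_j\<close> passes \<open>x_i\<close> and
    \<open>x_(i+1)\<close>; with them the terms in \<open>opp i\<close> and \<open>opm i\<close>
    cancel.\<close>
  define \<epsilon> \<epsilon>' :: "(idx, 'f) lop"
    where "\<epsilon> = (if i = j then -1 else 1)" and "\<epsilon>' = (if Suc i = j then -1 else 1)"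
  have c: "j = i \<or> j = Suc i \<or> (j \<noteq> i \<and> j \<noteq> Suc i)" by blast
  have xc: "opc j * opx k = (if k = j then - (opx k * opc j) else opx k * opc j :: (idx, 'f) lop)" for k
    by (auto simp: opc_opx)
  have xc': "opc (tp i j) * opx k = (if k = tp i j then - (opx k * opc (tp i j)) else opx k * opc (tp i j) :: (idx, 'f) lop)" for k
    by (auto simp: opc_opx)
  have p: "opp i * opc j = (if i = j then - (opc (tp i j) * opp i) else opc (tp i j) * opp i :: (idx, 'f) lop)"
    "opm i * opc j = (if Suc i = j then - (opc (tp i j) * opm i) else opc (tp i j) * opm i :: (idx, 'f) lop)"
    using c by (auto simp: opc_opp opc_opp_other tp_apply)
  have "?D = 0"
  proof (rule lop_eq_0_by_generation[of "{i, Suc i}"])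
    fix k assume "k \<in> {i, Suc i}"
    moreover have "?D * opx i = \<epsilon> * opx (Suc i) * ?D"
    proof -
      have "?D * opx i = ops i * (opc j * opx i) - opc (tp i j) * (ops i * opx i)"
        by (simp only: left_diff_distrib mult.assoc)
      also have "\<dots> = \<epsilon> * (ops i * opx i) * opc j - opc (tp i j) * (ops i * opx i)"
        by (simp add: xc \<epsilon>_def mult.assoc)
      also have "\<dots> = \<epsilon> * opx (Suc i) * (ops i * opc j) - \<epsilon> * (opp i * opc j)
          - (opc (tp i j) * opx (Suc i)) * ops i + opc (tp i j) * opp i"
        unfolding ops_opx by (simp add: left_diff_distrib right_diff_distrib mult.assoc)
      also have "\<dots> = \<epsilon> * opx (Suc i) * (ops i * opc j) - \<epsilon> * (opx (Suc i) * opc (tp i j)) * ops i"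
        unfolding p xc' by (auto simp: \<epsilon>_def tp_apply)
      finally show ?thesis by (simp only: right_diff_distrib mult.assoc)
    qed
    moreover have "?D * opx (Suc i) = \<epsilon>' * opx i * ?D"
    proof -
      have "?D * opx (Suc i) = ops i * (opc j * opx (Suc i)) - opc (tp i j) * (ops i * opx (Suc i))"
        by (simp only: left_diff_distrib mult.assoc)
      also have "\<dots> = \<epsilon>' * (ops i * opx (Suc i)) * opc j - opc (tp i j) * (ops i * opx (Suc i))"
        by (simp add: xc \<epsilon>'_def mult.assoc)
      also have "\<dots> = \<epsilon>' * opx i * (ops i * opc j) + \<epsilon>' * (opm i * opc j)
          - (opc (tp i j) * opx i) * ops i - opc (tp i j) * opm i"
        unfolding ops_opx_Suc by (simp add: distrib_left distrib_right mult.assoc)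
      also have "\<dots> = \<epsilon>' * opx i * (ops i * opc j) - \<epsilon>' * (opx i * opc (tp i j)) * ops i"
        unfolding p xc' by (auto simp: \<epsilon>'_def tp_apply)
      finally show ?thesis by (simp only: right_diff_distrib mult.assoc)
    qed
    ultimately show "\<exists>A. ?D * opx k = A * ?D" by blast
  next
    fix a :: "nat \<Rightarrow> nat" and S w assume z: "\<forall>k\<in>{i, Suc i}. a k = 0"
    have "ap (ops i) (ap (opc j) (bas (a, S, w))) = ap (opt i) (ap (opc j) (bas (a, S, w) :: idx \<Rightarrow>\<^sub>0 'f))"
      using z by (auto simp: ops_bas_0 single_uminus ap_uminus simp del: opt_bas)
    moreover have "ap (opc (tp i j)) (ap (ops i) (bas (a, S, w))) = ap (opc (tp i j)) (ap (opt i) (bas (a, S, w) :: idx \<Rightarrow>\<^sub>0 'f))"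
      using z by (simp add: ops_bas_0 del: opt_bas)
    moreover have "ap (opt i) (ap (opc j) v) = ap (opc (tp i j)) (ap (opt i) v)" for v :: "idx \<Rightarrow>\<^sub>0 'f"
      by (simp only: ap_simps(6)[symmetric] opt_opc)
    ultimately show "ap ?D (bas (a, S, w)) = 0"
      by (simp del: opt_bas opc_bas)
  qed simp
  thus ?thesis by simp
qed

lemma mult_left_ext: "A * B = C \<Longrightarrow> A * (B * T) = C * (T :: 'r::ring_1)"
  by (simp add: mult.assoc[symmetric])

lemma ops_opp: "ops i * opp i = opm i * ops i" "ops i * opm i = opp i * ops i"
  by (simp_all add: opp_def opm_def algebra_simps ops_opc ops_opc[THEN mult_left_ext] tp_apply opc_swap_left opc_swap)

lemma ops_sq: "ops i * ops i = (1 :: (idx, 'f::field) lop)"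
proof -
  let ?D = "ops i * ops i - 1 :: (idx, 'f) lop"
  have "?D = 0"
  proof (rule lop_eq_0_by_generation[of "{i, Suc i}"])
    fix k assume "k \<in> {i, Suc i}"
    moreover have "?D * opx i = opx i * ?D" "?D * opx (Suc i) = opx (Suc i) * ?D"
      by (simp_all add: algebra_simps ops_opx ops_opx_Suc ops_opx[THEN mult_left_ext]
        ops_opx_Suc[THEN mult_left_ext] ops_opp)
    ultimately show "\<exists>A. ?D * opx k = A * ?D" by blast
  next
    fix a :: "nat \<Rightarrow> nat" and S w assume z: "\<forall>k\<in>{i, Suc i}. a k = 0"
    have z': "(a \<circ> tp i) i = 0" "(a \<circ> tp i) (Suc i) = 0" using z by (auto simp: tp_apply)
    have "ap (ops i) (ap (ops i) (bas (a, S, w))) = ap (opt i) (ap (opt i) (bas (a, S, w) :: idx \<Rightarrow>\<^sub>0 'f))"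
      using z z' by (auto simp: ops_bas_0 single_uminus ap_uminus)
    thus "ap ?D (bas (a, S, w)) = 0" by (simp add: opt_sq flip: ap_simps(6) del: opt_bas)
  qed simp
  thus ?thesis by simp
qed

lemma ops_left_sq [simp]: "ops i * (ops i * T) = T"
  by (simp add: mult.assoc[symmetric] ops_sq)

lemma ops_commute_pp:
  assumes "Suc i < j"
  shows "ops i * opp j = opp j * ops i" "ops j * opp i = opp i * ops j"
    "ops i * opm j = opm j * ops i" "ops j * opm i = opm i * ops j"
  using assms by (simp_all add: opp_def opm_def algebra_simps ops_opc ops_opc[THEN mult_left_ext] tp_apply)

lemma ops_commute:
  assumes "Suc i < j"
  shows "ops i * ops j = ops j * (ops i :: (idx, 'f::field) lop)"
proof -
  let ?D = "ops i * ops j - ops j * ops i :: (idx, 'f) lop"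
  note pp = ops_commute_pp[OF assms]
  have o: "ops i * opx j = opx j * ops i" "ops i * opx (Suc j) = opx (Suc j) * ops i"
    "ops j * opx i = opx i * ops j" "ops j * opx (Suc i) = opx (Suc i) * ops j" for i' :: nat
    using assms by (simp_all add: ops_opx_other)
  have "?D = 0"
  proof (rule lop_eq_0_by_generation[of "{i, Suc i, j, Suc j}"])
    fix k assume "k \<in> {i, Suc i, j, Suc j}"
    moreover have "?D * opx i = opx (Suc i) * ?D" "?D * opx (Suc i) = opx i * ?D"
      "?D * opx j = opx (Suc j) * ?D" "?D * opx (Suc j) = opx j * ?D"
      using assms by (simp_all add: algebra_simps ops_opx ops_opx_Suc ops_opx[THEN mult_left_ext]
        ops_opx_Suc[THEN mult_left_ext] ops_opx_other ops_opx_other[THEN mult_left_ext] pp)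
    ultimately show "\<exists>A. ?D * opx k = A * ?D" by blast
  next
    fix a :: "nat \<Rightarrow> nat" and S w assume z: "\<forall>k\<in>{i, Suc i, j, Suc j}. a k = 0"
    have z': "\<forall>k\<in>{i, Suc i, j, Suc j}. (a \<circ> tp i) k = 0" "\<forall>k\<in>{i, Suc i, j, Suc j}. (a \<circ> tp j) k = 0"
      using z by (auto simp: tp_apply)
    have "ap (ops i) (ap (ops j) (bas (a, S, w))) = ap (opt i) (ap (opt j) (bas (a, S, w) :: idx \<Rightarrow>\<^sub>0 'f))"
      "ap (ops j) (ap (ops i) (bas (a, S, w))) = ap (opt j) (ap (opt i) (bas (a, S, w) :: idx \<Rightarrow>\<^sub>0 'f))"
      using z z' by (auto simp: ops_bas_0 single_uminus ap_uminus)
    thus "ap ?D (bas (a, S, w)) = 0" by (simp add: opt_commute[OF assms] flip: ap_simps(6) del: opt_bas)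
  qed simp
  thus ?thesis by simp
qed

lemma ops_braid: "ops i * ops (Suc i) * ops i = ops (Suc i) * ops i * (ops (Suc i) :: (idx, 'f::field) lop)"
proof -
  define k l where "k = Suc i" and "l = Suc k"
  let ?D = "ops i * ops k * ops i - ops k * ops i * ops k :: (idx, 'f) lop"
  have d: "i \<noteq> k" "k \<noteq> i" "i \<noteq> l" "l \<noteq> i" "k \<noteq> l" "l \<noteq> k" by (simp_all add: k_def l_def)
  have x: "ops i * opx i = opx k * ops i - opp i" "ops i * opx k = opx i * ops i + opm i"
    "ops k * opx k = opx l * ops k - opp k" "ops k * opx l = opx k * ops k + opm k"
    "ops i * opx l = opx l * ops i" "ops k * opx i = opx i * (ops k :: (idx, 'f) lop)"
    by (simp_all add: k_def l_def ops_opx ops_opx_Suc ops_opx_other)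
  have c: "ops i * opc i = opc k * ops i" "ops i * opc k = opc i * ops i" "ops i * opc l = opc l * ops i"
    "ops k * opc k = opc l * ops k" "ops k * opc l = opc k * ops k" "ops k * opc i = opc i * (ops k :: (idx, 'f) lop)"
    by (simp_all add: ops_opc) (simp_all add: tp_apply k_def l_def)
  have pp: "opp i = 1 + opc i * opc k" "opp k = 1 + opc k * opc l" "opm i = 1 - opc i * opc k"
    "opm k = 1 - opc k * (opc l :: (idx, 'f) lop)"
    by (simp_all add: k_def l_def opp_def opm_def)
  have ac: "opc k * opc i = - (opc i * opc k)" "opc l * opc i = - (opc i * opc l)"
    "opc l * opc k = - (opc k * (opc l :: (idx, 'f) lop))"
    using d by (simp_all add: opc_anticommute[of k i] opc_anticommute[of l i] opc_anticommute[of l k])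
  have "?D = 0"
  proof (rule lop_eq_0_by_generation[of "{i, k, l}"])
    fix j assume "j \<in> {i, k, l}"
    \<comment> \<open>Both triple products exchange the indices \<open>i\<close> and
      \<open>l\<close> and fix \<open>k\<close>; the correction terms of the two sides cancel once
      the Clifford letters are sorted.\<close>
    moreover have "?D * opx i = opx l * ?D" "?D * opx k = opx k * ?D" "?D * opx l = opx i * ?D"
      by (simp_all add: algebra_simps x x[THEN mult_left_ext] pp c c[THEN mult_left_ext] ops_sq
         ac ac[THEN mult_left_ext])
    ultimately show "\<exists>A. ?D * opx j = A * ?D" by blast
  next
    fix a :: "nat \<Rightarrow> nat" and S w assume "\<forall>j\<in>{i, k, l}. a j = 0"
    hence z: "a i = 0" "a (Suc i) = 0" "a (Suc (Suc i)) = 0" by (simp_all add: k_def l_def)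
    have "ap (ops i) (ap (ops k) (ap (ops i) (bas (a, S, w)))) =
      ap (opt i) (ap (opt k) (ap (opt i) (bas (a, S, w) :: idx \<Rightarrow>\<^sub>0 'f)))"
      "ap (ops k) (ap (ops i) (ap (ops k) (bas (a, S, w)))) =
      ap (opt k) (ap (opt i) (ap (opt k) (bas (a, S, w) :: idx \<Rightarrow>\<^sub>0 'f)))"
      using z by (simp_all add: k_def ops_bas_0 single_uminus ap_uminus tp_apply)
    thus "ap ?D (bas (a, S, w)) = 0" unfolding k_def
      by (simp add: opt_braid flip: ap_simps(6) mult.assoc del: opt_bas)
  qed simp
  thus ?thesis by (simp add: k_def)
qed

section \<open>The cyclotomic operators\<close>

lemma scalar_left_commute: "A * (scalar z * B) = scalar z * (A * B)"
  by (simp only: mult.assoc[symmetric] scalar_commute[of z A])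

lemma opx_even_pow_opc:
  assumes "even k"
  shows "opx i ^ k * opc j = opc j * opx i ^ k"
proof -
  have "opx i * opx i * opc j = opc j * (opx i * opx i)"
    by (simp add: mult.assoc opx_opc opx_opc_left)
  from power_commuting_commutes[OF this, of "k div 2"] show ?thesis
    using assms by (simp add: power_mult[symmetric] flip: power2_eq_square)
qed

text \<open>Newton's recursion expresses \<open>A^m + B^m\<close> through \<open>A + B\<close>,
  \<open>A * B\<close> and the two preceding power sums. It will be applied to the squares of
  \<open>x_i\<close> and \<open>x_(i+1)\<close>, whose sum and product commute with
  \<open>s_i\<close>.\<close>

lemma commutes_power_sum:
  fixes s A B :: "'r::ring_1"
  assumes AB: "A * B = B * A" and p: "s * (A * B) = A * B * s" and q: "s * (A + B) = (A + B) * s"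
  shows "s * (A ^ m + B ^ m) = (A ^ m + B ^ m) * s"
proof (induction m rule: less_induct)
  case (less m)
  consider "m = 0" | "m = 1" | k where "m = Suc (Suc k)" by (metis One_nat_def not0_implies_Suc)
  then show ?case
  proof cases
    case 3
    have rec: "A ^ m + B ^ m = (A + B) * (A ^ Suc k + B ^ Suc k) - A * B * (A ^ k + B ^ k)"
      using 3 by (simp add: algebra_simps AB AB[THEN mult_left_ext])
    have "s * ((A + B) * (A ^ Suc k + B ^ Suc k)) = (A + B) * (s * (A ^ Suc k + B ^ Suc k))"
      by (simp only: mult.assoc[symmetric] q)
    also have "\<dots> = (A + B) * (A ^ Suc k + B ^ Suc k) * s"
      using less[of "Suc k"] 3 by (simp add: mult.assoc)
    finally have 1: "s * ((A + B) * (A ^ Suc k + B ^ Suc k)) = (A + B) * (A ^ Suc k + B ^ Suc k) * s" .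
    have "s * (A * B * (A ^ k + B ^ k)) = A * B * (s * (A ^ k + B ^ k))"
      using p by (simp only: mult.assoc[symmetric])
    also have "\<dots> = A * B * (A ^ k + B ^ k) * s"
      using less[of k] 3 by (simp add: mult.assoc)
    finally show ?thesis using 1 unfolding rec by (simp only: right_diff_distrib left_diff_distrib)
  qed (use q in \<open>auto simp: algebra_simps mult_2 mult_2_right\<close>)
qed

lemma ops_opx_sq_sum:
  "ops i * (opx i ^ (2 * m) + opx (Suc i) ^ (2 * m)) = (opx i ^ (2 * m) + opx (Suc i) ^ (2 * m)) * ops i"
  unfolding power_mult
  by (rule commutes_power_sum)
    (simp_all add: power2_eq_square algebra_simps ops_opx ops_opx_Suc ops_opx[THEN mult_left_ext]
      ops_opx_Suc[THEN mult_left_ext] opx_opm opx_opm[THEN mult_left_ext] opx_left_commute opx_commute)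

text \<open>The first two hypotheses give \<open>s * b = a * s + e\<close>; in
  \<open>s * (a * b)\<close> the two corrections \<open>e * b\<close> and \<open>b * e\<close> then
  cancel. The case of interest is \<open>a = G 1\<close>, \<open>b = G 2\<close>.\<close>

lemma symmetric_product_commutes:
  fixes s :: "'r::ring_1"
  assumes "s * a = b * s - e" "s * (a + b) = (a + b) * s" "e * b = b * e" "b * a = a * b"
  shows "s * (a * b) = a * b * s"
proof -
  have s2: "s * b = a * s + e"
    using assms(2) unfolding distrib_left distrib_right assms(1) by (simp add: algebra_simps)
  have "s * (a * b) = b * (s * b) - e * b"
    unfolding mult.assoc[symmetric] assms(1) left_diff_distrib ..
  thus ?thesis unfolding s2 assms(3) distrib_left mult.assoc[symmetric] assms(4) by simp
qed

text \<open>For \<open>opX 2\<close>: with \<open>x - u\<close> as \<open>opX 1\<close>, the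
  conjugate of \<open>x\<close> together with \<open>p * s\<close> is exactly \<open>y\<close>, so
  only \<open>u\<close> remains conjugated.\<close>

lemma conjugate_reduction:
  fixes s :: "'r::ring_1"
  assumes "s * x = y * s - p" "s * s = 1"
  shows "s * (x - u) * s + p * s = y - s * u * s"
proof -
  have 1: "s * (x - u) * s = (s * x) * s - s * u * s"
    by (simp only: right_diff_distrib left_diff_distrib)
  have 2: "(s * x) * s = y * (s * s) - p * s"
    unfolding assms(1) by (simp only: left_diff_distrib mult.assoc)
  show ?thesis unfolding 1 2 assms(2) by (simp add: algebra_simps)
qed

text \<open>Here \<open>x - u\<close> is \<open>opX 1\<close> and \<open>y - s * u * s\<close> is
  \<open>opX 2\<close>. Everything that contains \<open>x\<close> or \<open>y\<close> cancels; what
  is left are two corrections linear in \<open>u\<close> and the terms quadratic in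
  \<open>u\<close>.\<close>

lemma commutator_expansion:
  fixes s x y p m u :: "'r::ring_1"
  assumes sx: "s * x = y * s - p" and xs: "x * s = s * y - m" and sm: "s * m = p * s"
    and yu: "y * u = u * y" and up: "u * p = m * u" and xy: "x * y = y * x"
  shows "(x - u) * (y - s * u * s) - (y - s * u * s) * (x - u) = m * u * s - p * s * u + u * s * u * s - s * u * s * u"
proof -
  have A1: "(x - u) * (y - s * u * s) = x * y - (x * s) * (u * s) - u * y + u * s * u * s"
    by (simp add: left_diff_distrib right_diff_distrib mult.assoc)
  have A2: "(x * s) * (u * s) = s * (y * u) * s - m * u * s"
    unfolding xs by (simp only: left_diff_distrib mult.assoc)
  have B1: "(y - s * u * s) * (x - u) = y * x - s * u * (s * x) - y * u + s * u * s * u"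
    by (simp add: left_diff_distrib right_diff_distrib mult.assoc)
  have B2: "s * u * (s * x) = s * (u * y) * s - s * (u * p)"
    unfolding sx by (simp only: right_diff_distrib mult.assoc)
  have B3: "s * (u * p) = p * s * u"
    unfolding up by (simp only: mult.assoc[symmetric] sm)
  show ?thesis unfolding A1 A2 B1 B2 B3 xy yu by (simp add: algebra_simps)
qed

text \<open>Read with \<open>r = rho\<close> and \<open>C = G 1 * G 2\<close>: the term
  \<open>m * u\<close> in \<open>u * s * u\<close> absorbs both corrections that are linear in
  \<open>u\<close>.\<close>

lemma commutator_reduction:
  fixes s p m u r C :: "'r::ring_1"
  assumes usu: "u * s * u = C * (r * s * r) - m * u" and sC: "s * C = C * s" and sm: "s * m = p * s"
  shows "m * u * s - p * s * u + u * s * u * s - s * u * s * u = C * (r * s * r * s - s * r * s * r)"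
proof -
  have "s * (u * s * u) = (s * C) * (r * s * r) - (s * m) * u"
    unfolding usu by (simp only: right_diff_distrib mult.assoc)
  hence 3: "s * (u * s * u) = C * (s * r * s * r) - p * s * u"
    unfolding sC sm by (simp only: mult.assoc)
  have "m * u * s - p * s * u + u * s * u * s - s * u * s * u = m * u * s - p * s * u + (u * s * u) * s - s * (u * s * u)"
    by (simp only: mult.assoc)
  also have "\<dots> = m * u * s - p * s * u + (C * (r * s * r) * s - m * u * s) - (C * (s * r * s * r) - p * s * u)"
    unfolding 3 unfolding usu left_diff_distrib ..
  finally show ?thesis by (simp add: algebra_simps)
qed

section \<open>The generators \<open>x_i\<close> modulo \<open>g(x_1)\<close>\<close>

locale cyclotomic_model =
  fixes d :: nat and g :: "'f::field poly"
  assumes d_pos: "d \<ge> 2" and d_even: "even d" and degree_g: "degree g = d"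
    and lead_g: "coeff g d = 1" and g_even: "\<And>k. odd k \<Longrightarrow> coeff g k = 0"
begin

definition G :: "nat \<Rightarrow> (idx, 'f) lop" where
  "G j = (\<Sum>k\<le>d. scalar (coeff g k) * opx j ^ k)"

text \<open>Extracts the coefficient of \<open>x_1^(d-1)\<close>. For exponents below
  \<open>d\<close> this is the part on which multiplication by \<open>x_1\<close> overflows, and
  subtracting \<open>G 1 * rho\<close> there replaces \<open>x_1^d\<close> by its remainder modulo
  the monic polynomial \<open>g\<close>.\<close>

definition rho :: "(idx, 'f) lop" where
  "rho = mk (\<lambda>(a, S, w). if a 1 = d - 1 then bas (a(1 := 0), S, w) else 0)"

lemma rho_bas: "ap rho (Poly_Mapping.single (a, S, w) z) =
    (if a 1 = d - 1 then Poly_Mapping.single (a(1 := 0), S, w) z else 0)"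
  by (subst ap_single) (simp add: rho_def)

lemma G_commute:
  assumes "\<And>k. even k \<Longrightarrow> T * opx j ^ k = opx j ^ k * T"
  shows "T * G j = G j * T"
proof -
  have "T * (scalar (coeff g k) * opx j ^ k) = scalar (coeff g k) * opx j ^ k * T" for k
    using assms[of k] by (cases "even k") (simp_all add: g_even scalar_left_commute mult.assoc)
  thus ?thesis by (simp add: G_def sum_distrib_left sum_distrib_right)
qed

lemma G_opx: "opx i * G j = G j * opx i"
  by (rule G_commute) (simp add: opx_pow_commute)

lemma G_opc: "opc i * G j = G j * opc i"
  by (rule G_commute) (simp add: opx_even_pow_opc)

lemma G_opp: "opp i * G j = G j * opp i" "opm i * G j = G j * opm i"
  by (simp_all add: opp_def opm_def algebra_simps G_opc G_opc[THEN mult_left_ext])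

lemma G_ops_other:
  assumes "j \<noteq> i" "j \<noteq> Suc i"
  shows "ops i * G j = G j * ops i"
  by (rule G_commute) (metis assms ops_opx_other power_commuting_commutes)

lemma G_G: "G i * G j = G j * G i"
  by (rule G_commute) (metis G_opx power_commuting_commutes)

lemma rho_opx: "j \<noteq> 1 \<Longrightarrow> rho * opx j = opx j * rho"
  by (rule lop_idx_eqI) (auto simp: rho_bas fun_upd_twist)

text \<open>\<open>rho\<close> removes \<open>x_1^(d-1)\<close>, an odd power since \<open>d\<close>
  is even. So it anticommutes with \<open>c_1\<close> as \<open>x_1\<close> does, and
  \<open>opx 1 - G 1 * rho\<close> inherits the relation.\<close>

lemma rho_opc: "rho * opc j = (if j = 1 then - (opc j * rho) else opc j * rho)"
proof (rule lop_idx_eqI)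
  fix a S w
  have "odd (d - 1)" using d_pos d_even by simp
  thus "ap (rho * opc j) (bas (a, S, w)) = ap (if j = 1 then - (opc j * rho) else opc j * rho) (bas (a, S, w))"
    by (auto simp: rho_bas single_uminus ap_uminus)
qed

lemma rho_opp: "rho * opp 1 = opm 1 * rho" "rho * opm 1 = opp 1 * rho"
  "i \<ge> 2 \<Longrightarrow> rho * opp i = opp i * rho" "i \<ge> 2 \<Longrightarrow> rho * opm i = opm i * rho"
  by (simp_all add: opp_def opm_def algebra_simps rho_opc rho_opc[THEN mult_left_ext])

lemma rho_ops:
  assumes "i \<ge> 2"
  shows "rho * ops i = ops i * rho"
proof -
  let ?D = "rho * ops i - ops i * rho"
  have "?D = 0"
  proof (rule lop_eq_0_by_generation[of "{i, Suc i}"])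
    fix k assume "k \<in> {i, Suc i}"
    moreover have "?D * opx i = opx (Suc i) * ?D" "?D * opx (Suc i) = opx i * ?D"
      using assms by (simp_all add: algebra_simps ops_opx ops_opx_Suc ops_opx[THEN mult_left_ext]
        ops_opx_Suc[THEN mult_left_ext] rho_opx rho_opx[THEN mult_left_ext] rho_opp)
    ultimately show "\<exists>A. ?D * opx k = A * ?D" by blast
  next
    fix a :: "nat \<Rightarrow> nat" and S w assume z: "\<forall>k\<in>{i, Suc i}. a k = 0"
    have "(a(1 := 0)) \<circ> tp i = (a \<circ> tp i)(1 := 0)" using assms by (auto simp: fun_eq_iff tp_apply)
    thus "ap ?D (bas (a, S, w)) = 0"
      using z assms by (auto simp: ops_bas_0 rho_bas tp_apply)
  qed simp
  thus ?thesis by simp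
qed

text \<open>The recursion is the relation between \<open>s_i\<close> and \<open>x_i\<close>,
  multiplied by \<open>s_i\<close> from the right and solved for \<open>x_(i+1)\<close>. The value
  at 0 is a dummy.\<close>

fun opX :: "nat \<Rightarrow> (idx, 'f) lop" where
  "opX 0 = 0"
| "opX (Suc 0) = opx 1 - G 1 * rho"
| "opX (Suc (Suc i)) = ops (Suc i) * opX (Suc i) * ops (Suc i) + opp (Suc i) * ops (Suc i)"

lemma opX_1: "opX 1 = opx 1 - G 1 * rho" by simp
lemma opX_Suc: "i \<ge> 1 \<Longrightarrow> opX (Suc i) = ops i * opX i * ops i + opp i * ops i"
  by (cases i) simp_all

declare opX.simps [simp del]

lemma opX_opc:
  assumes "i \<ge> 1"
  shows "opX i * opc j = (if i = j then - (opc j * opX i) else opc j * opX i)"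
  using assms
proof (induction i arbitrary: j rule: dec_induct)
  case base
  show ?case by (simp only: opX_1) (simp add: algebra_simps opx_opc rho_opc rho_opc[THEN mult_left_ext] G_opc G_opc[THEN mult_left_ext])
next
  case (step i)
  have t: "ops i * (opX i * (ops i * opc j)) = (if j = Suc i then - (opc j * (ops i * (opX i * ops i))) else opc j * (ops i * (opX i * ops i)))"
    using step(3)[of "tp i j"] step(3)[of "tp i j", THEN mult_left_ext]
    by (auto simp: ops_opc ops_opc[THEN mult_left_ext] mult.assoc tp_apply)
  have p: "opp i * (ops i * opc j) = (if j = Suc i then - (opc j * (opp i * ops i)) else opc j * (opp i * (ops i :: (idx, 'f) lop)))"
    using opc_opp(1,3)[THEN mult_left_ext] opc_opp_other(1)[THEN mult_left_ext]
    by (auto simp: ops_opc tp_apply opc_opp(1,3)[THEN mult_left_ext] opc_opp_other(1)[THEN mult_left_ext] mult.assoc)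
  show ?case unfolding opX_Suc[OF step(1)] by (simp add: distrib_right distrib_left mult.assoc t p)
qed

lemma opX_opp: "i \<ge> 1 \<Longrightarrow> j \<noteq> i \<Longrightarrow> j \<noteq> Suc i \<Longrightarrow> j \<ge> 1 \<Longrightarrow> opX j * opp i = opp i * opX j"
  by (simp add: opp_def algebra_simps opX_opc opX_opc[THEN mult_left_ext])

lemma opX_ops_below:
  assumes "i \<ge> 1" "i < j"
  shows "opX i * ops j = ops j * opX i"
  using assms
proof (induction i arbitrary: j rule: dec_induct)
  case base
  hence "ops j * opx 1 = opx 1 * ops j" "ops j * G 1 = G 1 * ops j" "rho * ops j = ops j * rho"
    by (simp_all add: ops_opx_other G_ops_other rho_ops)
  note c = this(1,3) this(2)[symmetric]
  show ?case unfolding opX_1 by (simp only: algebra_simps c c[THEN mult_left_ext])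
next
  case (step i)
  have c: "opX i * ops j = ops j * opX i" "ops i * ops j = ops j * (ops i :: (idx, 'f) lop)"
    "opp i * ops j = ops j * (opp i :: (idx, 'f) lop)"
    using step by (auto intro: ops_commute ops_commute[symmetric] simp: ops_commute_pp)
  show ?case using step(1) by (simp add: opX_Suc algebra_simps c c[THEN mult_left_ext])
qed

lemma ops_opX: "i \<ge> 1 \<Longrightarrow> ops i * opX i = opX (Suc i) * ops i - opp i"
  by (simp add: opX_Suc algebra_simps ops_sq)

text \<open>For \<open>j = i + 2\<close> the operator is expressed through \<open>opX i\<close>, and
  the braid relation carries \<open>s_i\<close> through. Beyond that it is enough that
  \<open>s_i\<close> commutes with \<open>s_j\<close>.\<close>

lemma opX_ops_above:
  assumes "i \<ge> 1" "Suc (Suc i) \<le> j"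
  shows "opX j * ops i = ops i * opX j"
  using assms(2)
proof (induction j rule: dec_induct)
  case base
  define k l where "k = Suc i" and "l = Suc k"
  have d: "i \<noteq> k" "k \<noteq> i" "i \<noteq> l" "l \<noteq> i" "k \<noteq> l" "l \<noteq> k" by (simp_all add: k_def l_def)
  have c: "ops i * opc i = opc k * ops i" "ops i * opc k = opc i * ops i" "ops i * opc l = opc l * ops i"
    "ops k * opc k = opc l * ops k" "ops k * opc l = opc k * ops k" "ops k * opc i = opc i * (ops k :: (idx, 'f) lop)"
    by (simp_all add: ops_opc) (simp_all add: tp_apply k_def l_def)
  have pp: "opp i = 1 + opc i * opc k" "opp k = 1 + opc k * (opc l :: (idx, 'f) lop)"
    by (simp_all add: k_def l_def opp_def)
  have b: "ops i * (ops k * ops i) = ops k * (ops i * (ops k :: (idx, 'f) lop))"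
    by (simp only: k_def mult.assoc[symmetric] ops_braid)
  have b': "ops i * (ops k * (ops i * T)) = ops k * (ops i * (ops k * T))" for T :: "(idx, 'f) lop"
    by (simp only: k_def mult.assoc[symmetric] ops_braid)
  have x: "opX i * ops k = ops k * opX i" using assms(1) by (simp add: opX_ops_below k_def)
  have X: "opX l = ops k * (ops i * opX i * ops i + opp i * ops i) * ops k + opp k * ops k"
    using assms(1) by (simp add: k_def l_def opX_Suc)
  have "opX l * ops i = ops i * opX l"
    unfolding X by (simp add: algebra_simps pp c c[THEN mult_left_ext] b b' ops_sq x x[THEN mult_left_ext])
  thus ?case by (simp add: k_def l_def)
next
  case (step j)
  have c: "opX j * ops i = ops i * opX j" "ops j * ops i = ops i * (ops j :: (idx, 'f) lop)"
    "opp j * ops i = ops i * (opp j :: (idx, 'f) lop)"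
    using step by (auto intro: ops_commute ops_commute[symmetric] simp: ops_commute_pp)
  show ?case using step(1) assms by (simp add: opX_Suc algebra_simps c c[THEN mult_left_ext])
qed


section \<open>The commutator of \<open>opX 1\<close> and \<open>opX 2\<close> in closed
  form\<close>

definition opE :: "nat \<Rightarrow> (idx, 'f) lop" where
  "opE k = (\<Sum>j<k. opx 2 ^ (k - 1 - j) * opp 1 * opx 1 ^ j)"

lemma opE_Suc: "opE (Suc k) = opx 2 * opE k + opp 1 * opx 1 ^ k"
proof -
  have "opx 2 * opE k = (\<Sum>j<k. opx 2 ^ (Suc k - 1 - j) * opp 1 * opx 1 ^ j)"
    unfolding opE_def sum_distrib_left
  proof (rule sum.cong)
    fix j assume "j \<in> {..<k}"
    hence "Suc k - 1 - j = Suc (k - 1 - j)" by auto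
    thus "opx 2 * (opx 2 ^ (k - 1 - j) * opp 1 * opx 1 ^ j) = opx 2 ^ (Suc k - 1 - j) * opp 1 * (opx 1 ^ j :: (idx, 'f) lop)"
      by (simp only: power_Suc mult.assoc)
  qed simp
  thus ?thesis unfolding opE_def by (simp add: mult.assoc)
qed

lemma ops_opx_pow: "ops 1 * opx 1 ^ k = opx 2 ^ k * ops 1 - opE k"
proof (induction k)
  case (Suc k)
  have "ops 1 * opx 1 ^ Suc k = (ops 1 * opx 1) * (opx 1 ^ k :: (idx, 'f) lop)"
    by (simp add: mult.assoc)
  also have "\<dots> = opx 2 * (ops 1 * opx 1 ^ k) - opp 1 * (opx 1 ^ k :: (idx, 'f) lop)"
    by (simp only: ops_opx[of 1]) (simp add: left_diff_distrib mult.assoc numeral_2_eq_2)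
  finally show ?case by (simp add: Suc opE_Suc right_diff_distrib mult.assoc del: One_nat_def)
qed (simp add: opE_def)

text \<open>The correction that arises when \<open>s_1\<close> passes \<open>g(x_1)\<close>: a
  divided difference of \<open>g\<close> in \<open>x_1\<close> and \<open>x_2\<close>, with
  \<open>opp 1\<close> inserted between the powers.\<close>

definition GE :: "(idx, 'f) lop" where
  "GE = (\<Sum>k\<le>d. scalar (coeff g k) * opE k)"

lemma ops_G1: "ops 1 * G 1 = G 2 * ops 1 - GE"
  by (simp add: G_def GE_def sum_distrib_left sum_distrib_right scalar_left_commute ops_opx_pow
    right_diff_distrib sum_subtractf mult.assoc del: One_nat_def)

lemma GE_G2: "GE * G 2 = G 2 * GE"
proof -
  have "opE k * G 2 = G 2 * opE k" for k
  proof -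
    have c: "opx j ^ l * G 2 = G 2 * opx j ^ l" for j l
      by (rule power_commuting_commutes) (rule G_opx)
    show ?thesis unfolding opE_def sum_distrib_left sum_distrib_right
      by (rule sum.cong) (simp_all add: mult.assoc c c[THEN mult_left_ext] G_opp G_opp[THEN mult_left_ext] del: One_nat_def)
  qed
  thus ?thesis
    by (simp add: GE_def sum_distrib_left sum_distrib_right scalar_left_commute mult.assoc)
qed

text \<open>Only even powers occur in \<open>g\<close>, so \<open>G 1 + G 2\<close> is a combination
  of power sums in \<open>x_1^2\<close> and \<open>x_2^2\<close>.\<close>

lemma ops_G_sum: "ops 1 * (G 1 + G 2) = (G 1 + G 2) * ops 1"
proof -
  define P :: "nat \<Rightarrow> (idx, 'f) lop" where "P k = opx 1 ^ k + opx 2 ^ k" for k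
  have P: "ops 1 * (scalar (coeff g k) * P k) = scalar (coeff g k) * P k * ops 1" for k
  proof (cases "even k")
    case True
    then obtain m where k: "k = 2 * m" by auto
    have "ops 1 * P k = P k * ops 1"
      using ops_opx_sq_sum[of 1 m] unfolding k P_def by (simp only: Suc_1)
    thus ?thesis by (simp only: scalar_left_commute[of "ops 1"] mult.assoc)
  qed (simp add: g_even)
  have "G 1 + G 2 = (\<Sum>k\<le>d. scalar (coeff g k) * P k)"
    by (simp only: G_def P_def distrib_left sum.distrib)
  thus ?thesis by (simp only: sum_distrib_left sum_distrib_right P)
qed

lemma ops_G1_G2: "ops 1 * (G 1 * G 2) = G 1 * G 2 * ops 1"
proof (rule symmetric_product_commutes)
  show "ops 1 * G 1 = G 2 * ops 1 - GE" by (rule ops_G1)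
  show "ops 1 * (G 1 + G 2) = (G 1 + G 2) * ops 1" by (rule ops_G_sum)
  show "GE * G 2 = G 2 * GE" by (rule GE_G2)
  show "G 2 * G 1 = G 1 * G 2" by (rule G_G)
qed

lemma rho_opx1_rho:
  assumes "k < d"
  shows "rho * (opx 1 ^ k * rho) = (if k = d - 1 then rho else 0)"
proof (rule lop_idx_eqI)
  fix a :: "nat \<Rightarrow> nat" and S w
  show "ap (rho * (opx 1 ^ k * rho)) (bas (a, S, w)) = ap (if k = d - 1 then rho else 0) (bas (a, S, w))"
    by (simp add: rho_bas opx_pow_bas del: One_nat_def)
qed

text \<open>Between two copies of \<open>rho\<close> only the power \<open>x_1^(d-1)\<close>
  survives. Among the \<open>opE k\<close> with \<open>k \<le> d\<close> it occurs only for
  \<open>k = d\<close>, in the term without \<open>x_2\<close>, and there the coefficient is the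
  leading coefficient 1 of \<open>g\<close>.\<close>

lemma rho_GE_rho: "rho * (GE * rho) = opm 1 * rho"
proof -
  have x2: "rho * opx 2 ^ l = opx 2 ^ l * rho" for l
    by (rule power_commuting_commutes[symmetric]) (simp add: rho_opx)
  have "rho * (opE k * rho) = (if k = d then opm 1 * rho else 0)" if "k \<le> d" for k
  proof -
    have "rho * (opE k * rho) = (\<Sum>j<k. opx 2 ^ (k - 1 - j) * (opm 1 * (rho * (opx 1 ^ j * rho))))"
      unfolding opE_def sum_distrib_left sum_distrib_right
      by (rule sum.cong) (simp_all add: mult.assoc x2[THEN mult_left_ext] rho_opp[THEN mult_left_ext] del: One_nat_def)
    also have "\<dots> = (\<Sum>j<k. if j = d - 1 then opx 2 ^ (k - 1 - j) * (opm 1 * rho) else 0)"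
      using that by (intro sum.cong refl) (simp add: rho_opx1_rho del: One_nat_def)
    also have "\<dots> = (if k = d then opm 1 * rho else 0)"
      using that d_pos by (auto simp: sum.delta)
    finally show ?thesis .
  qed
  hence "rho * (GE * rho) = (\<Sum>k\<le>d. scalar (coeff g k) * (if k = d then opm 1 * rho else 0))"
    unfolding GE_def sum_distrib_left sum_distrib_right
    by (intro sum.cong refl) (simp add: mult.assoc scalar_left_commute del: One_nat_def)
  also have "\<dots> = opm 1 * rho"
    by (subst sum.remove[of _ d]) (auto simp: lead_g intro!: sum.neutral)
  finally show ?thesis .
qed

lemma rho_ops_G_rho: "rho * (ops 1 * (G 1 * rho)) = G 2 * (rho * (ops 1 * rho)) - opm 1 * rho"
proof -
  have c: "rho * G 2 = G 2 * rho"
    by (rule G_commute) (rule power_commuting_commutes[symmetric], simp add: rho_opx)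
  have "rho * (ops 1 * (G 1 * rho)) = rho * ((ops 1 * G 1) * rho)"
    by (simp only: mult.assoc)
  also have "\<dots> = (rho * G 2) * (ops 1 * rho) - rho * (GE * rho)"
    by (simp only: ops_G1 left_diff_distrib right_diff_distrib mult.assoc)
  finally show ?thesis by (simp only: c rho_GE_rho mult.assoc)
qed

text \<open>This reduces commutation to the equation
  \<open>(rho * ops 1)^2 = (ops 1 * rho)^2\<close>, which can be checked on basis vectors with small
  exponents.\<close>

lemma opX_1_2:
  "opX 1 * opX 2 - opX 2 * opX 1 =
    G 1 * G 2 * (rho * ops 1 * rho * ops 1 - ops 1 * rho * ops 1 * rho)"
proof -
  define s x y p m \<theta> :: "(idx, 'f) lop"
    where "s = ops 1" and "x = opx 1" and "y = opx 2" and "p = opp 1" and "m = opm 1" and "\<theta> = G 1 * rho"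
  note defs = s_def x_def y_def p_def m_def \<theta>_def
  have r: "s * x = y * s - p" "s * y = x * s + m" "s * s = 1" "s * p = m * s" "s * m = p * s"
    using ops_opx[of 1] ops_opx_Suc[of 1] ops_sq[of 1] ops_opp[of 1]
    by (simp_all add: defs numeral_2_eq_2 del: One_nat_def)
  have y\<theta>: "y * \<theta> = \<theta> * y"
    by (simp add: defs rho_opx G_opx[THEN mult_left_ext] mult.assoc del: One_nat_def)
  have p\<theta>: "\<theta> * p = m * \<theta>"
    by (simp add: defs rho_opp G_opp[THEN mult_left_ext] mult.assoc del: One_nat_def)
  have sC: "s * (G 1 * G 2) = G 1 * G 2 * s" using ops_G1_G2 by (simp only: s_def)
  have xs: "x * s = s * y - m" using r(2) by simp
  have xy: "x * y = y * x" by (simp only: x_def y_def opx_commute)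
  have X2: "opX 2 = y - s * \<theta> * s"
  proof -
    have "opX 2 = s * (x - \<theta>) * s + p * s"
      unfolding defs opX_1[symmetric] using opX_Suc[OF order_refl] unfolding Suc_1 .
    also have "\<dots> = y - s * \<theta> * s" by (rule conjugate_reduction[OF r(1) r(3)])
    finally show ?thesis .
  qed
  have usu: "\<theta> * s * \<theta> = G 1 * G 2 * (rho * s * rho) - m * \<theta>"
  proof -
    have 1: "\<theta> * s * \<theta> = G 1 * (rho * (s * (G 1 * rho)))" by (simp only: \<theta>_def mult.assoc)
    have 2: "rho * (s * (G 1 * rho)) = G 2 * (rho * (s * rho)) - m * rho"
      unfolding s_def m_def by (rule rho_ops_G_rho)
    have 3: "G 1 * (m * rho) = m * \<theta>"
      unfolding m_def \<theta>_def by (simp only: mult.assoc[symmetric] G_opp(2))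
    show ?thesis unfolding 1 2 right_diff_distrib 3 by (simp only: mult.assoc)
  qed
  show ?thesis
    using commutator_expansion[OF r(1) xs r(5) y\<theta> p\<theta> xy] commutator_reduction[OF usu sC r(5)]
    unfolding X2 opX_1 unfolding s_def[symmetric] x_def[symmetric] \<theta>_def[symmetric] by (rule trans)
qed

end

section \<open>Coordinate subspaces and the lower terms of \<open>ops\<close>\<close>

definition spn :: "'b set \<Rightarrow> ('b \<Rightarrow>\<^sub>0 'f::field) set" where
  "spn Y = {v. keys v \<subseteq> Y}"

lemma spn_iff: "v \<in> spn Y \<longleftrightarrow> (\<forall>k. k \<notin> Y \<longrightarrow> coef v k = 0)"
  by (auto simp: spn_def in_keys_iff)

lemma spn_0 [simp]: "0 \<in> spn Y" by (simp add: spn_iff)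
lemma spn_add: "v \<in> spn Y \<Longrightarrow> w \<in> spn Y \<Longrightarrow> v + w \<in> spn Y" by (simp add: spn_iff lookup_add)
lemma spn_diff: "v \<in> spn Y \<Longrightarrow> w \<in> spn Y \<Longrightarrow> v - w \<in> spn Y" by (simp add: spn_iff lookup_minus)
lemma spn_uminus: "v \<in> spn Y \<Longrightarrow> - v \<in> spn Y" by (simp add: spn_iff)
lemma spn_scl: "v \<in> spn Y \<Longrightarrow> scl a v \<in> spn Y" by (simp add: spn_iff)
lemma spn_sum: "(\<And>x. x \<in> A \<Longrightarrow> f x \<in> spn Y) \<Longrightarrow> sum f A \<in> spn Y" by (simp add: spn_iff lookup_sum)
lemma spn_single: "k \<in> Y \<Longrightarrow> Poly_Mapping.single k a \<in> spn Y"
  by (auto simp: spn_iff lookup_single when_def)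
lemma spn_mono: "v \<in> spn Y \<Longrightarrow> Y \<subseteq> Z \<Longrightarrow> v \<in> spn Z" by (auto simp: spn_def)
lemma spn_empty: "v \<in> spn {} \<longleftrightarrow> v = 0" by (simp add: spn_def)

lemma ap_spn:
  assumes "v \<in> spn Y" "\<And>k. k \<in> Y \<Longrightarrow> ap A (bas k) \<in> spn Z"
  shows "ap A v \<in> spn Z"
proof -
  have "ap A v = (\<Sum>k\<in>keys v. scl (coef v k) (ap A (bas k)))"
    by (rule ap_expansion) auto
  also have "\<dots> \<in> spn Z"
    by (intro spn_sum spn_scl assms(2)) (use assms(1) in \<open>auto simp: spn_def\<close>)
  finally show ?thesis .
qed

lemma ap_eq_on_spn:
  assumes "v \<in> spn Y" "\<And>k. k \<in> Y \<Longrightarrow> ap A (bas k) = ap B (bas k)"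
  shows "ap A v = ap B v"
proof -
  have "ap (A - B) v \<in> spn {}"
    using assms by (intro ap_spn[of v Y]) (simp_all add: spn_empty)
  thus ?thesis by (simp add: spn_empty)
qed

text \<open>The monomials that may occur in \<open>ops i - opt i\<close>. Besides the drop in
  degree, the bound by the larger of the two old exponents matters: if no exponent reached
  \<open>d\<close> before, none does afterwards.\<close>

definition low :: "nat \<Rightarrow> idx \<Rightarrow> idx set" where
  "low i = (\<lambda>(a, S, w). {(a', S', w'). w' = w \<and> (S' = S \<or> S' = tog (tog S i) (Suc i)) \<and>
     (\<forall>j. j \<noteq> i \<longrightarrow> j \<noteq> Suc i \<longrightarrow> a' j = a j) \<and> a' i + a' (Suc i) < a i + a (Suc i) \<and>
     a' i \<le> max (a i) (a (Suc i)) \<and> a' (Suc i) \<le> max (a i) (a (Suc i))})"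

lemma opp_bas: "ap (opp i) (bas (a, S, w)) \<in> spn {(a, S, w), (a, tog (tog S i) (Suc i), w)}"
  "ap (opm i) (bas (a, S, w)) \<in> spn {(a, S, w), (a, tog (tog S i) (Suc i), w)}"
  by (auto simp: opp_def opm_def tog_commute[of S i] intro!: spn_add spn_diff spn_single spn_uminus)

text \<open>Induction on the degree in \<open>x_i\<close> and \<open>x_(i+1)\<close>. Their product
  commutes with \<open>s_i\<close> and can be stripped off; a power of a single one is reduced by
  one factor at the cost of one correction \<open>opp i\<close> or \<open>opm i\<close> of lower
  degree.\<close>

lemma ops_low: "ap (ops i) (bas (a, S, w)) - ap (opt i) (bas (a, S, w)) \<in> spn (low i (a, S, w) :: idx set)"
proof (induction "a i + a (Suc i)" arbitrary: a rule: less_induct)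
  case less
  let ?D = "\<lambda>a. ap (ops i) (bas (a, S, w)) - ap (opt i) (bas (a, S, w)) :: idx \<Rightarrow>\<^sub>0 'a"
  consider "a i = 0" "a (Suc i) = 0" | "a i > 0" "a (Suc i) > 0" | "a i > 0" "a (Suc i) = 0" | "a i = 0" "a (Suc i) > 0"
    by blast
  thus ?case
  proof cases
    case 1
    thus ?thesis by (simp add: ops_bas_0)
  next
    case 2
    define b where "b = a(i := a i - 1, Suc i := a (Suc i) - 1)"
    have "b(i := Suc (b i), Suc i := Suc (b (Suc i))) = a" using 2 by (auto simp: b_def)
    hence ab: "bas (a, S, w) = ap (opx (Suc i) * opx i) (bas (b, S, w) :: idx \<Rightarrow>\<^sub>0 'a)" by simp
    have 1: "ops i * (opx (Suc i) * opx i) = opx (Suc i) * opx i * (ops i :: (idx, 'a) lop)"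
      by (simp add: algebra_simps ops_opx ops_opx_Suc ops_opx[THEN mult_left_ext]
        ops_opx_Suc[THEN mult_left_ext] opx_opm opx_left_commute opx_commute)
    have 2: "opt i * (opx (Suc i) * opx i) = opx (Suc i) * opx i * (opt i :: (idx, 'a) lop)"
      by (simp add: opt_opx opt_opx[THEN mult_left_ext] mult.assoc tp_apply opx_commute opx_left_commute)
    have eq: "?D a = ap (opx (Suc i) * opx i) (?D b)"
      unfolding ab ap_diff by (simp only: ap_simps(6)[symmetric] 1 2)
    have "?D b \<in> spn (low i (b, S, w))"
      by (rule less) (use \<open>a i > 0\<close> in \<open>simp add: b_def\<close>)
    thus ?thesis unfolding eq
      by (rule ap_spn) (use \<open>a i > 0\<close> \<open>a (Suc i) > 0\<close> in \<open>auto simp: low_def b_def intro!: spn_single\<close>)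
  next
    case 3
    define b where "b = a(i := a i - 1)"
    have "b(i := Suc (b i)) = a" using 3 by (auto simp: b_def)
    hence ab: "bas (a, S, w) = ap (opx i) (bas (b, S, w) :: idx \<Rightarrow>\<^sub>0 'a)" by simp
    have o: "opt i * opx i = opx (Suc i) * (opt i :: (idx, 'a) lop)" by (simp add: opt_opx tp_apply)
    have eq: "?D a = ap (opx (Suc i)) (?D b) - ap (opp i) (bas (b, S, w))"
      unfolding ab ap_simps(6)[symmetric] ops_opx o ap_diff ap_simps(4) by (simp add: algebra_simps del: opt_bas opx_bas)
    have "?D b \<in> spn (low i (b, S, w))"
      by (rule less) (use 3 in \<open>simp add: b_def\<close>)
    hence 1: "ap (opx (Suc i)) (?D b) \<in> spn (low i (a, S, w))"
      by (rule ap_spn) (use 3 in \<open>auto simp: low_def b_def intro!: spn_single\<close>)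
    have 2: "ap (opp i) (bas (b, S, w)) \<in> spn (low i (a, S, w))"
      by (rule spn_mono[OF opp_bas(1)]) (use 3 in \<open>auto simp: low_def b_def\<close>)
    show ?thesis unfolding eq by (rule spn_diff[OF 1 2])
  next
    case 4
    define b where "b = a(Suc i := a (Suc i) - 1)"
    have "b(Suc i := Suc (b (Suc i))) = a" using 4 by (auto simp: b_def)
    hence ab: "bas (a, S, w) = ap (opx (Suc i)) (bas (b, S, w) :: idx \<Rightarrow>\<^sub>0 'a)" by simp
    have o: "opt i * opx (Suc i) = opx i * (opt i :: (idx, 'a) lop)" by (simp add: opt_opx tp_apply)
    have eq: "?D a = ap (opx i) (?D b) + ap (opm i) (bas (b, S, w))"
      unfolding ab ap_simps(6)[symmetric] ops_opx_Suc o ap_diff ap_simps(3) by (simp only: add_diff_eq diff_add_eq)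
    have "?D b \<in> spn (low i (b, S, w))"
      by (rule less) (use 4 in \<open>simp add: b_def\<close>)
    hence 1: "ap (opx i) (?D b) \<in> spn (low i (a, S, w))"
      by (rule ap_spn) (use 4 in \<open>auto simp: low_def b_def intro!: spn_single\<close>)
    have 2: "ap (opm i) (bas (b, S, w)) \<in> spn (low i (a, S, w))"
      by (rule spn_mono[OF opp_bas(2)]) (use 4 in \<open>auto simp: low_def b_def\<close>)
    show ?thesis unfolding eq by (rule spn_add[OF 1 2])
  qed
qed

lemma power_intertwine:
  fixes x t y :: "'r::ring_1"
  assumes "x * t = t * y"
  shows "x ^ r * t = t * y ^ r"
proof (induction r)
  case (Suc r)
  have "x ^ Suc r * t = x * (x ^ r * t)" by (simp add: mult.assoc)
  also have "\<dots> = (x * t) * y ^ r" unfolding Suc by (simp add: mult.assoc)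
  finally show ?case unfolding assms by (simp add: mult.assoc)
qed simp

section \<open>Commutation of \<open>opX 1\<close> and \<open>opX 2\<close> on reduced
  vectors\<close>

context cyclotomic_model
begin

text \<open>Each step turns one factor \<open>x_2\<close> to the right of \<open>s_1\<close> into a
  factor \<open>x_1\<close> on its left. The correction \<open>opm 1\<close> comes with too small a
  power of \<open>x_1\<close> to survive \<open>rho\<close>.\<close>

lemma rho_opx_opsy:
  assumes "a 1 = 0" "a 2 = 0" "r + b \<le> d - 1"
  shows "ap rho (ap (opx 1 ^ r) (ap (opsy 1 b) (bas (a, S, w)))) =
    (if r + b = d - 1 then ap (opt 1) (bas (a, S, w)) else 0)"
  using assms(3)
proof (induction b arbitrary: r)
  case 0
  have "opx 1 ^ r * opt 1 = opt 1 * (opx 2 ^ r :: (idx, 'f) lop)"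
    by (rule power_intertwine) (simp add: opt_opx tp_apply numeral_2_eq_2)
  hence "ap (opx 1 ^ r) (ap (opt 1) (bas (a, S, w))) = ap (opt 1) (ap (opx 2 ^ r) (bas (a, S, w) :: idx \<Rightarrow>\<^sub>0 'f))"
    by (simp only: ap_simps(6)[symmetric])
  hence "ap (opx 1 ^ r) (ap (opt 1) (bas (a, S, w))) = ap (opt 1) (bas (a(2 := r), S, w) :: idx \<Rightarrow>\<^sub>0 'f)"
    using assms(2) by (simp only: opx_pow_bas add_0)
  moreover have "(a(2 := r)) \<circ> tp 1 = (a \<circ> tp 1)(1 := r)" by (auto simp: fun_eq_iff tp_apply numeral_2_eq_2)
  moreover have "((a \<circ> tp 1)(1 := r))(1 := 0) = a \<circ> tp 1"
    using assms by (auto simp: fun_eq_iff tp_apply numeral_2_eq_2)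
  ultimately show ?case by (simp add: rho_bas del: One_nat_def fun_upd_apply) (auto simp: rho_bas)
next
  case (Suc b)
  have c: "opx 1 ^ r * opm 1 = (if even r then opm 1 else opp 1) * (opx 1 :: (idx, 'f) lop) ^ r"
    by (induction r) (auto simp: mult.assoc opx_opm opx_opm[THEN mult_left_ext] simp del: One_nat_def)
  have "rho * (opx 1 ^ r * (opm 1 * opx 2 ^ b)) = (rho * (if even r then opm 1 else opp 1)) * (opx 1 ^ r * opx 2 ^ b)"
    by (simp only: c[THEN mult_left_ext] mult.assoc)
  also have "rho * (if even r then opm 1 else opp 1) = (if even r then opp 1 else opm 1) * rho"
    by (simp add: rho_opp del: One_nat_def)
  finally have z: "ap (rho * (opx 1 ^ r * (opm 1 * opx 2 ^ b))) (bas (a, S, w)) = 0"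
    using assms Suc(2) by (simp add: opx_pow_bas rho_bas del: One_nat_def)
  have "rho * (opx 1 ^ r * opsy 1 (Suc b)) = rho * (opx 1 ^ Suc r * opsy 1 b) + rho * (opx 1 ^ r * (opm 1 * opx 2 ^ b))"
    by (simp add: distrib_left mult.assoc power_commutes numeral_2_eq_2[symmetric] mult_left_ext[OF power_commutes] del: One_nat_def)
  hence "ap (rho * (opx 1 ^ r * opsy 1 (Suc b))) (bas (a, S, w)) = ap rho (ap (opx 1 ^ Suc r) (ap (opsy 1 b) (bas (a, S, w))))"
    using z by (simp del: opsy.simps One_nat_def power_Suc)
  thus ?case using Suc(1)[of "Suc r"] Suc(2) by (simp del: opsy.simps One_nat_def power_Suc)
qed

lemma rho_opsx:
  assumes "a 1 = 0" "a 2 = 0" "b < d" "k < d"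
  shows "ap rho (ap (opsx 1 b k) (bas (a, S, w))) =
    (if b = d - 1 then ap (opx 2 ^ k) (ap (opt 1) (bas (a, S, w))) else 0)"
  using assms(4)
proof (induction k)
  case 0
  thus ?case using rho_opx_opsy[of a 0 b S w] assms by (simp del: One_nat_def opt_bas)
next
  case (Suc k)
  have 1: "ap (rho * (opp 1 * (opx 1 ^ k * opx 2 ^ b))) (bas (a, S, w)) = 0"
  proof -
    have "k \<noteq> d - 1" using Suc(2) by simp
    thus ?thesis using assms unfolding mult.assoc[symmetric] rho_opp
      by (simp add: opx_pow_bas rho_bas mult.assoc del: One_nat_def)
  qed
  have "opsx 1 b (Suc k) = opx 2 * opsx 1 b k - (opp 1 * (opx 1 ^ k * opx 2 ^ b) :: (idx, 'f) lop)"
    by (simp add: numeral_2_eq_2[symmetric] mult.assoc del: One_nat_def)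
  hence "rho * opsx 1 b (Suc k) = opx 2 * (rho * opsx 1 b k) - rho * (opp 1 * (opx 1 ^ k * opx 2 ^ b))"
    by (simp only: right_diff_distrib) (simp add: rho_opx[THEN mult_left_ext] mult.assoc del: One_nat_def)
  hence "ap (rho * opsx 1 b (Suc k)) (bas (a, S, w)) = ap (opx 2) (ap rho (ap (opsx 1 b k) (bas (a, S, w))))"
    using 1 by (simp only: ap_simps) simp
  thus ?case using Suc by (simp del: One_nat_def opt_bas opsx.simps)
qed

text \<open>\<open>s_1\<close> exchanges the exponents of \<open>x_1\<close> and \<open>x_2\<close>
  up to lower terms, and these do not contribute to the coefficient of
  \<open>x_1^(d-1)\<close>.\<close>

lemma rho_ops_bas:
  assumes "a 1 < d" "a 2 < d"
  shows "ap rho (ap (ops 1) (bas (a, S, w))) =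
    (if a 2 = d - 1 then ap (opx 2 ^ a 1) (ap (opt 1) (bas (a(1 := 0, 2 := 0), S, w))) else 0)"
  using assms rho_opsx[of "a(1 := 0, 2 := 0)" "a 2" "a 1" S w]
  by (simp add: ops_bas numeral_2_eq_2[symmetric] del: One_nat_def opt_bas)

definition Rd :: "idx set" where
  "Rd = {(a, S, w). \<forall>j. a j < d}"

text \<open>Both products vanish unless both exponents equal \<open>d - 1\<close>. In that case the
  two \<open>rho\<close> remove one full exponent each and the two exchanges \<open>opt 1\<close>
  cancel, so both products give the vector with the exponents deleted.\<close>

lemma rho_ops_rho_ops_bas:
  assumes "a 1 < d" "a 2 < d"
  shows "ap (rho * ops 1 * rho * ops 1) (bas (a, S, w)) = ap (ops 1 * rho * ops 1 * rho) (bas (a, S, w))"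
proof -
  let ?u = "bas (a(1 := 0, 2 := 0), S, w) :: idx \<Rightarrow>\<^sub>0 'f"
  have tt: "ap (opt 1) (ap (opt 1) v) = v" for v :: "idx \<Rightarrow>\<^sub>0 'f"
    by (simp add: opt_sq flip: ap_simps(6) del: One_nat_def)
  obtain a' S' w' and z :: 'f where u: "ap (opt 1) ?u = scl z (bas (a', S', w'))" and a': "a' 1 = 0" "a' 2 = 0"
  proof -
    have "((a(1 := 0, 2 := 0)) \<circ> tp 1) 1 = 0" "((a(1 := 0, 2 := 0)) \<circ> tp 1) 2 = 0"
      by (simp_all add: tp_apply numeral_2_eq_2)
    moreover have "ap (opt 1) ?u = scl (if 1 \<in> S \<and> Suc 1 \<in> S then -1 else 1) (bas ((a(1 := 0, 2 := 0)) \<circ> tp 1, tp 1 -` S, tp 1 \<circ> w))"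
      by simp
    ultimately show ?thesis using that by blast
  qed
  have u': "scl z (ap (opt 1) (bas (a', S', w'))) = ?u"
    using arg_cong[OF u, of "ap (opt 1)"] unfolding tt by (simp only: ap_scl)
  have 1: "ap (rho * ops 1 * rho * ops 1) (bas (a, S, w)) = (if a 2 = d - 1 \<and> a 1 = d - 1 then ?u else 0)"
  proof (cases "a 2 = d - 1")
    case True
    have "ap (rho * ops 1 * rho * ops 1) (bas (a, S, w)) = ap rho (ap (ops 1) (ap (opx 2 ^ a 1) (scl z (bas (a', S', w')))))"
      using True by (simp only: ap_simps rho_ops_bas[OF assms] if_True u refl simp_thms)
    also have "\<dots> = scl z (ap rho (ap (ops 1) (bas (a'(2 := a 1), S', w'))))"
      by (simp only: ap_scl opx_pow_bas a' add_0)
    also have "\<dots> = (if a 1 = d - 1 then scl z (ap (opt 1) (bas (a', S', w'))) else 0)"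
    proof -
      have "(a'(2 := a 1))(1 := 0, 2 := 0) = a'" using a' by auto
      thus ?thesis using assms rho_ops_bas[of "a'(2 := a 1)" S' w'] a' d_pos
        by (simp del: One_nat_def opt_bas scl_single)
    qed
    finally show ?thesis using True unfolding u' by simp
  next
    case False
    thus ?thesis by (simp only: ap_simps rho_ops_bas[OF assms]) simp
  qed
  have 2: "ap (ops 1 * rho * ops 1 * rho) (bas (a, S, w)) = (if a 2 = d - 1 \<and> a 1 = d - 1 then ?u else 0)"
  proof (cases "a 1 = d - 1")
    case True
    have e: "(a(1 := 0))(1 := 0, 2 := 0) = a(1 := 0, 2 := 0)" by simp
    have "ap (ops 1 * rho * ops 1 * rho) (bas (a, S, w)) = ap (ops 1) (ap rho (ap (ops 1) (bas (a(1 := 0), S, w))))"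
      using True by (simp add: rho_bas del: One_nat_def)
    also have "\<dots> = (if a 2 = d - 1 then ap (ops 1) (ap (opt 1) ?u) else 0)"
      using assms rho_ops_bas[of "a(1 := 0)" S w] unfolding e by (simp del: One_nat_def opt_bas)
    also have "ap (ops 1) (ap (opt 1) ?u) = scl z (ap (opt 1) (bas (a', S', w')))"
      unfolding u ap_scl using a' by (simp add: ops_bas_0 numeral_2_eq_2 del: opt_bas scl_single)
    finally show ?thesis using True unfolding u' by simp
  next
    case False
    thus ?thesis by (simp add: rho_bas del: One_nat_def)
  qed
  show ?thesis unfolding 1 2 ..
qed

lemma opX_1_2_Rd:
  assumes "v \<in> spn Rd"
  shows "ap (opX 1) (ap (opX 2) v) = ap (opX 2) (ap (opX 1) v)"
proof -
  have "ap (rho * ops 1 * rho * ops 1) v = ap (ops 1 * rho * ops 1 * rho) v"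
    using assms by (rule ap_eq_on_spn) (auto simp: Rd_def intro!: rho_ops_rho_ops_bas simp del: ap_simps One_nat_def)
  hence "ap (rho * ops 1 * rho * ops 1 - ops 1 * rho * ops 1 * rho) v = 0"
    by (simp only: ap_simps(4)) simp
  hence "ap (opX 1 * opX 2 - opX 2 * opX 1) v = 0"
    by (simp only: opX_1_2 ap_simps(6)) simp
  thus ?thesis by (simp only: ap_simps) simp
qed

end

section \<open>The filtration by degree in \<open>x\<close> and symbols of operators\<close>

lemma diff_telescope: "(a - b) + (b - c) = a - (c :: 'r::ab_group_add)"
  by simp

definition exdeg :: "nat \<Rightarrow> (nat \<Rightarrow> nat) \<Rightarrow> nat" where
  "exdeg n a = (\<Sum>j\<in>{1..n}. a j)"

lemma exdeg_upd: "j \<in> {1..n} \<Longrightarrow> exdeg n (a(j := v)) + a j = exdeg n a + v"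
proof -
  assume j: "j \<in> {1..n}"
  have "(\<Sum>x\<in>{1..n}. (a(j := v)) x) = v + (\<Sum>x\<in>{1..n} - {j}. a x)"
    using j by (subst sum.remove[of _ j]) (auto intro!: sum.cong)
  moreover have "(\<Sum>x\<in>{1..n}. a x) = a j + (\<Sum>x\<in>{1..n} - {j}. a x)"
    using j by (subst sum.remove[of _ j]) auto
  ultimately show ?thesis by (simp add: exdeg_def)
qed

lemma exdeg_tp: "1 \<le> i \<Longrightarrow> i < n \<Longrightarrow> exdeg n (a \<circ> tp i) = exdeg n a"
  unfolding exdeg_def
  by (rule sum.reindex_bij_witness[of _ "tp i" "tp i"]) (auto simp: tp_apply)

lemma exdeg_split:
  assumes "1 \<le> i" "i < n"
  shows "exdeg n a = a i + a (Suc i) + (\<Sum>j\<in>{1..n} - {i, Suc i}. a j)"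
proof -
  have "{1..n} = insert i (insert (Suc i) ({1..n} - {i, Suc i}))" using assms by auto
  hence "exdeg n a = (\<Sum>j\<in>insert i (insert (Suc i) ({1..n} - {i, Suc i})). a j)"
    unfolding exdeg_def by simp
  thus ?thesis by simp
qed

locale cyclotomic_space = cyclotomic_model d g for d :: nat and g :: "'f::field poly" +
  fixes n :: nat
  assumes n_pos: "n \<ge> 1"
begin

definition Bs :: "idx set" where
  "Bs = {(a, S, w). (\<forall>j. a j < d) \<and> (\<forall>j. j \<notin> {1..n} \<longrightarrow> a j = 0) \<and> S \<subseteq> {1..n} \<and> w permutes {1..n}}"

definition Bl :: "nat \<Rightarrow> idx set" where
  "Bl k = {b \<in> Bs. exdeg n (fst b) < k}"

definition Bd :: "nat \<Rightarrow> idx set" where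
  "Bd k = {b \<in> Bs. exdeg n (fst b) = k}"

text \<open>Multiplication by \<open>x_i\<close> in the associated graded algebra, where
  \<open>x_i^d = 0\<close>.\<close>

definition lamx :: "nat \<Rightarrow> (idx, 'f) lop" where
  "lamx i = mk (\<lambda>(a, S, w). if a i = d - 1 then 0 else bas (a(i := Suc (a i)), S, w))"

lemma lamx_bas: "ap (lamx i) (Poly_Mapping.single (a, S, w) z) =
    (if a i = d - 1 then 0 else Poly_Mapping.single (a(i := Suc (a i)), S, w) z)"
  by (subst ap_single) (simp add: lamx_def)

lemma Bl_mono: "k \<le> l \<Longrightarrow> Bl k \<subseteq> Bl l" by (auto simp: Bl_def)
lemma Bl_subset_Bs: "Bl k \<subseteq> Bs" by (auto simp: Bl_def)
lemma Bs_subset_Rd: "Bs \<subseteq> Rd" by (auto simp: Bs_def Rd_def)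
lemma Bl_0: "Bl 0 = {}" by (simp add: Bl_def)

lemma tp_permutes: "1 \<le> i \<Longrightarrow> i < n \<Longrightarrow> tp i permutes {1..n}"
  by (intro permutes_swap_id) auto

definition filt :: "nat \<Rightarrow> (idx, 'f) lop \<Rightarrow> bool" where
  "filt m A \<longleftrightarrow> (\<forall>k. \<forall>v\<in>spn (Bl k). ap A v \<in> spn (Bl (k + m)))"

text \<open>One degree better than \<open>filt m\<close>: degree at most \<open>k\<close> is sent
  below degree \<open>k + m\<close>. The successor on the source side avoids a subtraction on the
  target side.\<close>

definition low_order :: "nat \<Rightarrow> (idx, 'f) lop \<Rightarrow> bool" where
  "low_order m A \<longleftrightarrow> (\<forall>k. \<forall>v\<in>spn (Bl (Suc k)). ap A v \<in> spn (Bl (k + m)))"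

text \<open>\<open>\<alpha>\<close> represents the image of \<open>A\<close>, as an operator of
  degree \<open>m\<close>, in the associated graded setting.\<close>

definition symb :: "nat \<Rightarrow> (idx, 'f) lop \<Rightarrow> (idx, 'f) lop \<Rightarrow> bool" where
  "symb m A \<alpha> \<longleftrightarrow> filt m \<alpha> \<and> low_order m (A - \<alpha>)"

lemma spn_Bl_zero: "v \<in> spn (Bl 0) \<Longrightarrow> v = 0" by (simp add: Bl_0 spn_empty)

lemma low_order_imp_filt: "low_order m A \<Longrightarrow> filt m A"
proof (unfold filt_def, intro allI ballI)
  fix k and v :: "idx \<Rightarrow>\<^sub>0 'f" assume A: "low_order m A" and v: "v \<in> spn (Bl k)"
  show "ap A v \<in> spn (Bl (k + m))"
  proof (cases k)
    case 0
    hence "v = 0" using v by (intro spn_Bl_zero) simp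
    thus ?thesis by simp
  next
    case (Suc k')
    hence "ap A v \<in> spn (Bl (k' + m))" using A v by (auto simp: low_order_def)
    thus ?thesis by (rule spn_mono) (simp add: Suc Bl_mono)
  qed
qed

lemma filt_add: "filt m A \<Longrightarrow> filt m B \<Longrightarrow> filt m (A + B)"
  by (simp add: filt_def spn_add)
lemma low_order_add: "low_order m A \<Longrightarrow> low_order m B \<Longrightarrow> low_order m (A + B)"
  by (simp add: low_order_def spn_add)
lemma symb_filt: "symb m A \<alpha> \<Longrightarrow> filt m A"
  using filt_add[of m \<alpha> "A - \<alpha>"] low_order_imp_filt by (simp add: symb_def)

lemma filt_mult: "filt m A \<Longrightarrow> filt l B \<Longrightarrow> filt (m + l) (A * B)"
  unfolding filt_def
proof (intro allI ballI)
  fix k and v :: "idx \<Rightarrow>\<^sub>0 'f"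
  assume A: "\<forall>k. \<forall>v\<in>spn (Bl k). ap A v \<in> spn (Bl (k + m))"
    and B: "\<forall>k. \<forall>v\<in>spn (Bl k). ap B v \<in> spn (Bl (k + l))" and v: "v \<in> spn (Bl k)"
  have "ap A (ap B v) \<in> spn (Bl ((k + l) + m))" using A B v by blast
  thus "ap (A * B) v \<in> spn (Bl (k + (m + l)))" by (simp add: ac_simps)
qed

lemma filt_low_order: "filt m A \<Longrightarrow> low_order l B \<Longrightarrow> low_order (m + l) (A * B)"
  unfolding filt_def low_order_def
proof (intro allI ballI)
  fix k and v :: "idx \<Rightarrow>\<^sub>0 'f"
  assume A: "\<forall>k. \<forall>v\<in>spn (Bl k). ap A v \<in> spn (Bl (k + m))"
    and B: "\<forall>k. \<forall>v\<in>spn (Bl (Suc k)). ap B v \<in> spn (Bl (k + l))" and v: "v \<in> spn (Bl (Suc k))"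
  have "ap A (ap B v) \<in> spn (Bl ((k + l) + m))" using A B v by blast
  thus "ap (A * B) v \<in> spn (Bl (k + (m + l)))" by (simp add: ac_simps)
qed

lemma low_order_filt: "low_order m A \<Longrightarrow> filt l B \<Longrightarrow> low_order (m + l) (A * B)"
  unfolding filt_def low_order_def
proof (intro allI ballI)
  fix k and v :: "idx \<Rightarrow>\<^sub>0 'f"
  assume A: "\<forall>k. \<forall>v\<in>spn (Bl (Suc k)). ap A v \<in> spn (Bl (k + m))"
    and B: "\<forall>k. \<forall>v\<in>spn (Bl k). ap B v \<in> spn (Bl (k + l))" and v: "v \<in> spn (Bl (Suc k))"
  have "ap B v \<in> spn (Bl (Suc (k + l)))" using B v by fastforce
  hence "ap A (ap B v) \<in> spn (Bl ((k + l) + m))" using A by blast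
  thus "ap (A * B) v \<in> spn (Bl (k + (m + l)))" by (simp add: ac_simps)
qed

lemma symb_mult:
  assumes "symb m A \<alpha>" "symb l B \<beta>"
  shows "symb (m + l) (A * B) (\<alpha> * \<beta>)"
proof -
  have e: "A * B - \<alpha> * \<beta> = A * (B - \<beta>) + (A - \<alpha>) * \<beta>"
    by (simp only: right_diff_distrib left_diff_distrib diff_telescope)
  have "filt m A" using assms(1) by (rule symb_filt)
  thus ?thesis using assms unfolding symb_def e
    by (auto intro: filt_mult filt_low_order low_order_filt low_order_add)
qed

lemma symb_add_low: "symb m A \<alpha> \<Longrightarrow> low_order m C \<Longrightarrow> symb m (A + C) \<alpha>"
  unfolding symb_def using low_order_add[of m "A - \<alpha>" C] unfolding diff_add_eq by blast

lemma filtI: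
  assumes "\<And>a S w. (a, S, w) \<in> Bs \<Longrightarrow> ap A (bas (a, S, w)) \<in> spn (Bl (Suc (exdeg n a) + m))"
  shows "filt m A"
  unfolding filt_def
proof (intro allI ballI)
  fix k and v :: "idx \<Rightarrow>\<^sub>0 'f" assume v: "v \<in> spn (Bl k)"
  thus "ap A v \<in> spn (Bl (k + m))"
  proof (rule ap_spn)
    fix b assume b: "b \<in> Bl k"
    obtain a S w where eq: "b = (a, S, w)" by (cases b)
    show "ap A (bas b) \<in> spn (Bl (k + m))" unfolding eq
      by (rule spn_mono[OF assms[of a S w]]) (use b in \<open>auto simp: Bl_def eq\<close>)
  qed
qed

lemma low_orderI:
  assumes "\<And>a S w. (a, S, w) \<in> Bs \<Longrightarrow> ap A (bas (a, S, w)) \<in> spn (Bl (exdeg n a + m))"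
  shows "low_order m A"
  unfolding low_order_def
proof (intro allI ballI)
  fix k and v :: "idx \<Rightarrow>\<^sub>0 'f" assume v: "v \<in> spn (Bl (Suc k))"
  thus "ap A v \<in> spn (Bl (k + m))"
  proof (rule ap_spn)
    fix b assume b: "b \<in> Bl (Suc k)"
    obtain a S w where eq: "b = (a, S, w)" by (cases b)
    show "ap A (bas b) \<in> spn (Bl (k + m))" unfolding eq
      by (rule spn_mono[OF assms[of a S w]]) (use b in \<open>auto simp: Bl_def eq\<close>)
  qed
qed

lemma low_order_0: "low_order m 0" by (simp add: low_order_def)

lemma symb_refl: "filt m A \<Longrightarrow> symb m A A"
  by (simp add: symb_def low_order_0)

lemma Bs_opt: "(a, S, w) \<in> Bs \<Longrightarrow> 1 \<le> i \<Longrightarrow> i < n \<Longrightarrow> (a \<circ> tp i, tp i -` S, tp i \<circ> w) \<in> Bs"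
  using tp_permutes[of i] permutes_compose[of w "{1..n}" "tp i"]
  by (auto simp: Bs_def tp_apply split: if_splits)

lemma filt_opt: "1 \<le> i \<Longrightarrow> i < n \<Longrightarrow> filt 0 (opt i)"
  by (rule filtI) (auto simp: Bl_def exdeg_tp intro!: spn_single Bs_opt)

lemma filt_opc: "1 \<le> i \<Longrightarrow> i \<le> n \<Longrightarrow> filt 0 (opc i)"
  by (rule filtI) (auto simp: Bl_def Bs_def intro!: spn_single)

lemma filt_lamx: "1 \<le> i \<Longrightarrow> i \<le> n \<Longrightarrow> filt 1 (lamx i)"
proof (rule filtI)
  fix a S w assume i: "1 \<le> i" "i \<le> n" and b: "(a, S, w) \<in> Bs"
  have "exdeg n (a(i := Suc (a i))) = Suc (exdeg n a)" using i exdeg_upd[of i n a "Suc (a i)"] by auto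
  moreover have "a i \<noteq> d - 1 \<Longrightarrow> Suc (a i) < d" using b d_pos
    by (auto simp: Bs_def dest!: spec[of _ i])
  ultimately show "ap (lamx i) (bas (a, S, w)) \<in> spn (Bl (Suc (exdeg n a) + 1))"
    using b i by (auto simp: lamx_bas Bl_def Bs_def intro!: spn_single)
qed

lemma symb_opc: "1 \<le> i \<Longrightarrow> i \<le> n \<Longrightarrow> symb 0 (opc i) (opc i)"
  by (rule symb_refl) (rule filt_opc)

lemma symb_ops:
  assumes "1 \<le> i" "i < n"
  shows "symb 0 (ops i) (opt i)"
  unfolding symb_def
proof
  show "low_order 0 (ops i - opt i)"
  proof (rule low_orderI)
    fix a S w assume b: "(a, S, w) \<in> Bs"
    have "low i (a, S, w) \<subseteq> Bl (exdeg n a)"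
    proof
      fix b' assume b': "b' \<in> low i (a, S, w)"
      obtain a' S' w' where [simp]: "b' = (a', S', w')" by (cases b')
      have "(\<Sum>j\<in>{1..n} - {i, Suc i}. a' j) = (\<Sum>j\<in>{1..n} - {i, Suc i}. a j)"
        by (rule sum.cong) (use b' in \<open>auto simp: low_def\<close>)
      hence "exdeg n a' < exdeg n a" using b' exdeg_split[OF assms] by (simp add: low_def)
      moreover have "a' j < d" for j
      proof -
        have "a j < d" "a i < d" "a (Suc i) < d" using b by (auto simp: Bs_def)
        thus ?thesis using b' by (cases "j = i"; cases "j = Suc i") (auto simp: low_def)
      qed
      moreover have "S' \<subseteq> insert i (insert (Suc i) S)" "S \<subseteq> {1..n}"
        using b b' by (auto simp: low_def Bs_def)
      hence "S' \<subseteq> {1..n}" using assms by auto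
      moreover have "w' permutes {1..n}" "\<forall>j. j \<notin> {1..n} \<longrightarrow> a' j = 0"
        using b b' assms by (auto simp: low_def Bs_def split: if_splits)
      ultimately show "b' \<in> Bl (exdeg n a)" by (simp add: Bl_def Bs_def)
    qed
    thus "ap (ops i - opt i) (bas (a, S, w)) \<in> spn (Bl (exdeg n a + 0))"
      using spn_mono[OF ops_low] by (simp del: opt_bas)
  qed
qed (rule filt_opt[OF assms])

text \<open>At exponent \<open>d - 1\<close> the operator \<open>opX 1\<close> produces minus the
  lower terms of \<open>g\<close>, with exponents at most \<open>d - 1\<close>; the degree does not
  rise.\<close>

lemma low_order_G_rho: "low_order 1 (opX 1 - lamx 1)"
proof (rule low_orderI)
  fix a S w assume b: "(a, S, w) \<in> Bs"
  have up: "exdeg n (a(1 := v)) + a 1 = exdeg n a + v" for v using exdeg_upd[of 1 n a v] n_pos by simp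
  show "ap (opX 1 - lamx 1) (bas (a, S, w)) \<in> spn (Bl (exdeg n a + 1))"
  proof (cases "a 1 = d - 1")
    case True
    have "ap (G 1 * rho) (bas (a, S, w)) = (\<Sum>k\<le>d. scl (coeff g k) (bas (a(1 := k), S, w)))"
      using True by (simp add: rho_bas G_def ap_sum_lop opx_pow_bas del: One_nat_def scl_single)
    also have "\<dots> = scl (coeff g d) (bas (a(1 := d), S, w)) + (\<Sum>k<d. scl (coeff g k) (bas (a(1 := k), S, w)))"
      using d_pos by (simp add: lessThan_Suc_atMost[symmetric] add.commute)
    finally have "ap (opX 1 - lamx 1) (bas (a, S, w)) = - (\<Sum>k<d. scl (coeff g k) (bas (a(1 := k), S, w)))"
      using True d_pos unfolding opX_1 by (simp add: lead_g lamx_bas del: One_nat_def scl_single)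
    also have "\<dots> \<in> spn (Bl (exdeg n a + 1))"
    proof (intro spn_uminus spn_sum spn_scl spn_single)
      fix k assume "k \<in> {..<d}"
      thus "(a(1 := k), S, w) \<in> Bl (exdeg n a + 1)"
        using b up[of k] True n_pos by (auto simp: Bl_def Bs_def)
    qed
    finally show ?thesis .
  next
    case False
    thus ?thesis unfolding opX_1 by (simp add: rho_bas lamx_bas del: One_nat_def)
  qed
qed

lemma opt_lamx: "opt i * lamx j = lamx (tp i j) * opt i"
  by (rule lop_idx_eqI) (auto simp: lamx_bas upd_comp_tp)

lemma low_order_Suc: "filt m A \<Longrightarrow> low_order (Suc m) A"
  unfolding filt_def low_order_def by (metis add_Suc add_Suc_right)

lemma filt_opp: "1 \<le> i \<Longrightarrow> i < n \<Longrightarrow> filt 0 (opp i)"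
  unfolding opp_def using filt_mult[of 0 "opc i" 0 "opc (Suc i)"]
  by (intro filt_add) (auto simp: filt_opc, simp add: filt_def)

text \<open>\<open>opt j\<close> conjugates \<open>lamx j\<close> into \<open>lamx (j + 1)\<close>,
  and the summand \<open>opp j * ops j\<close> has degree 0, so it is negligible in degree
  1.\<close>

lemma symb_opX:
  assumes "1 \<le> j" "j \<le> n"
  shows "symb 1 (opX j) (lamx j)"
  using assms
proof (induction j rule: dec_induct)
  case base
  thus ?case using low_order_G_rho filt_lamx n_pos by (simp add: symb_def)
next
  case (step j)
  hence j: "1 \<le> j" "j < n" by auto
  have "symb (0 + 1 + 0) (ops j * opX j * ops j) (opt j * lamx j * opt j)"
    by (intro symb_mult symb_ops j) (use step in auto)
  moreover have "opt j * lamx j * opt j = lamx (Suc j) * (opt j * opt j)"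
    by (simp add: opt_lamx tp_apply mult.assoc)
  moreover have "low_order 1 (opp j * ops j)"
    using filt_mult[OF filt_opp[OF j] symb_filt[OF symb_ops[OF j]]] low_order_Suc[of 0] by simp
  ultimately show ?case using symb_add_low opX_Suc[OF j(1)] by (simp add: opt_sq)
qed

end

section \<open>Evaluation of the free algebra\<close>

definition wop :: "(sergeev_gen \<Rightarrow> (idx, 'f::field) lop) \<Rightarrow> sergeev_gen list \<Rightarrow> (idx, 'f) lop" where
  "wop f u = prod_list (map f u)"

lemma wop_simps [simp]: "wop f [] = 1" "wop f (l # u) = f l * wop f u" "wop f (u @ v) = wop f u * wop f v"
  by (simp_all add: wop_def)

definition evalf :: "(sergeev_gen \<Rightarrow> (idx, 'f::field) lop) \<Rightarrow> 'f sergeev_free \<Rightarrow> (idx, 'f) lop" where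
  "evalf f p = (\<Sum>w\<in>keys p. scalar (coef p w) * wop f (letters w))"

lemma evalf_add: "evalf f (p + q) = evalf f p + evalf f q"
  unfolding evalf_def by (rule setsum_keys_plus_distrib) (simp_all add: distrib_right)

lemma evalf_0 [simp]: "evalf f 0 = 0" by (simp add: evalf_def)

lemma evalf_single [simp]: "evalf f (Poly_Mapping.single w z) = scalar z * wop f (letters w)"
  by (cases "z = 0") (simp_all add: evalf_def)

lemma evalf_sum: "evalf f (sum h A) = (\<Sum>x\<in>A. evalf f (h x))"
  by (induction A rule: infinite_finite_induct) (simp_all add: evalf_add)

lemma free_expansion: "p = (\<Sum>w\<in>keys p. Poly_Mapping.single w (coef p w))"
  by (rule poly_mapping_expansion) auto

lemma letters_plus [simp]: "letters (v + w) = letters v @ letters w"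
  by (simp add: plus_free_word_def)
lemma letters_0 [simp]: "letters 0 = []"
  by (simp add: zero_free_word_def)

lemma evalf_mult: "evalf f (p * q) = evalf f p * evalf f q"
proof -
  have "p * q = (\<Sum>v\<in>keys p. \<Sum>w\<in>keys q. Poly_Mapping.single (v + w) (coef p v * coef q w))"
    by (subst (1) free_expansion[of p], subst (1) free_expansion[of q])
      (simp add: sum_product mult_single)
  moreover have "evalf f (Poly_Mapping.single (v + w) (x * y))
      = (scalar x * wop f (letters v)) * (scalar y * wop f (letters w))" for v w x y
    by (simp only: evalf_single letters_plus wop_simps scalar_simps mult.assoc scalar_left_commute[of "wop f (letters v)"])
  ultimately have "evalf f (p * q) = (\<Sum>v\<in>keys p. \<Sum>w\<in>keys q.
      (scalar (coef p v) * wop f (letters v)) * (scalar (coef q w) * wop f (letters w)))"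
    by (simp only: evalf_sum)
  thus ?thesis unfolding evalf_def[of f p] evalf_def[of f q] sum_product .
qed

lemma evalf_uminus: "evalf f (- p) = - evalf f p"
  using evalf_add[of f p "- p"] by (simp add: eq_neg_iff_add_eq_0 add.commute)

lemma evalf_diff: "evalf f (p - q) = evalf f p - evalf f q"
  using evalf_add[of f p "- q"] by (simp add: evalf_uminus)

lemma evalf_1: "evalf f 1 = 1"
  using evalf_single[of f 0 1] by simp

fun xdeg :: "sergeev_gen list \<Rightarrow> nat" where
  "xdeg [] = 0"
| "xdeg (gX i # u) = Suc (xdeg u)"
| "xdeg (gS i # u) = xdeg u"
| "xdeg (gC i # u) = xdeg u"

lemma xdeg_append [simp]: "xdeg (u @ v) = xdeg u + xdeg v"
  by (induction u rule: xdeg.induct) auto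

context cyclotomic_space
begin

fun opl :: "sergeev_gen \<Rightarrow> (idx, 'f) lop" where
  "opl (gS i) = ops i" | "opl (gX i) = opX i" | "opl (gC i) = opc i"

fun lam :: "sergeev_gen \<Rightarrow> (idx, 'f) lop" where
  "lam (gS i) = opt i" | "lam (gX i) = lamx i" | "lam (gC i) = opc i"

lemma symb_letter: "l \<in> sergeev_gens n \<Longrightarrow> symb (xdeg [l]) (opl l) (lam l)"
  using symb_ops symb_opX symb_opc by (auto simp: sergeev_gens_def)

lemma symb_word: "set u \<subseteq> sergeev_gens n \<Longrightarrow> symb (xdeg u) (wop opl u) (wop lam u)"
proof (induction u)
  case Nil
  show ?case by (simp add: symb_refl filt_def)
next
  case (Cons l u)
  have "symb (xdeg [l] + xdeg u) (opl l * wop opl u) (lam l * wop lam u)"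
    using Cons by (intro symb_mult symb_letter) auto
  moreover have "xdeg (l # u) = xdeg [l] + xdeg u" by (cases l) auto
  ultimately show ?case by simp
qed

lemma exdeg_bound: "b \<in> Bs \<Longrightarrow> exdeg n (fst b) < Suc (n * d)"
proof -
  assume "b \<in> Bs"
  hence "(\<Sum>j\<in>{1..n}. fst b j) \<le> (\<Sum>j\<in>{1..n}. d)" by (intro sum_mono) (auto simp: Bs_def less_imp_le)
  thus ?thesis by (simp add: exdeg_def)
qed

text \<open>The degree is bounded on \<open>Bs\<close>, so the filtration stops, and an operator of
  any filtration degree preserves \<open>spn Bs\<close>.\<close>

lemma spn_Bs_eq: "spn Bs = (spn (Bl (Suc (n * d))) :: (idx \<Rightarrow>\<^sub>0 'f) set)"
proof -
  have "Bs = Bl (Suc (n * d))" using exdeg_bound by (auto simp: Bl_def)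
  thus ?thesis by simp
qed

lemma filt_Bs: "filt m A \<Longrightarrow> v \<in> spn Bs \<Longrightarrow> ap A v \<in> spn Bs"
  unfolding filt_def spn_Bs_eq using spn_mono[OF _ Bl_subset_Bs] spn_Bs_eq by blast

lemma evalf_Bs:
  assumes "p \<in> free_carrier n" "v \<in> spn Bs"
  shows "ap (evalf opl p) v \<in> spn Bs"
proof -
  have "ap (evalf opl p) v = (\<Sum>w\<in>keys p. scl (coef p w) (ap (wop opl (letters w)) v))"
    by (simp add: evalf_def ap_sum_lop)
  also have "\<dots> \<in> spn Bs"
    using assms by (intro spn_sum spn_scl filt_Bs[OF symb_filt[OF symb_word]]) (auto simp: free_carrier_def)
  finally show ?thesis .
qed

text \<open>Restricted to \<open>spn Bs\<close> because the commutation of the \<open>opX i\<close>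
  is established only there.\<close>

definition annih :: "'f sergeev_free \<Rightarrow> bool" where
  "annih p \<longleftrightarrow> (\<forall>v\<in>spn Bs. ap (evalf opl p) v = 0)"

text \<open>\<open>X\<close> commutes with \<open>s\<close> and \<open>p\<close> as operators, but
  with \<open>Y\<close> only on \<open>spn Bs\<close>. Since \<open>s\<close> preserves this space,
  commutation passes from \<open>Y\<close> to \<open>Z\<close>.\<close>

lemma conjugate_commute:
  assumes XY: "\<And>v. v \<in> spn Bs \<Longrightarrow> ap (X * Y) v = ap (Y * X) v"
    and s: "\<And>v. v \<in> spn Bs \<Longrightarrow> ap s v \<in> spn Bs" and Xs: "X * s = s * X" and Xp: "X * p = p * X"
    and Z: "Z = s * Y * s + p * s" and v: "v \<in> spn Bs"
  shows "ap (X * Z) v = ap (Z * X) v"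
proof -
  have 1: "X * Z = s * (X * Y) * s + p * (s * X)"
    unfolding Z distrib_left mult.assoc[symmetric] Xs Xp by (simp only: mult.assoc Xs)
  have 2: "Z * X = s * (Y * X) * s + p * (s * X)"
    unfolding Z distrib_right mult.assoc by (simp only: Xs)
  have "ap (s * (X * Y) * s) v = ap (s * (Y * X) * s) v"
    using XY[OF s[OF v]] by simp
  thus ?thesis unfolding 1 2 ap_simps(3) by simp
qed

lemma ops_Bs: "1 \<le> j \<Longrightarrow> j < n \<Longrightarrow> (v :: idx \<Rightarrow>\<^sub>0 'f) \<in> spn Bs \<Longrightarrow> ap (ops j) v \<in> spn Bs"
  by (rule filt_Bs[OF symb_filt[OF symb_ops]])

text \<open>Two conjugations per step: \<open>(i, i+1)\<close> leads to \<open>(i, i+2)\<close> by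
  conjugating the second member with \<open>s_(i+1)\<close>, and then to \<open>(i+1, i+2)\<close>
  by conjugating the first with \<open>s_i\<close>, which commutes with
  \<open>opX (i+2)\<close>.\<close>

lemma opX_commute_Suc:
  assumes "1 \<le> i" "Suc i \<le> n" "v \<in> spn Bs"
  shows "ap (opX i * opX (Suc i)) v = ap (opX (Suc i) * opX i) v"
  using assms
proof (induction i arbitrary: v rule: dec_induct)
  case base
  have "v \<in> spn Rd" using base spn_mono[OF _ Bs_subset_Rd] by blast
  thus ?case using opX_1_2_Rd by (simp add: numeral_2_eq_2)
next
  case (step i)
  define k where "k = Suc i"
  have k: "1 \<le> k" "k < n" "i < k" "i < n" "Suc k \<le> n" using step by (auto simp: k_def)
  have XY: "ap (opX i * opX k) v = ap (opX k * opX i) v" if "v \<in> spn Bs" for v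
    unfolding k_def by (rule step(3)) (use step that in auto)
  have ik: "opX i * ops k = ops k * opX i" "opX i * opp k = opp k * opX i"
    using opX_ops_below[OF step(1)] opX_opp[OF k(1), of i] step(1) k by (auto simp: k_def)
  have ZX: "ap (opX i * opX (Suc k)) v = ap (opX (Suc k) * opX i) v" if "v \<in> spn Bs" for v
    by (rule conjugate_commute[OF XY ops_Bs[OF k(1,2)] ik opX_Suc[OF k(1)] that])
  have XZ: "ap (opX (Suc k) * opX i) v = ap (opX i * opX (Suc k)) v" if "v \<in> spn Bs" for v
    by (rule ZX[OF that, symmetric])
  have ki: "opX (Suc k) * ops i = ops i * opX (Suc k)" "opX (Suc k) * opp i = opp i * opX (Suc k)"
    using opX_ops_above[OF step(1), of "Suc k"] opX_opp[OF step(1), of "Suc k"] by (simp_all add: k_def)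
  have "ap (opX (Suc k) * opX k) v = ap (opX k * opX (Suc k)) v"
    by (rule conjugate_commute[OF XZ ops_Bs[OF step(1) k(4)] ki opX_Suc[OF step(1), folded k_def] step.prems(2)])
  thus ?case by (simp only: k_def)
qed

lemma opX_commute_less:
  assumes "1 \<le> i" "i < j" "j \<le> n" "v \<in> spn Bs"
  shows "ap (opX i * opX j) v = ap (opX j * opX i) v"
proof -
  from assms(2) have "Suc i \<le> j" by simp
  thus ?thesis using assms(3,4)
  proof (induction j arbitrary: v rule: dec_induct)
    case base
    thus ?case using opX_commute_Suc assms(1) by simp
  next
    case (step k)
    hence k: "1 \<le> k" "k < n" "i < k" by auto
    have XY: "ap (opX i * opX k) v = ap (opX k * opX i) v" if "v \<in> spn Bs" for v
      by (rule step(3)) (use step that in auto)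
    have ik: "opX i * ops k = ops k * opX i" "opX i * opp k = opp k * opX i"
      using opX_ops_below[OF assms(1) k(3)] opX_opp[OF k(1), of i] assms(1) k by auto
    show ?case
      by (rule conjugate_commute[OF XY ops_Bs[OF k(1,2)] ik opX_Suc[OF k(1)] step.prems(2)])
  qed
qed

lemma opX_commute:
  assumes "i \<in> {1..n}" "j \<in> {1..n}" "v \<in> spn Bs"
  shows "ap (opX i * opX j) v = ap (opX j * opX i) v"
  using opX_commute_less[of i j v] opX_commute_less[of j i v] assms
  by (cases i j rule: linorder_cases) auto

lemma annih_of_eq: "evalf opl p = evalf opl q \<Longrightarrow> annih (p - q)"
  by (simp add: annih_def evalf_diff)

lemma evalf_gen: "evalf opl (gen l) = opl l"
  by simp

lemmas evalf_rel = evalf_mult evalf_gen opl.simps evalf_diff evalf_add evalf_uminus evalf_1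

lemma annih_rel: "sergeev_rel n p q \<Longrightarrow> annih (p - q)"
proof (induction rule: sergeev_rel.induct)
  case (s_sq i)
  show ?case by (rule annih_of_eq) (simp only: evalf_rel ops_sq)
next
  case (s_comm i j)
  have "Suc i < j \<or> Suc j < i" using s_comm(3) by linarith
  hence "ops i * ops j = (ops j * ops i :: (idx, 'f) lop)"
    using ops_commute ops_commute[symmetric] by metis
  thus ?case unfolding annih_def evalf_rel by simp
next
  case (s_braid i)
  show ?case by (rule annih_of_eq) (simp only: evalf_rel Suc_eq_plus1[symmetric] ops_braid)
next
  case (x_comm i j)
  thus ?case using opX_commute[of i j] by (simp add: annih_def evalf_diff evalf_mult)
next
  case (c_sq i)
  show ?case by (rule annih_of_eq) (simp only: evalf_rel opc_sq)
next
  case (c_anticomm i j)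
  show ?case
    by (rule annih_of_eq, unfold evalf_rel) (rule opc_anticommute[OF c_anticomm(3)])
next
  case (s_x i)
  hence "ops i * opX i = opX (i + 1) * ops i - (1 + opc i * opc (i + 1))"
    using ops_opX[of i] unfolding opp_def by simp
  thus ?case by (intro annih_of_eq) (simp only: evalf_rel)
next
  case (s_x_comm i j)
  show ?case
  proof (rule annih_of_eq)
    show "evalf opl (gs i * gx j) = evalf opl (gx j * gs i)"
      using s_x_comm opX_ops_below[of j i] opX_ops_above[of i j]
      by (cases "j < i") (auto simp: evalf_mult)
  qed
next
  case (s_c i)
  show ?case by (rule annih_of_eq) (simp add: evalf_rel ops_opc tp_apply del: evalf_single)
next
  case (s_c_Suc i)
  show ?case by (rule annih_of_eq) (simp add: evalf_rel ops_opc tp_apply del: evalf_single)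
next
  case (s_c_comm i j)
  thus ?case by (intro annih_of_eq) (simp add: evalf_rel ops_opc tp_apply del: evalf_single)
next
  case (x_c i)
  thus ?case by (intro annih_of_eq) (simp add: evalf_rel opX_opc del: evalf_single)
next
  case (x_c_comm i j)
  thus ?case by (intro annih_of_eq) (simp add: evalf_rel opX_opc del: evalf_single)
qed

lemma opX_1_bas: "ap (opX 1) (bas (a, S, w)) =
    (if a 1 = d - 1 then - (\<Sum>k<d. scl (coeff g k) (bas (a(1 := k), S, w))) else bas (a(1 := Suc (a 1)), S, w))"
proof (cases "a 1 = d - 1")
  case True
  have "ap (G 1 * rho) (bas (a, S, w)) = (\<Sum>k\<le>d. scl (coeff g k) (bas (a(1 := k), S, w)))"
    using True by (simp add: rho_bas G_def ap_sum_lop opx_pow_bas del: One_nat_def scl_single)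
  also have "\<dots> = scl (coeff g d) (bas (a(1 := d), S, w)) + (\<Sum>k<d. scl (coeff g k) (bas (a(1 := k), S, w)))"
    using d_pos by (simp add: lessThan_Suc_atMost[symmetric] add.commute)
  finally show ?thesis
    using True d_pos unfolding opX_1 by (simp add: lead_g del: One_nat_def scl_single)
next
  case False
  thus ?thesis unfolding opX_1 by (simp add: rho_bas del: One_nat_def)
qed

definition gpoly :: "'f sergeev_free" where
  "gpoly = (\<Sum>k\<le>degree g. Poly_Mapping.single 0 (coeff g k) * gx 1 ^ k)"

lemma evalf_gx_pow: "evalf opl (gx i ^ k) = opX i ^ k"
  by (induction k) (simp_all add: evalf_1 evalf_mult)

lemma evalf_gpoly: "evalf opl gpoly = (\<Sum>k\<le>d. scalar (coeff g k) * opX 1 ^ k)"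
  by (simp add: gpoly_def evalf_sum evalf_mult evalf_gx_pow degree_g del: One_nat_def)

lemma opX_1_pow_bas:
  assumes "a 1 = 0" "k \<le> d"
  shows "ap (opX 1 ^ k) (bas (a, S, w)) =
    (if k = d then - (\<Sum>k<d. scl (coeff g k) (bas (a(1 := k), S, w))) else bas (a(1 := k), S, w))"
  using assms(2)
proof (induction k)
  case 0
  have "a(1 := 0) = a" using assms(1) by (rule fun_upd_idem)
  moreover have "0 \<noteq> d" using d_pos by linarith
  ultimately show ?case by (simp only: power_0 ap_simps(2) if_False)
next
  case (Suc k)
  have "ap (opX 1 ^ Suc k) (bas (a, S, w)) = ap (opX 1) (bas (a(1 := k), S, w))"
  proof -
    have "k \<noteq> d" "k \<le> d" using Suc(2) by linarith+
    thus ?thesis unfolding power_Suc ap_simps(6) using Suc(1) by (simp only: if_False)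
  qed
  also have "\<dots> = (if k = d - 1 then - (\<Sum>k<d. scl (coeff g k) (bas (a(1 := k), S, w))) else bas (a(1 := Suc k), S, w))"
    by (simp only: opX_1_bas fun_upd_same fun_upd_upd)
  also have "k = d - 1 \<longleftrightarrow> Suc k = d" using Suc(2) by auto
  finally show ?case .
qed

lemma gpoly_commute: "opX 1 ^ k * evalf opl gpoly = evalf opl gpoly * opX 1 ^ k"
proof (rule power_commuting_commutes)
  show "opX 1 * evalf opl gpoly = evalf opl gpoly * opX 1"
    unfolding evalf_gpoly sum_distrib_left sum_distrib_right
    by (rule sum.cong[OF refl]) (simp only: scalar_left_commute[of "opX 1"] mult.assoc power_commutes)
qed

lemma gpoly_bas:
  assumes "a 1 = 0"
  shows "ap (evalf opl gpoly) (bas (a, S, w)) = 0"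
proof -
  let ?R = "\<Sum>k<d. scl (coeff g k) (bas (a(1 := k), S, w))"
  have "(\<Sum>k<d. scl (coeff g k) (ap (opX 1 ^ k) (bas (a, S, w)))) = ?R"
  proof (rule sum.cong[OF refl])
    fix k assume "k \<in> {..<d}"
    thus "scl (coeff g k) (ap (opX 1 ^ k) (bas (a, S, w))) = scl (coeff g k) (bas (a(1 := k), S, w))"
      using opX_1_pow_bas[of a k S w] assms by (simp del: scl_single One_nat_def)
  qed
  moreover have "ap (opX 1 ^ d) (bas (a, S, w)) = - ?R"
    using opX_1_pow_bas[of a d S w] assms by (simp del: scl_single One_nat_def)
  moreover have "ap (evalf opl gpoly) (bas (a, S, w)) = (\<Sum>k<d. scl (coeff g k) (ap (opX 1 ^ k) (bas (a, S, w))))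
      + scl (coeff g d) (ap (opX 1 ^ d) (bas (a, S, w)))"
    unfolding evalf_gpoly ap_sum_lop ap_simps ap_scalar lessThan_Suc_atMost[symmetric] sum.lessThan_Suc ..
  ultimately show ?thesis unfolding lead_g by (simp only: scl_simps right_minus)
qed

lemma opX_1_generates:
  assumes "a 1 < d"
  shows "bas (a, S, w) = ap (opX 1 ^ a 1) (bas (a(1 := 0), S, w))"
proof -
  have "a(1 := a 1) = a" by (rule fun_upd_triv)
  thus ?thesis using opX_1_pow_bas[of "a(1 := 0)" "a 1" S w] assms by (simp del: One_nat_def)
qed

text \<open>\<open>g(opX 1)\<close> commutes with \<open>opX 1\<close>, and reduced vectors are
  powers of \<open>opX 1\<close> applied to vectors without \<open>x_1\<close>. On those,
  \<open>opX 1\<close> raises the exponent until its power \<open>d\<close> yields minus the lower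
  terms of \<open>g\<close>.\<close>

lemma annih_gpoly: "annih gpoly"
  unfolding annih_def
proof
  fix v :: "idx \<Rightarrow>\<^sub>0 'f" assume v: "v \<in> spn Bs"
  have "ap (evalf opl gpoly) v = ap 0 v"
    using v
  proof (rule ap_eq_on_spn)
    fix b assume b: "b \<in> Bs"
    obtain a S w where eq: "b = (a, S, w)" by (cases b)
    have "a 1 < d" using b by (simp add: eq Bs_def)
    hence e: "bas b = ap (opX 1 ^ a 1) (bas (a(1 := 0), S, w))" unfolding eq by (rule opX_1_generates)
    have "ap (evalf opl gpoly) (bas b) = ap (opX 1 ^ a 1) (ap (evalf opl gpoly) (bas (a(1 := 0), S, w)))"
      unfolding e ap_simps(6)[symmetric] gpoly_commute ..
    also have "\<dots> = 0" using gpoly_bas[of "a(1 := 0)" S w] by simp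
    finally show "ap (evalf opl gpoly) (bas b) = ap 0 (bas b)" by simp
  qed
  thus "ap (evalf opl gpoly) v = 0" by simp
qed

end

section \<open>Right multiplication and leading terms\<close>

definition PE :: "bool \<Rightarrow> idx set" where
  "PE e = {(a, S, w). finite S \<and> (even (card S) \<longleftrightarrow> e)}"

lemma even_card_tog: "finite S \<Longrightarrow> even (card (tog S i)) \<longleftrightarrow> odd (card S)"
proof -
  assume f: "finite S"
  show ?thesis
  proof (cases "i \<in> S")
    case True
    hence "tog S i = S - {i}" by auto
    thus ?thesis using f True card_gt_0_iff[of S] by (auto simp: card_Diff_singleton)
  next
    case False
    hence "tog S i = insert i S" by auto
    thus ?thesis using f False by simp
  qed
qed

lemma finite_tog [simp]: "finite (tog S i) \<longleftrightarrow> finite S"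
proof
  have *: "finite T \<Longrightarrow> finite (tog T i)" for T
    by (rule finite_subset[of _ "insert i T"]) auto
  show "finite S \<Longrightarrow> finite (tog S i)" by (rule *)
  show "finite (tog S i) \<Longrightarrow> finite S" using *[of "tog S i"] by simp
qed

lemma vimage_tp: "tp i -` S = tp i ` S"
  by (auto simp: image_iff) (metis tp_tp)

lemma card_vimage_tp [simp]: "card (tp i -` S) = card S"
  unfolding vimage_tp by (rule card_image) (auto intro: inj_on_subset[OF inj_transpose])

lemma finite_vimage_tp [simp]: "finite (tp i -` S) \<longleftrightarrow> finite S"
proof
  have *: "finite T \<Longrightarrow> finite (tp i -` T)" for T by (simp add: vimage_tp)
  show "finite S \<Longrightarrow> finite (tp i -` S)" by (rule *)
  show "finite (tp i -` S) \<Longrightarrow> finite S" using *[of "tp i -` S"] by simp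
qed

text \<open>Parity is a truth value with True for even, so equality of truth values is addition
  modulo 2: \<open>pres True\<close> preserves and \<open>pres False\<close> reverses the
  parity.\<close>

definition pres :: "bool \<Rightarrow> (idx, 'f::field) lop \<Rightarrow> bool" where
  "pres c A \<longleftrightarrow> (\<forall>e. \<forall>v\<in>spn (PE e). ap A v \<in> spn (PE (e = c)))"

lemma pres_mult: "pres c A \<Longrightarrow> pres c' B \<Longrightarrow> pres (c = c') (A * B)"
  unfolding pres_def ap_simps
proof (intro allI ballI)
  fix e and v :: "idx \<Rightarrow>\<^sub>0 'a"
  assume A: "\<forall>e. \<forall>v\<in>spn (PE e). ap A v \<in> spn (PE (e = c))"
    and B: "\<forall>e. \<forall>v\<in>spn (PE e). ap B v \<in> spn (PE (e = c'))" and v: "v \<in> spn (PE e)"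
  have "ap A (ap B v) \<in> spn (PE ((e = c') = c))" using A B v by blast
  moreover have "((e = c') = c) = (e = (c = c'))" by auto
  ultimately show "ap A (ap B v) \<in> spn (PE (e = (c = c')))" by simp
qed

lemma pres_add: "pres c A \<Longrightarrow> pres c B \<Longrightarrow> pres c (A + B)"
  by (auto simp: pres_def intro: spn_add)

lemma pres_1: "pres True 1" by (auto simp: pres_def)

lemma presI: "(\<And>e a S w. (a, S, w) \<in> PE e \<Longrightarrow> ap A (bas (a, S, w)) \<in> spn (PE (e = c))) \<Longrightarrow> pres c A"
  unfolding pres_def by (intro allI ballI, erule ap_spn) auto

lemma pres_opc: "pres False (opc i)"
  by (rule presI) (auto simp: PE_def even_card_tog intro!: spn_single)

lemma pres_ops: "pres True (ops i)"
proof (rule presI)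
  fix e a S w assume b: "(a, S, w) \<in> PE e"
  have "low i (a, S, w) \<subseteq> PE e"
    using b by (auto simp: low_def PE_def even_card_tog)
  hence 1: "ap (ops i) (bas (a, S, w)) - ap (opt i) (bas (a, S, w)) \<in> spn (PE e)"
    by (rule spn_mono[OF ops_low])
  have 2: "ap (opt i) (bas (a, S, w)) \<in> spn (PE e)"
    using b by (auto simp: PE_def intro!: spn_single)
  show "ap (ops i) (bas (a, S, w)) \<in> spn (PE (e = True))"
    using spn_add[OF 1 2] by (simp del: opt_bas)
qed

context cyclotomic_space
begin

lemma pres_opX:
  assumes "1 \<le> i"
  shows "pres True (opX i)"
  using assms
proof (induction i rule: dec_induct)
  case base
  show ?case
    by (rule presI) (auto simp: opX_1_bas PE_def intro!: spn_uminus spn_sum spn_single simp del: One_nat_def)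
next
  case (step i)
  have "pres True (opp i)"
    unfolding opp_def using pres_mult[OF pres_opc pres_opc] by (intro pres_add pres_1) simp
  thus ?case unfolding opX_Suc[OF step(1)]
    using pres_mult[OF pres_mult[OF pres_ops step(3)] pres_ops] pres_mult[OF _ pres_ops]
    by (intro pres_add) auto
qed

lemma not_range_gC [simp]: "gS i \<notin> range gC" "gX i \<notin> range gC" by auto

lemma pres_word: "set u \<subseteq> sergeev_gens n \<Longrightarrow> pres (even (odd_letters (Word u))) (wop opl u)"
proof (induction u)
  case Nil
  thus ?case by (simp add: pres_1 odd_letters_def)
next
  case (Cons l u)
  have "pres (l \<notin> range gC) (opl l)"
    using Cons(2) pres_ops pres_opc pres_opX by (auto simp: sergeev_gens_def)
  from pres_mult[OF this Cons(1)] Cons(2) show ?case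
    by (cases "l \<in> range gC") (auto simp: odd_letters_def)
qed

definition v0 :: "idx \<Rightarrow>\<^sub>0 'f" where "v0 = bas (\<lambda>_. 0, {}, id)"

lemma v0_Bd: "v0 \<in> spn (Bd 0)"
  unfolding v0_def using d_pos by (intro spn_single) (auto simp: Bd_def Bs_def exdeg_def permutes_id)

lemma Bd_subset_Bl: "Bd k \<subseteq> Bl (Suc k)" by (auto simp: Bd_def Bl_def)
lemma Bd_subset_Bs: "Bd k \<subseteq> Bs" by (auto simp: Bd_def)

lemma v0_Bl: "v0 \<in> spn (Bl (Suc 0))" using v0_Bd spn_mono Bd_subset_Bl by blast
lemma v0_Bs: "v0 \<in> spn Bs" using v0_Bd spn_mono Bd_subset_Bs by blast

lemma even_eval:
  assumes "p \<in> free_carrier n" "\<forall>w\<in>keys p. even (odd_letters w)"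
  shows "ap (evalf opl p) v0 \<in> spn (PE True)"
proof -
  have v: "v0 \<in> spn (PE True)" unfolding v0_def by (intro spn_single) (simp add: PE_def)
  have "ap (evalf opl p) v0 = (\<Sum>w\<in>keys p. scl (coef p w) (ap (wop opl (letters w)) v0))"
    by (simp add: evalf_def ap_sum_lop)
  also have "\<dots> \<in> spn (PE True)"
  proof (intro spn_sum spn_scl)
    fix w assume w: "w \<in> keys p"
    have "pres (even (odd_letters (Word (letters w)))) (wop opl (letters w))"
      by (rule pres_word) (use assms w in \<open>auto simp: free_carrier_def\<close>)
    moreover have "Word (letters w) = w" by (cases w) simp
    ultimately show "ap (wop opl (letters w)) v0 \<in> spn (PE True)"
      using v assms(2) w by (auto simp: pres_def)
  qed
  finally show ?thesis .
qed

section \<open>Right multiplication in the graded algebra\<close>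

definition rops :: "nat \<Rightarrow> (idx, 'f) lop" where
  "rops i = mk (\<lambda>(a, S, w). bas (a, S, w \<circ> tp i))"

text \<open>\<open>w c_i = c_(w i) w\<close>, and the letter then passes the letters of
  \<open>c^S\<close> with larger index. Their number is \<open>card S - nlt S (w i)\<close>, less
  one if \<open>w i\<close> lies in \<open>S\<close>; for the parity all signs may be taken
  positive.\<close>

definition ropc :: "nat \<Rightarrow> (idx, 'f) lop" where
  "ropc i = mk (\<lambda>(a, S, w). Poly_Mapping.single (a, tog S (w i), w)
     (if even (card S + nlt S (w i) + (if w i \<in> S then 1 else 0)) then 1 else -1))"

text \<open>To leading order \<open>w x_i = x_(w i) w\<close>, and \<open>x_(w i)\<close> passes
  \<open>c^S\<close> with a sign exactly if the letter \<open>c_(w i)\<close> occurs.\<close>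

definition ropx :: "nat \<Rightarrow> (idx, 'f) lop" where
  "ropx i = mk (\<lambda>(a, S, w). if a (w i) = d - 1 then 0
     else Poly_Mapping.single (a(w i := Suc (a (w i))), S, w) (if w i \<in> S then -1 else 1))"

fun rop :: "sergeev_gen \<Rightarrow> (idx, 'f) lop" where
  "rop (gS i) = rops i" | "rop (gX i) = ropx i" | "rop (gC i) = ropc i"

lemma rops_bas: "ap (rops i) (Poly_Mapping.single (a, S, w) z) = Poly_Mapping.single (a, S, w \<circ> tp i) z"
  by (subst ap_single) (simp add: rops_def)

lemma ropc_bas: "ap (ropc i) (Poly_Mapping.single (a, S, w) z) = Poly_Mapping.single (a, tog S (w i), w)
    (if even (card S + nlt S (w i) + (if w i \<in> S then 1 else 0)) then z else - z)"
  by (subst ap_single) (simp add: ropc_def)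

lemma ropx_bas: "ap (ropx i) (Poly_Mapping.single (a, S, w) z) = (if a (w i) = d - 1 then 0
     else Poly_Mapping.single (a(w i := Suc (a (w i))), S, w) (if w i \<in> S then - z else z))"
  by (subst ap_single) (simp add: ropx_def)

lemma opt_sign_commute:
  assumes "finite S"
  shows "(even (card S + nlt S k + (if k \<in> S then 1 else 0)) = (i \<in> tog S k \<and> Suc i \<in> tog S k))
     = (even (card S + nlt (tp i -` S) (tp i k) + (if k \<in> S then 1 else 0)) = (i \<in> S \<and> Suc i \<in> S))"
proof -
  have "k < i \<or> k = i \<or> k = Suc i \<or> Suc i < k" by linarith
  moreover have "tp i k = k" if "k < i \<or> Suc i < k" using that by (auto simp: tp_apply)
  ultimately show ?thesis
    by (elim disjE)
      (auto simp: nlt_tp_below nlt_tp_Suc nlt_tp_above nlt_Suc tp_apply)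
qed

text \<open>Associativity of the graded algebra, which is never constructed; it is checked for each
  pair of generators.\<close>

lemma lam_rop_commute:
  assumes "b \<in> Bs"
  shows "ap (lam l) (ap (rop m) (bas b)) = ap (rop m) (ap (lam l) (bas b))"
proof -
  obtain a S w where b: "b = (a, S, w)" by (cases b)
  have fin: "finite S" using assms b finite_subset[of S "{1..n}"] by (auto simp: Bs_def)
  show ?thesis
  proof (cases m)
    case m: (gS i)
    show ?thesis
      by (cases l) (auto simp: b m rops_bas lamx_bas comp_assoc)
  next
    case m: (gX i)
    show ?thesis
    proof (cases l)
      case (gS j)
      thus ?thesis by (auto simp: b m ropx_bas upd_comp_tp single_uminus ap_uminus)
    next
      case (gX j)
      thus ?thesis by (auto simp: b m ropx_bas lamx_bas fun_upd_twist single_uminus ap_uminus)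
    next
      case (gC j)
      thus ?thesis by (auto simp: b m ropx_bas single_uminus ap_uminus)
    qed
  next
    case m: (gC i)
    show ?thesis
    proof (cases l)
      case (gS j)
      thus ?thesis using opt_sign_commute[OF fin, of "w i" j]
        by (simp add: b m ropc_bas tog_vimage_tp del: tog_iff) (auto simp: tog_vimage_tp simp del: tog_iff)
    next
      case (gX j)
      thus ?thesis by (auto simp: b m ropc_bas lamx_bas)
    next
      case (gC j)
      thus ?thesis using even_card_tog[OF fin, of j]
        by (auto simp: b m ropc_bas even_nlt_tog tog_commute[of _ "w i" j] even_card_tog[OF fin] single_uminus)
    qed
  qed
qed

lemma rop_v0: "ap (rop l) v0 = ap (lam l) v0"
proof -
  have "(\<lambda>_. 0 :: nat) \<circ> f = (\<lambda>_. 0)" for f :: "nat \<Rightarrow> nat" by auto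
  thus ?thesis using d_pos by (cases l) (auto simp: v0_def rops_bas ropc_bas ropx_bas lamx_bas nlt_def)
qed

lemma lam_Bd: "l \<in> sergeev_gens n \<Longrightarrow> v \<in> spn (Bd k) \<Longrightarrow> ap (lam l) v \<in> spn (Bd (k + xdeg [l]))"
proof (erule ap_spn)
  fix b assume l: "l \<in> sergeev_gens n" and b: "b \<in> Bd k"
  obtain a S w where eq: "b = (a, S, w)" by (cases b)
  have lt: "a j < d" for j using b by (simp add: eq Bd_def Bs_def)
  from l consider i where "l = gS i" "1 \<le> i" "i < n" | i where "l = gX i" "1 \<le> i" "i \<le> n" | i where "l = gC i" "1 \<le> i" "i \<le> n"
    by (auto simp: sergeev_gens_def)
  thus "ap (lam l) (bas b) \<in> spn (Bd (k + xdeg [l]))"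
  proof cases
    case (1 i)
    thus ?thesis using b by (auto simp: eq Bd_def exdeg_tp intro!: spn_single Bs_opt)
  next
    case (2 i)
    have "exdeg n (a(i := Suc (a i))) = Suc (exdeg n a)" using 2 exdeg_upd[of i n a "Suc (a i)"] by auto
    moreover have "a i \<noteq> d - 1 \<Longrightarrow> Suc (a i) < d" using lt[of i] by linarith
    ultimately show ?thesis using b 2 by (auto simp: eq lamx_bas Bd_def Bs_def intro!: spn_single)
  next
    case (3 i)
    thus ?thesis using b by (auto simp: eq Bd_def Bs_def intro!: spn_single)
  qed
qed

lemma rop_Bd: "l \<in> sergeev_gens n \<Longrightarrow> v \<in> spn (Bd k) \<Longrightarrow> ap (rop l) v \<in> spn (Bd (k + xdeg [l]))"
proof (erule ap_spn)
  fix b assume l: "l \<in> sergeev_gens n" and b: "b \<in> Bd k"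
  obtain a S w where eq: "b = (a, S, w)" by (cases b)
  have lt: "a j < d" for j using b by (simp add: eq Bd_def Bs_def)
  have w: "w permutes {1..n}" using b by (simp add: eq Bd_def Bs_def)
  have wi: "w i \<in> {1..n}" if "1 \<le> i" "i \<le> n" for i using that permutes_in_image[OF w, of i] by simp
  from l consider i where "l = gS i" "1 \<le> i" "i < n" | i where "l = gX i" "1 \<le> i" "i \<le> n" | i where "l = gC i" "1 \<le> i" "i \<le> n"
    by (auto simp: sergeev_gens_def)
  thus "ap (rop l) (bas b) \<in> spn (Bd (k + xdeg [l]))"
  proof cases
    case (1 i)
    have "w \<circ> tp i permutes {1..n}" using permutes_compose[OF tp_permutes w] 1 by simp
    thus ?thesis using b 1 by (auto simp: eq rops_bas Bd_def Bs_def intro!: spn_single)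
  next
    case (2 i)
    define j where "j = w i"
    have j: "1 \<le> j" "j \<le> n" using wi[OF 2(2,3)] by (auto simp: j_def)
    have "exdeg n (a(j := Suc (a j))) = Suc (exdeg n a)" using j exdeg_upd[of j n a "Suc (a j)"] by auto
    moreover have "a j \<noteq> d - 1 \<Longrightarrow> Suc (a j) < d" using lt[of j] by linarith
    ultimately show ?thesis using b 2(1) j by (auto simp: eq ropx_bas Bd_def Bs_def j_def[symmetric] intro!: spn_single)
  next
    case (3 i)
    thus ?thesis using b wi[OF 3(2,3)] by (auto simp: eq ropc_bas Bd_def Bs_def intro!: spn_single)
  qed
qed

lemma lam_word_Bd: "set u \<subseteq> sergeev_gens n \<Longrightarrow> ap (wop lam u) v0 \<in> spn (Bd (xdeg u))"
proof (induction u)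
  case Nil
  thus ?case by (simp add: v0_Bd)
next
  case (Cons l u)
  have "xdeg (l # u) = xdeg u + xdeg [l]" by (cases l) auto
  thus ?case using lam_Bd[of l "ap (wop lam u) v0" "xdeg u"] Cons by simp
qed

text \<open>Appending a letter to a word is right multiplication of the result: on \<open>v0\<close>
  left and right multiplication agree, and the right one then commutes out past the word.\<close>

lemma lam_word_rop:
  assumes "m \<in> sergeev_gens n" "set u \<subseteq> sergeev_gens n"
  shows "ap (wop lam u) (ap (lam m) v0) = ap (rop m) (ap (wop lam u) v0)"
  using assms(2)
proof (induction u)
  case Nil
  thus ?case by (simp add: rop_v0)
next
  case (Cons l u)
  have "ap (lam l * rop m) (ap (wop lam u) v0) = ap (rop m * lam l) (ap (wop lam u) v0)"
  proof (rule ap_eq_on_spn[of _ Bs])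
    show "ap (wop lam u) v0 \<in> spn Bs"
      by (rule spn_mono[OF lam_word_Bd Bd_subset_Bs]) (use Cons(2) in auto)
  qed (simp add: lam_rop_commute)
  thus ?case using Cons by simp
qed

definition toppart :: "nat \<Rightarrow> 'f sergeev_free \<Rightarrow> (idx, 'f) lop" where
  "toppart K q = (\<Sum>u\<in>{u \<in> keys q. xdeg (letters u) = K}. scalar (coef q u) * wop lam (letters u))"

lemma filt_scalar: "filt m A \<Longrightarrow> filt m (scalar z * A)"
  by (simp add: filt_def spn_scl)
lemma low_order_scalar: "low_order m A \<Longrightarrow> low_order m (scalar z * A)"
  by (simp add: low_order_def spn_scl)
lemma filt_sum: "(\<And>x. x \<in> I \<Longrightarrow> filt m (h x)) \<Longrightarrow> filt m (sum h I)"
  by (simp add: filt_def ap_sum_lop spn_sum)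
lemma low_order_sum: "(\<And>x. x \<in> I \<Longrightarrow> low_order m (h x)) \<Longrightarrow> low_order m (sum h I)"
  by (simp add: low_order_def ap_sum_lop spn_sum)

lemma filt_low_order_less: "filt m A \<Longrightarrow> m < K \<Longrightarrow> low_order K A"
  unfolding filt_def low_order_def
proof (intro allI ballI)
  fix k and v :: "idx \<Rightarrow>\<^sub>0 'f"
  assume "\<forall>k. \<forall>v\<in>spn (Bl k). ap A v \<in> spn (Bl (k + m))" "m < K" "v \<in> spn (Bl (Suc k))"
  hence "ap A v \<in> spn (Bl (Suc k + m))" by blast
  thus "ap A v \<in> spn (Bl (k + K))" by (rule spn_mono) (rule Bl_mono, use \<open>m < K\<close> in simp)
qed

lemma symb_eval:
  assumes "q \<in> free_carrier n" "\<And>u. u \<in> keys q \<Longrightarrow> xdeg (letters u) \<le> K"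
  shows "symb K (evalf opl q) (toppart K q)"
proof -
  have s: "symb (xdeg (letters u)) (wop opl (letters u)) (wop lam (letters u))" if "u \<in> keys q" for u
    using symb_word assms(1) that by (auto simp: free_carrier_def)
  have f: "filt K (toppart K q)"
    unfolding toppart_def by (intro filt_sum filt_scalar) (use s in \<open>auto simp: symb_def\<close>)
  have "evalf opl q = (\<Sum>u\<in>{u \<in> keys q. xdeg (letters u) = K}. scalar (coef q u) * wop opl (letters u))
      + (\<Sum>u\<in>{u \<in> keys q. xdeg (letters u) \<noteq> K}. scalar (coef q u) * wop opl (letters u))"
    unfolding evalf_def by (subst sum.union_disjoint[symmetric]) (auto intro!: sum.cong)
  hence e: "evalf opl q - toppart K q = (\<Sum>u\<in>{u \<in> keys q. xdeg (letters u) = K}. scalar (coef q u) * (wop opl (letters u) - wop lam (letters u)))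
      + (\<Sum>u\<in>{u \<in> keys q. xdeg (letters u) \<noteq> K}. scalar (coef q u) * wop opl (letters u))"
    by (simp add: toppart_def right_diff_distrib sum_subtractf)
  have "low_order K (evalf opl q - toppart K q)"
    unfolding e
  proof (intro low_order_add low_order_sum low_order_scalar)
    fix u assume u: "u \<in> {u \<in> keys q. xdeg (letters u) \<noteq> K}"
    hence "xdeg (letters u) < K" using assms(2)[of u] by auto
    thus "low_order K (wop opl (letters u))" using symb_filt[OF s] u filt_low_order_less by blast
  qed (use s in \<open>auto simp: symb_def\<close>)
  thus ?thesis using f by (simp add: symb_def)
qed

lemma toppart_Bd: "q \<in> free_carrier n \<Longrightarrow> ap (toppart K q) v0 \<in> spn (Bd K)"
  unfolding toppart_def ap_sum_lop ap_simps ap_scalar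
  by (intro spn_sum spn_scl) (use lam_word_Bd in \<open>auto simp: free_carrier_def\<close>)

lemma spn_Bd_Bl_disjoint: "v \<in> spn (Bd k) \<Longrightarrow> v \<in> spn (Bl k) \<Longrightarrow> v = 0"
proof (rule poly_mapping_eqI)
  fix b assume v: "v \<in> spn (Bd k)" "v \<in> spn (Bl k)"
  have "b \<notin> Bd k \<or> b \<notin> Bl k" by (auto simp: Bd_def Bl_def)
  moreover have "b \<notin> Bd k \<Longrightarrow> coef v b = 0" "b \<notin> Bl k \<Longrightarrow> coef v b = 0"
    using v unfolding spn_iff by blast+
  ultimately show "coef v b = coef 0 b" by auto
qed

text \<open>The two products agree on \<open>v0\<close>, so the difference of their leading terms
  has lower degree. It is also homogeneous of the full degree, hence zero.\<close>

lemma central_toppart: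
  assumes q: "q \<in> free_carrier n" and K: "\<And>u. u \<in> keys q \<Longrightarrow> xdeg (letters u) \<le> K"
    and y: "y \<in> sergeev_gens n" and c: "annih (gen y * q - q * gen y)"
  shows "ap (lam y) (ap (toppart K q) v0) = ap (rop y) (ap (toppart K q) v0)"
proof -
  let ?T = "toppart K q" and ?A = "evalf opl q"
  have sT: "symb K ?A ?T" by (rule symb_eval[OF q K])
  have sy: "symb (xdeg [y]) (opl y) (lam y)" by (rule symb_letter[OF y])
  have 1: "ap (opl y * ?A) v0 - ap (lam y * ?T) v0 \<in> spn (Bl (xdeg [y] + K))"
    using symb_mult[OF sy sT] v0_Bl unfolding symb_def low_order_def by fastforce
  have 2: "ap (?A * opl y) v0 - ap (?T * lam y) v0 \<in> spn (Bl (K + xdeg [y]))"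
    using symb_mult[OF sT sy] v0_Bl unfolding symb_def low_order_def by fastforce
  have T: "ap (?T * lam y) v0 = ap (rop y) (ap ?T v0)"
    unfolding toppart_def ap_simps(6) ap_sum_lop ap_scalar ap_sum ap_scl
  proof (rule sum.cong[OF refl])
    fix u assume "u \<in> {u \<in> keys q. xdeg (letters u) = K}"
    hence "set (letters u) \<subseteq> sergeev_gens n" using q by (auto simp: free_carrier_def)
    thus "scl (coef q u) (ap (wop lam (letters u)) (ap (lam y) v0)) = scl (coef q u) (ap (rop y) (ap (wop lam (letters u)) v0))"
      by (simp only: lam_word_rop[OF y])
  qed
  have "ap (opl y * ?A) v0 = ap (?A * opl y) v0"
    using c v0_Bs by (simp add: annih_def evalf_diff evalf_mult)
  hence "ap (lam y) (ap ?T v0) - ap (rop y) (ap ?T v0) \<in> spn (Bl (K + xdeg [y]))"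
    using spn_diff[OF 2 1[unfolded add.commute[of "xdeg [y]" K]]] T by simp
  moreover have "ap (lam y) (ap ?T v0) - ap (rop y) (ap ?T v0) \<in> spn (Bd (K + xdeg [y]))"
    using y toppart_Bd[OF q] by (intro spn_diff lam_Bd rop_Bd)
  ultimately show ?thesis using spn_Bd_Bl_disjoint by fastforce
qed

end

section \<open>Words of adjacent transpositions\<close>

primrec pw :: "nat list \<Rightarrow> nat \<Rightarrow> nat" where
  "pw [] = id"
| "pw (i # l) = tp i \<circ> pw l"

lemma pw_append: "pw (l @ l') = pw l \<circ> pw l'"
  by (induction l) (auto simp: comp_assoc)

lemma pw_rev: "pw (rev l) \<circ> pw l = id" "pw l \<circ> pw (rev l) = id"
proof -
  show 1: "pw (rev l) \<circ> pw l = id" for l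
    by (induction l) (auto simp: pw_append fun_eq_iff)
  show "pw l \<circ> pw (rev l) = id" using 1[of "rev l"] by simp
qed

lemma pw_permutes: "set l \<subseteq> {1..<n} \<Longrightarrow> pw l permutes {1..n}"
proof (induction l)
  case (Cons i l)
  have "tp i permutes {1..n}" using Cons(2) by (intro permutes_swap_id) auto
  moreover have "pw l permutes {1..n}" using Cons by simp
  ultimately show ?case unfolding pw.simps by (intro permutes_compose)
qed (simp add: permutes_id)

text \<open>The inner induction raises the image of the last index step by step with adjacent
  transpositions; once this index is fixed, the outer induction applies.\<close>

lemma permutes_pw:
  assumes "\<sigma> permutes {1..n}"
  obtains l where "set l \<subseteq> {1..<n}" "\<sigma> = pw l"
proof -
  have "\<exists>l. set l \<subseteq> {1..<n} \<and> \<sigma> = pw l"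
    using assms
  proof (induction n arbitrary: \<sigma>)
    case 0
    hence "\<sigma> = id" by simp
    thus ?case by (intro exI[of _ "[]"]) simp
  next
    case (Suc n)
    have "\<sigma> permutes {1..Suc n} \<Longrightarrow> \<exists>l. set l \<subseteq> {1..<Suc n} \<and> \<sigma> = pw l" for \<sigma>
    proof (induction "Suc n - \<sigma> (Suc n)" arbitrary: \<sigma>)
      case 0
      have "\<sigma> (Suc n) \<in> {1..Suc n}" using permutes_in_image[OF 0(2), of "Suc n"] by simp
      hence fx: "\<sigma> (Suc n) = Suc n" using 0(1) by simp
      have "\<sigma> permutes {1..n}"
      proof (rule permutes_superset[OF 0(2)])
        fix x assume "x \<in> {1..Suc n} - {1..n}"
        hence "x = Suc n" by auto
        thus "\<sigma> x = x" using fx by simp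
      qed
      then obtain l where "set l \<subseteq> {1..<n}" "\<sigma> = pw l" using Suc.IH by blast
      thus ?case by (intro exI[of _ l]) auto
    next
      case (Suc m)
      let ?k = "\<sigma> (Suc n)"
      have k: "?k \<in> {1..Suc n}" using permutes_in_image[OF Suc(3), of "Suc n"] by simp
      have kn: "?k < Suc n" using Suc(2) by simp
      have t: "tp ?k permutes {1..Suc n}" using k kn by (intro permutes_swap_id) auto
      have "(tp ?k \<circ> \<sigma>) (Suc n) = Suc ?k" by (simp add: tp_apply)
      hence "m = Suc n - (tp ?k \<circ> \<sigma>) (Suc n)" using Suc(2) by simp
      from Suc(1)[OF this permutes_compose[OF Suc(3) t]] obtain l where
        l: "set l \<subseteq> {1..<Suc n}" "tp ?k \<circ> \<sigma> = pw l" by blast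
      have "\<sigma> = tp ?k \<circ> pw l" unfolding l(2)[symmetric] by (simp add: fun_eq_iff)
      thus ?case using l(1) k kn by (intro exI[of _ "?k # l"]) auto
    qed
    thus ?case using Suc.prems by blast
  qed
  thus ?thesis using that by blast
qed

section \<open>Rooted permutations\<close>

definition Rt :: "nat \<Rightarrow> (nat \<Rightarrow> nat) \<Rightarrow> nat set" where
  "Rt n w = {r \<in> {1..n}. \<forall>k. r \<le> (w ^^ k) r}"

definition dst :: "nat \<Rightarrow> (nat \<Rightarrow> nat) \<Rightarrow> nat \<Rightarrow> nat" where
  "dst n w x = (LEAST k. (w ^^ k) x \<in> Rt n w)"

definition rt :: "nat \<Rightarrow> (nat \<Rightarrow> nat) \<Rightarrow> nat \<Rightarrow> nat" where
  "rt n w x = (w ^^ dst n w x) x"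

text \<open>The successor of the root is the point of the cycle farthest from the root, so the
  length of the cycle is its distance plus one.\<close>

definition clen :: "nat \<Rightarrow> (nat \<Rightarrow> nat) \<Rightarrow> nat \<Rightarrow> nat" where
  "clen n w r = Suc (dst n w (w r))"

locale rooted =
  fixes n :: nat and w :: "nat \<Rightarrow> nat"
  assumes w: "w permutes {1..n}"
begin

lemma funpow_in: "x \<in> {1..n} \<Longrightarrow> (w ^^ k) x \<in> {1..n}"
  by (induction k) (use permutes_in_image[OF w] in auto)

lemma w_in: "x \<in> {1..n} \<Longrightarrow> w x \<in> {1..n}"
  using permutes_in_image[OF w] by auto

lemma funpow_swap: "(w ^^ k) (w x) = w ((w ^^ k) x)"
  by (metis funpow_swap1)

lemma reach: "x \<in> {1..n} \<Longrightarrow> \<exists>k. (w ^^ k) x \<in> Rt n w"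
proof -
  assume x: "x \<in> {1..n}"
  define k where "k = (ARG_MIN (\<lambda>k. (w ^^ k) x) k. True)"
  have "(w ^^ k) x \<le> (w ^^ j) x" for j
    unfolding k_def by (rule arg_min_nat_le) simp
  hence "(w ^^ k) x \<le> (w ^^ i) ((w ^^ k) x)" for i
    by (metis funpow_add o_apply)
  hence "(w ^^ k) x \<in> Rt n w" using funpow_in[OF x] by (simp add: Rt_def)
  thus ?thesis ..
qed

lemma rt_Rt: "x \<in> {1..n} \<Longrightarrow> rt n w x \<in> Rt n w"
  unfolding rt_def dst_def using LeastI_ex[OF reach] by blast

lemma Rt_in: "Rt n w \<subseteq> {1..n}" by (auto simp: Rt_def)

lemma finite_Rt [simp]: "finite (Rt n w)" using Rt_in finite_subset by blast

lemma dst_0: "x \<in> {1..n} \<Longrightarrow> dst n w x = 0 \<longleftrightarrow> x \<in> Rt n w"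
proof
  assume "x \<in> {1..n}" "dst n w x = 0"
  thus "x \<in> Rt n w" using rt_Rt[of x] by (simp add: rt_def)
next
  assume "x \<in> Rt n w"
  thus "dst n w x = 0" unfolding dst_def by (intro Least_eq_0) simp
qed

lemma dst_Suc:
  assumes "x \<in> {1..n}" "x \<notin> Rt n w"
  shows "dst n w x = Suc (dst n w (w x))"
proof -
  have "(LEAST k. (w ^^ k) x \<in> Rt n w) = Suc (LEAST k. (w ^^ Suc k) x \<in> Rt n w)"
    using reach[OF assms(1)] by (elim exE) (rule Least_Suc, assumption, use assms(2) in simp)
  thus ?thesis by (simp add: dst_def funpow_swap)
qed

lemma rt_step: "x \<in> {1..n} \<Longrightarrow> x \<notin> Rt n w \<Longrightarrow> rt n w (w x) = rt n w x"
  by (simp add: rt_def dst_Suc funpow_swap)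

lemma rt_root: "r \<in> Rt n w \<Longrightarrow> rt n w r = r"
proof -
  assume r: "r \<in> Rt n w"
  hence "dst n w r = 0" using dst_0[of r] Rt_in by blast
  thus ?thesis by (simp add: rt_def)
qed

text \<open>Some power of \<open>w\<close> is the identity, so \<open>r\<close> can be reached from
  the root found from \<open>w r\<close>. Both are least in their orbits, hence equal.\<close>

lemma rt_w_root:
  assumes "r \<in> Rt n w"
  shows "rt n w (w r) = r"
proof -
  have r: "r \<in> {1..n}" using assms Rt_in by blast
  define k where "k = Suc (dst n w (w r))"
  have e: "rt n w (w r) = (w ^^ k) r" by (simp add: rt_def k_def funpow_swap)
  have R: "(w ^^ k) r \<in> Rt n w" using rt_Rt[OF w_in[OF r]] e by simp
  have "permutation w" using w by (auto simp: permutation_permutes)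
  then obtain p where p: "w ^^ p = id" "p > 0" using permutation_is_nilpotent by blast
  have "w ^^ (p * k) = id" by (metis funpow_mult id_funpow p(1))
  moreover have "p * k = (p * k - k) + k" using p(2) by simp
  ultimately have "(w ^^ (p * k - k)) ((w ^^ k) r) = r" by (metis funpow_add o_apply id_apply)
  moreover have "\<forall>j. (w ^^ k) r \<le> (w ^^ j) ((w ^^ k) r)" using R by (simp add: Rt_def)
  ultimately have "(w ^^ k) r \<le> r" by metis
  moreover have "r \<le> (w ^^ k) r" using assms by (simp add: Rt_def)
  ultimately show ?thesis using e by simp
qed

lemma rt_w: "x \<in> {1..n} \<Longrightarrow> rt n w (w x) = rt n w x"
  using rt_step rt_w_root rt_root by (cases "x \<in> Rt n w") auto

lemma inj_w: "inj w" using w by (rule permutes_inj)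

lemma dst_eq_imp:
  "x \<in> {1..n} \<Longrightarrow> y \<in> {1..n} \<Longrightarrow> rt n w x = rt n w y \<Longrightarrow> dst n w x = dst n w y \<Longrightarrow> x = y"
  unfolding rt_def using inj_fn[OF inj_w] by (metis injD)

lemma dst_iterate:
  assumes "x \<in> {1..n}" "k \<le> dst n w x"
  shows "dst n w ((w ^^ k) x) = dst n w x - k \<and> rt n w ((w ^^ k) x) = rt n w x"
  using assms(2)
proof (induction k)
  case (Suc k)
  have in': "(w ^^ k) x \<in> {1..n}" by (rule funpow_in[OF assms(1)])
  have "(w ^^ k) x \<notin> Rt n w" using Suc dst_0[OF in'] by auto
  thus ?case using Suc dst_Suc[OF in'] rt_step[OF in'] by auto
qed simp

text \<open>A point farther away than the successor of the root would pass, on its way, a non-root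
  \<open>z\<close> such that \<open>w z\<close> has the same root and distance as that successor.
  Then \<open>w z\<close> is the successor and \<open>z\<close> is the root, a
  contradiction.\<close>

lemma dst_less_clen:
  assumes "x \<in> {1..n}"
  shows "dst n w x < clen n w (rt n w x)"
proof -
  let ?r = "rt n w x"
  have r: "?r \<in> Rt n w" "?r \<in> {1..n}" using rt_Rt[OF assms] Rt_in by auto
  let ?y = "w ?r"
  have y: "?y \<in> {1..n}" "rt n w ?y = ?r" using w_in r rt_w_root by auto
  have "(w ^^ Suc (dst n w x)) x = ?y" by (simp add: rt_def)
  have "dst n w x \<le> dst n w ?y"
  proof (rule ccontr)
    assume "\<not> ?thesis"
    hence l: "dst n w ?y < dst n w x" by simp
    let ?z = "(w ^^ (dst n w x - Suc (dst n w ?y))) x"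
    have "dst n w ?z = Suc (dst n w ?y)" "rt n w ?z = ?r" and z: "?z \<in> {1..n}"
      using dst_iterate[OF assms, of "dst n w x - Suc (dst n w ?y)"] l funpow_in[OF assms] by auto
    hence "?z \<notin> Rt n w" using dst_0[OF z] by auto
    hence "dst n w (w ?z) = dst n w ?y" "rt n w (w ?z) = ?r"
      using dst_Suc[OF z] \<open>dst n w ?z = Suc (dst n w ?y)\<close> rt_w[OF z] \<open>rt n w ?z = ?r\<close> by auto
    hence "w ?z = ?y" using dst_eq_imp[OF w_in[OF z] y(1)] y(2) by simp
    hence "?z = ?r" using inj_w by (simp add: inj_eq)
    thus False using \<open>?z \<notin> Rt n w\<close> r by simp
  qed
  thus ?thesis by (simp add: clen_def)
qed

lemma card_fiber:
  assumes "r \<in> Rt n w"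
  shows "card {x \<in> {1..n}. rt n w x = r} = clen n w r"
proof -
  have r: "r \<in> {1..n}" using assms Rt_in by blast
  have y: "w r \<in> {1..n}" "rt n w (w r) = r" using w_in[OF r] rt_w_root[OF assms] by auto
  have "bij_betw (dst n w) {x \<in> {1..n}. rt n w x = r} {..<clen n w r}"
    unfolding bij_betw_def
  proof
    show "inj_on (dst n w) {x \<in> {1..n}. rt n w x = r}"
      by (rule inj_onI) (auto intro: dst_eq_imp)
    show "dst n w ` {x \<in> {1..n}. rt n w x = r} = {..<clen n w r}"
    proof
      show "dst n w ` {x \<in> {1..n}. rt n w x = r} \<subseteq> {..<clen n w r}"
        using dst_less_clen by auto
      show "{..<clen n w r} \<subseteq> dst n w ` {x \<in> {1..n}. rt n w x = r}"
      proof
        fix j assume j: "j \<in> {..<clen n w r}"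
        let ?z = "(w ^^ (dst n w (w r) - j)) (w r)"
        have "dst n w ?z = j" "rt n w ?z = r"
          using dst_iterate[OF y(1), of "dst n w (w r) - j"] j y by (auto simp: clen_def)
        thus "j \<in> dst n w ` {x \<in> {1..n}. rt n w x = r}"
          using funpow_in[OF y(1)] by (intro image_eqI[of _ _ ?z]) auto
      qed
    qed
  qed
  thus ?thesis using bij_betw_same_card by fastforce
qed

lemma sum_clen: "(\<Sum>r\<in>Rt n w. clen n w r) = n"
proof -
  have "(\<Sum>r\<in>Rt n w. card {x \<in> {1..n}. rt n w x = r}) = card (\<Union>r\<in>Rt n w. {x \<in> {1..n}. rt n w x = r})"
    by (rule card_UN_disjoint[symmetric]) auto
  also have "(\<Union>r\<in>Rt n w. {x \<in> {1..n}. rt n w x = r}) = {1..n}" using rt_Rt by auto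
  finally have "(\<Sum>r\<in>Rt n w. card {x \<in> {1..n}. rt n w x = r}) = n" by simp
  moreover have "(\<Sum>r\<in>Rt n w. card {x \<in> {1..n}. rt n w x = r}) = (\<Sum>r\<in>Rt n w. clen n w r)"
    by (rule sum.cong[OF refl]) (rule card_fiber)
  ultimately show ?thesis by simp
qed

end

text \<open>A bijection between roots that preserves cycle lengths extends along the cycles, by counting the
  distance to the root.\<close>

lemma conjugator:
  assumes w: "w permutes {1..n}" and w': "w' permutes {1..n}"
    and \<tau>: "bij_betw \<tau> (Rt n w) (Rt n w')"
    and len: "\<And>r. r \<in> Rt n w \<Longrightarrow> clen n w' (\<tau> r) = clen n w r"
  obtains \<sigma> where "\<sigma> permutes {1..n}" "\<sigma> \<circ> w = w' \<circ> \<sigma>" "\<And>r. r \<in> Rt n w \<Longrightarrow> \<sigma> r = \<tau> r"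
    "\<And>x. x \<in> {1..n} \<Longrightarrow> \<sigma> x \<in> Rt n w' \<longleftrightarrow> x \<in> Rt n w"
proof -
  interpret W: rooted n w by unfold_locales (rule w)
  interpret W': rooted n w' by unfold_locales (rule w')
  have ex: "\<exists>y. y \<in> {1..n} \<and> rt n w' y = \<tau> (rt n w x) \<and> dst n w' y = dst n w x" if x: "x \<in> {1..n}" for x
  proof -
    have r: "rt n w x \<in> Rt n w" by (rule W.rt_Rt[OF x])
    hence r': "\<tau> (rt n w x) \<in> Rt n w'" using \<tau> by (auto simp: bij_betw_def)
    hence i: "w' (\<tau> (rt n w x)) \<in> {1..n}" using W'.w_in W'.Rt_in by blast
    have "dst n w x \<le> dst n w' (w' (\<tau> (rt n w x)))"
      using W.dst_less_clen[OF x] len[OF r] by (simp add: clen_def)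
    thus ?thesis
      using W'.dst_iterate[OF i, of "dst n w' (w' (\<tau> (rt n w x))) - dst n w x"] W'.funpow_in[OF i] W'.rt_w_root[OF r']
      by (intro exI[of _ "(w' ^^ (dst n w' (w' (\<tau> (rt n w x))) - dst n w x)) (w' (\<tau> (rt n w x)))"]) auto
  qed
  define \<sigma> where "\<sigma> x = (if x \<in> {1..n} then SOME y. y \<in> {1..n} \<and> rt n w' y = \<tau> (rt n w x) \<and> dst n w' y = dst n w x else x)" for x
  have \<sigma>: "\<sigma> x \<in> {1..n}" "rt n w' (\<sigma> x) = \<tau> (rt n w x)" "dst n w' (\<sigma> x) = dst n w x" if "x \<in> {1..n}" for x
    using someI_ex[OF ex[OF that]] that unfolding \<sigma>_def by auto
  have inj: "inj_on \<sigma> {1..n}"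
  proof (rule inj_onI)
    fix x y assume xy: "x \<in> {1..n}" "y \<in> {1..n}" "\<sigma> x = \<sigma> y"
    have "\<tau> (rt n w x) = \<tau> (rt n w y)" "dst n w x = dst n w y"
      using \<sigma>(2,3)[OF xy(1)] \<sigma>(2,3)[OF xy(2)] xy(3) by auto
    moreover have "inj_on \<tau> (Rt n w)" using \<tau> by (simp add: bij_betw_def)
    ultimately have "rt n w x = rt n w y" using W.rt_Rt xy by (auto dest: inj_onD)
    thus "x = y" using W.dst_eq_imp xy \<open>dst n w x = dst n w y\<close> by blast
  qed
  have perm: "\<sigma> permutes {1..n}"
  proof (rule bij_imp_permutes)
    have "\<sigma> ` {1..n} \<subseteq> {1..n}" using \<sigma>(1) by auto
    hence "\<sigma> ` {1..n} = {1..n}" using inj by (intro endo_inj_surj) auto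
    thus "bij_betw \<sigma> {1..n} {1..n}" using inj by (simp add: bij_betw_def)
  qed (auto simp: \<sigma>_def)
  have root: "\<sigma> x \<in> Rt n w' \<longleftrightarrow> x \<in> Rt n w" if "x \<in> {1..n}" for x
    using W'.dst_0[OF \<sigma>(1)[OF that]] W.dst_0[OF that] \<sigma>(3)[OF that] by simp
  have int: "\<sigma> (w x) = w' (\<sigma> x)" for x
  proof (cases "x \<in> {1..n}")
    case False
    thus ?thesis using permutes_not_in[OF w] permutes_not_in[OF w'] by (auto simp: \<sigma>_def)
  next
    case x: True
    have wx: "w x \<in> {1..n}" by (rule W.w_in[OF x])
    have w\<sigma>: "w' (\<sigma> x) \<in> {1..n}" by (rule W'.w_in[OF \<sigma>(1)[OF x]])
    have 1: "rt n w' (\<sigma> (w x)) = rt n w' (w' (\<sigma> x))"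
      using \<sigma>(2)[OF wx] W.rt_w[OF x] W'.rt_w[OF \<sigma>(1)[OF x]] \<sigma>(2)[OF x] by simp
    have 2: "dst n w' (\<sigma> (w x)) = dst n w' (w' (\<sigma> x))"
    proof (cases "x \<in> Rt n w")
      case True
      have e: "\<sigma> x = \<tau> x"
        using \<sigma>(2)[OF x] W.rt_root[OF True] W'.rt_root root[OF x] True by simp
      \<comment> \<open>At a root the distance does not fall by one but jumps to the cycle length
        minus one; this is where equal lengths are used.\<close>
      have "dst n w' (w' (\<sigma> x)) = dst n w (w x)" using len[OF True] e by (simp add: clen_def)
      thus ?thesis using \<sigma>(3)[OF wx] by simp
    next
      case False
      hence "\<sigma> x \<notin> Rt n w'" using root[OF x] by simp
      thus ?thesis
        using \<sigma>(3)[OF wx] \<sigma>(3)[OF x] W.dst_Suc[OF x False] W'.dst_Suc[OF \<sigma>(1)[OF x]] by simp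
    qed
    show ?thesis by (rule W'.dst_eq_imp[OF \<sigma>(1)[OF wx] w\<sigma> 1 2])
  qed
  show ?thesis
  proof
    show "\<sigma> permutes {1..n}" by (rule perm)
    show "\<sigma> \<circ> w = w' \<circ> \<sigma>" using int by auto
    show "\<sigma> r = \<tau> r" if "r \<in> Rt n w" for r
    proof -
      have r: "r \<in> {1..n}" using that W.Rt_in by blast
      show ?thesis using \<sigma>(2)[OF r] W.rt_root[OF that] W'.rt_root root[OF r] that by simp
    qed
  qed (rule root)
qed

section \<open>The leading term of a central element\<close>

lemma coef_monomial:
  assumes A: "\<And>k. ap A (bas k) = Poly_Mapping.single (\<pi> k) (\<epsilon> k)" and inj: "inj \<pi>"
  shows "coef (ap A v) (\<pi> k) = \<epsilon> k * coef v k"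
proof -
  have "ap A v = (\<Sum>j\<in>insert k (keys v). scl (coef v j) (ap A (bas j)))"
    by (rule ap_expansion) auto
  hence "coef (ap A v) (\<pi> k) = (\<Sum>j\<in>insert k (keys v). coef v j * coef (ap A (bas j)) (\<pi> k))"
    by (simp only: lookup_sum coef_scl)
  also have "\<dots> = (\<Sum>j\<in>insert k (keys v). if j = k then coef v j * \<epsilon> j else 0)"
    by (rule sum.cong[OF refl]) (use inj in \<open>auto simp: A lookup_single when_def inj_eq\<close>)
  also have "\<dots> = coef v k * \<epsilon> k" by (simp add: sum.delta)
  finally show ?thesis by (simp add: mult.commute)
qed

lemma coef_monomial_notin:
  assumes A: "\<And>k. ap A (bas k) = Poly_Mapping.single (\<pi> k) (\<epsilon> k)" and k: "k \<notin> range \<pi>"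
  shows "coef (ap A v) k = 0"
proof -
  have "ap A v = (\<Sum>j\<in>keys v. scl (coef v j) (ap A (bas j)))"
    by (rule ap_expansion) auto
  hence "coef (ap A v) k = (\<Sum>j\<in>keys v. coef v j * coef (ap A (bas j)) k)"
    by (simp only: lookup_sum coef_scl)
  also have "\<dots> = 0"
    by (rule sum.neutral) (use k in \<open>auto simp: A lookup_single when_def\<close>)
  finally show ?thesis .
qed

text \<open>Left multiplication by \<open>c_k\<close> on coefficient functions of \<open>S\<close>,
  without the sign that comes from the exponents. The sign may be read off at \<open>S\<close> since
  toggling \<open>k\<close> does not change \<open>nlt S k\<close>.\<close>

definition Cl :: "nat \<Rightarrow> (nat set \<Rightarrow> 'f::field) \<Rightarrow> nat set \<Rightarrow> 'f" where
  "Cl k \<phi> S = (if even (nlt S k) then \<phi> (tog S k) else - \<phi> (tog S k))"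

text \<open>The automorphism \<open>c_j \<mapsto> - c_j\<close> for \<open>j \<in> A\<close>, on
  coefficient functions. On even elements it makes up the difference between right and left
  multiplication by a letter.\<close>

definition kap :: "nat set \<Rightarrow> (nat set \<Rightarrow> 'f::field) \<Rightarrow> nat set \<Rightarrow> 'f" where
  "kap A \<phi> S = (if even (card (S \<inter> A)) then \<phi> S else - \<phi> S)"

lemma Cl_uminus: "Cl k (- \<phi>) = - Cl k \<phi>" by (rule ext) (simp add: Cl_def)
lemma kap_uminus: "kap A (- \<phi>) = - kap A \<phi>" by (rule ext) (simp add: kap_def)

lemma fun_minus_swap: "- \<phi> = \<psi> \<Longrightarrow> \<phi> = - (\<psi> :: 'a \<Rightarrow> 'f::field)"
proof (rule ext)
  fix x assume "- \<phi> = \<psi>"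
  hence "- \<phi> x = \<psi> x" by auto
  hence "- (- \<phi> x) = - \<psi> x" by simp
  thus "\<phi> x = (- \<psi>) x" by simp
qed

lemma Cl_Cl: "Cl k (Cl k \<phi>) = \<phi>"
  by (rule ext) (simp add: Cl_def even_nlt_tog)

lemma even_card_tog_Int: "finite A \<Longrightarrow> even (card (tog S k \<inter> A)) \<longleftrightarrow> (even (card (S \<inter> A)) \<longleftrightarrow> k \<notin> A)"
proof -
  assume A: "finite A"
  show ?thesis
  proof (cases "k \<in> A")
    case True
    hence "tog S k \<inter> A = tog (S \<inter> A) k" by auto
    thus ?thesis using True A even_card_tog[of "S \<inter> A" k] by simp
  next
    case False
    hence "tog S k \<inter> A = S \<inter> A" by auto
    thus ?thesis using False by simp
  qed
qed

lemma kap_Cl: "finite A \<Longrightarrow> kap A (Cl k \<phi>) = (if k \<in> A then - Cl k (kap A \<phi>) else Cl k (kap A \<phi>))"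
  by (rule ext) (simp add: Cl_def kap_def even_card_tog_Int)

lemma kap_kap:
  assumes "finite A" "finite B" "A \<inter> B = {}"
  shows "kap A (kap B \<phi>) = kap (A \<union> B) \<phi>"
proof (rule ext)
  fix S
  have "S \<inter> (A \<union> B) = (S \<inter> A) \<union> (S \<inter> B)" by auto
  moreover have "card ((S \<inter> A) \<union> (S \<inter> B)) = card (S \<inter> A) + card (S \<inter> B)"
    using assms by (intro card_Un_disjoint) auto
  ultimately show "kap A (kap B \<phi>) S = kap (A \<union> B) \<phi> S" by (simp add: kap_def)
qed

section \<open>Signs of permutations acting on Clifford monomials\<close>

primrec zeta :: "nat list \<Rightarrow> nat set \<Rightarrow> 'f::field" where
  "zeta [] S = 1"
| "zeta (i # l) S = (if pw (rev l) i \<in> S \<and> pw (rev l) (Suc i) \<in> S then - zeta l S else zeta l S)"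

definition lamw :: "nat list \<Rightarrow> (idx, 'f::field) lop" where
  "lamw l = prod_list (map opt l)"

lemma lamw_Cons: "lamw (i # l) = opt i * lamw l"
  by (simp add: lamw_def)

lemma pw_rev_Cons: "pw (rev (i # l)) = pw (rev l) \<circ> tp i"
  by (simp only: rev.simps pw_append pw.simps comp_id)

lemma lamw_bas: "ap (lamw l) (Poly_Mapping.single (a, S, w) z) =
    Poly_Mapping.single (a \<circ> pw (rev l), pw (rev l) -` S, pw l \<circ> w) (zeta l S * z)"
proof (induction l)
  case (Cons i l)
  have "ap (lamw (i # l)) (Poly_Mapping.single (a, S, w) z) = ap (opt i) (ap (lamw l) (Poly_Mapping.single (a, S, w) z))"
    by (simp only: lamw_Cons ap_simps)
  also have "\<dots> = Poly_Mapping.single (a \<circ> pw (rev l) \<circ> tp i, tp i -` (pw (rev l) -` S), tp i \<circ> (pw l \<circ> w)) (zeta (i # l) S * z)"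
    unfolding Cons by simp
  finally show ?case unfolding pw_rev_Cons pw.simps by (simp only: comp_assoc vimage_comp)
qed (simp add: lamw_def)

lemma zeta_nz: "zeta l S \<noteq> 0"
  by (induction l) auto

lemma lamw_opc: "lamw l * opc k = opc (pw l k) * (lamw l :: (idx, 'f::field) lop)"
proof (induction l)
  case (Cons i l)
  have "lamw (i # l) * opc k = opt i * (lamw l * opc k :: (idx, 'f) lop)" by (simp only: lamw_Cons mult.assoc)
  also have "\<dots> = (opt i * opc (pw l k)) * lamw l" unfolding Cons by (simp only: mult.assoc)
  finally show ?case by (simp only: opt_opc lamw_Cons mult.assoc pw.simps o_apply)
qed (simp add: lamw_def)

definition Rw :: "(nat \<Rightarrow> nat) \<Rightarrow> (idx, 'f::field) lop" where
  "Rw \<sigma> = mk (\<lambda>(a, S, w). bas (a, S, w \<circ> \<sigma>))"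

lemma Rw_bas: "ap (Rw \<sigma>) (Poly_Mapping.single (a, S, w) z) = Poly_Mapping.single (a, S, w \<circ> \<sigma>) z"
  by (subst ap_single) (simp add: Rw_def)

lemma Rw_opt: "Rw \<sigma> * opt i = opt i * Rw \<sigma>"
  by (rule lop_idx_eqI) (auto simp: Rw_bas comp_assoc)

lemma zeta_invariant:
  assumes "\<And>x. x \<in> S \<Longrightarrow> pw l x \<in> S" "\<And>x. x \<in> S \<Longrightarrow> \<exists>y\<in>S. pw l y = x"
  shows "pw (rev l) -` S = S"
proof -
  have 1: "pw l (pw (rev l) x) = x" "pw (rev l) (pw l x) = x" for x
    using fun_cong[OF pw_rev(2)[of l], of x] fun_cong[OF pw_rev(1)[of l], of x] by simp_all
  show ?thesis
  proof (intro equalityI subsetI)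
    fix x assume "x \<in> pw (rev l) -` S"
    hence "pw l (pw (rev l) x) \<in> S" using assms(1) by blast
    thus "x \<in> S" by (simp only: 1)
  next
    fix x assume "x \<in> S"
    then obtain y where "y \<in> S" "pw l y = x" using assms(2) by blast
    thus "x \<in> pw (rev l) -` S" using 1(2)[of y] by auto
  qed
qed

lemma comp_const_0: "(\<lambda>_. 0 :: nat) \<circ> h = (\<lambda>_. 0)" by auto

text \<open>\<open>lamw l\<close> commutes with \<open>opc k\<close> for every fixed
  \<open>k\<close>, so building up \<open>c^S\<close> letter by letter never produces a
  sign.\<close>

lemma zeta_fix:
  assumes "finite S" "\<And>k. k \<in> S \<Longrightarrow> pw l k = k"
  shows "zeta l S = (1 :: 'f::field)"
  using assms
proof (induction S rule: finite_induct)
  case empty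
  show ?case by (induction l) auto
next
  case (insert k S)
  have fx: "pw l x = x" if "x \<in> insert k S" for x using insert(4) that .
  have IH: "zeta l S = (1 :: 'f)" by (rule insert(3)) (use fx in blast)
  have inv: "pw (rev l) -` S = S" by (rule zeta_invariant) (use fx in auto)
  have inv': "pw (rev l) -` insert k S = insert k S" by (rule zeta_invariant) (use fx in auto)
  have t: "tog S k = insert k S" using insert by auto
  define e :: 'f where "e = (if even (nlt S k) then 1 else -1)"
  have e: "ap (opc k) (bas (\<lambda>_. 0, S, w)) = Poly_Mapping.single (\<lambda>_. 0, insert k S, w) e" for w
    by (simp add: e_def t)
  have L: "lamw l * opc k = opc k * (lamw l :: (idx, 'f) lop)"
    using lamw_opc[of l k] unfolding fx[OF insertI1] .
  have "ap (lamw l) (ap (opc k) (bas (\<lambda>_. 0, S, id))) = ap (opc k) (ap (lamw l) (bas (\<lambda>_. 0, S, id) :: idx \<Rightarrow>\<^sub>0 'f))"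
    by (simp only: ap_simps(6)[symmetric] L)
  hence "Poly_Mapping.single (\<lambda>_. 0, insert k S, pw l) (zeta l (insert k S) * e) = (Poly_Mapping.single (\<lambda>_. 0, insert k S, pw l) e :: idx \<Rightarrow>\<^sub>0 'f)"
    unfolding e lamw_bas comp_const_0 inv inv' comp_id IH mult_1 .
  from arg_cong[OF this, of "\<lambda>v. coef v (\<lambda>_. 0, insert k S, pw l)"]
  have "zeta l (insert k S) * e = e" by simp
  thus ?case by (auto simp: e_def split: if_splits)
qed

text \<open>The pair \<open>c_r c_r'\<close> is carried to \<open>c_r' c_r = - c_r c_r'\<close> and
  the remaining letters are fixed.\<close>

lemma zeta_swap:
  assumes "finite S" "r \<noteq> r'" "r \<notin> S" "r' \<notin> S" "\<And>k. k \<in> S \<Longrightarrow> pw l k = k" "pw l r = r'" "pw l r' = r"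
  shows "zeta l (insert r (insert r' S)) = (-1 :: 'f::field)"
proof -
  let ?S = "insert r (insert r' S)"
  have inv: "pw (rev l) -` S = S" by (rule zeta_invariant) (use assms in auto)
  have inv': "pw (rev l) -` ?S = ?S" by (rule zeta_invariant) (use assms in auto)
  have t: "tog (tog S r') r = ?S" using assms by auto
  define e :: 'f where "e = (if even (nlt (tog S r') r) = even (nlt S r') then 1 else -1)"
  have e: "ap (opc r * opc r') (bas (\<lambda>_. 0, S, w)) = Poly_Mapping.single (\<lambda>_. 0, ?S, w) e" for w
    by (simp add: e_def t del: tog_iff)
  have "lamw l * (opc r * opc r') = (lamw l * opc r) * (opc r' :: (idx, 'f) lop)" by (simp only: mult.assoc)
  also have "\<dots> = opc r' * (lamw l * opc r')" unfolding lamw_opc[of l r] assms(6) by (simp only: mult.assoc)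
  also have "\<dots> = (opc r' * opc r) * lamw l" unfolding lamw_opc[of l r'] assms(7) by (simp only: mult.assoc)
  finally have L: "lamw l * (opc r * opc r') = (opc r' * opc r) * (lamw l :: (idx, 'f) lop)" .
  have ac: "opc r' * opc r = - (opc r * opc r' :: (idx, 'f) lop)"
    using assms(2) by (intro opc_anticommute) simp
  have "ap (lamw l * (opc r * opc r')) v = ap (- (opc r * opc r') * lamw l) v" for v :: "idx \<Rightarrow>\<^sub>0 'f"
    by (simp only: L ac)
  hence "ap (lamw l) (ap (opc r * opc r') v) = - ap (opc r * opc r') (ap (lamw l) v)" for v :: "idx \<Rightarrow>\<^sub>0 'f"
    by (simp only: ap_simps)
  note this[of "bas (\<lambda>_. 0, S, id)"]
  moreover have z1: "zeta l S = (1 :: 'f)" by (rule zeta_fix[OF assms(1,5)])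
  ultimately have "Poly_Mapping.single (\<lambda>_. 0, ?S, pw l) (zeta l ?S * e) = - (Poly_Mapping.single (\<lambda>_. 0, ?S, pw l) e :: idx \<Rightarrow>\<^sub>0 'f)"
    unfolding lamw_bas[of l "\<lambda>_. 0" S id 1] comp_const_0 inv z1 mult_1 comp_id e
    unfolding lamw_bas comp_const_0 inv' comp_id by blast
  from arg_cong[OF this, of "\<lambda>v. coef v (\<lambda>_. 0, ?S, pw l)"] have "zeta l ?S * e = - e" by simp
  thus ?thesis by (auto simp: e_def split: if_splits, (metis minus_minus)+)
qed

section \<open>Symmetries of the coefficients of the leading term\<close>

locale central_top = cyclotomic_space d g n for d n :: nat and g :: "'f::field poly" +
  fixes F :: "idx \<Rightarrow>\<^sub>0 'f"
  assumes F_Bs: "F \<in> spn Bs" and F_even: "F \<in> spn (PE True)"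
    and F_central: "\<And>y. y \<in> sergeev_gens n \<Longrightarrow> ap (lam y) F = ap (rop y) F"
    and two: "(2 :: 'f) \<noteq> 0"
begin

definition f :: "(nat \<Rightarrow> nat) \<Rightarrow> nat set \<Rightarrow> (nat \<Rightarrow> nat) \<Rightarrow> 'f" where
  "f a S w = coef F (a, S, w)"

lemma f_Bs: "f a S w \<noteq> 0 \<Longrightarrow> (a, S, w) \<in> Bs"
  using F_Bs unfolding f_def spn_iff by blast

lemma f_even: "f a S w \<noteq> 0 \<Longrightarrow> even (card S)"
  using F_even unfolding f_def spn_iff PE_def by fastforce

lemma eq_uminus_imp_0: "(x :: 'f) = - x \<Longrightarrow> x = 0"
  using two by (metis add_eq_0_iff mult_2 mult_eq_0_iff)

lemma lamw_F:
  assumes "set l \<subseteq> {1..<n}"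
  shows "ap (lamw l) F = ap (Rw (pw l)) F"
  using assms
proof (induction l)
  case Nil
  have "Rw (pw []) = (1 :: (idx, 'f) lop)" by (rule lop_idx_eqI) (simp add: Rw_bas comp_def)
  thus ?case by (simp add: lamw_def del: pw.simps)
next
  case (Cons i l)
  have i: "gS i \<in> sergeev_gens n" using Cons(2) by (auto simp: sergeev_gens_def)
  have "ap (lamw (i # l)) F = ap (opt i) (ap (Rw (pw l)) F)"
    using Cons by (simp add: lamw_def)
  also have "\<dots> = ap (Rw (pw l)) (ap (opt i) F)"
    by (simp only: ap_simps(6)[symmetric] Rw_opt)
  also have "ap (opt i) F = ap (rops i) F" using F_central[OF i] by simp
  also have "ap (Rw (pw l)) (ap (rops i) F) = ap (Rw (pw l) * rops i) F" by simp
  also have "Rw (pw l) * rops i = Rw (pw (i # l))"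
    by (rule lop_idx_eqI) (simp add: Rw_bas rops_bas comp_assoc)
  finally show ?case .
qed

text \<open>Comparison of coefficients in \<open>t F = F t\<close> for a product \<open>t\<close> of
  simple transpositions: up to the sign \<open>zeta\<close>, the coefficients are constant under
  simultaneous conjugation of all three components.\<close>

lemma conj_coef:
  assumes "set l \<subseteq> {1..<n}"
  shows "zeta l S * f a S w = f (a \<circ> pw (rev l)) (pw (rev l) -` S) (pw l \<circ> w \<circ> pw (rev l))"
proof -
  let ?\<sigma> = "pw l" and ?\<tau> = "pw (rev l)"
  have r: "?\<sigma> (?\<tau> x) = x" "?\<tau> (?\<sigma> x) = x" for x using pw_rev[of l] by (auto simp: fun_eq_iff)
  have c: "?\<tau> \<circ> ?\<sigma> = id" by (rule pw_rev)
  define \<pi> :: "idx \<Rightarrow> idx" where "\<pi> = (\<lambda>(a, S, w). (a \<circ> ?\<tau>, ?\<tau> -` S, ?\<sigma> \<circ> w))"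
  have inj1: "inj \<pi>"
  proof (rule injI)
    fix x y assume e: "\<pi> x = \<pi> y"
    obtain a S w a' S' w' where xy: "x = (a, S, w)" "y = (a', S', w')" by (cases x; cases y)
    from e have "a (?\<tau> k) = a' (?\<tau> k)" "?\<tau> k \<in> S \<longleftrightarrow> ?\<tau> k \<in> S'" "?\<sigma> (w k) = ?\<sigma> (w' k)" for k
      by (auto simp: \<pi>_def xy fun_eq_iff)
    from this(1)[of "?\<sigma> _"] this(2)[of "?\<sigma> _"] arg_cong[OF this(3), of ?\<tau>]
    show "x = y" by (auto simp: xy r fun_eq_iff)
  qed
  define \<rho> :: "idx \<Rightarrow> idx" where "\<rho> = (\<lambda>(a, S, w). (a, S, w \<circ> ?\<sigma>))"
  have inj2: "inj \<rho>"
  proof (rule injI)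
    fix x y assume e: "\<rho> x = \<rho> y"
    obtain a S w a' S' w' where xy: "x = (a, S, w)" "y = (a', S', w')" by (cases x; cases y)
    from e have "a = a'" "S = S'" "w (?\<sigma> k) = w' (?\<sigma> k)" for k
      by (auto simp: \<rho>_def xy fun_eq_iff)
    from this(1,2) this(3)[of "?\<tau> _"] show "x = y" by (auto simp: xy r fun_eq_iff)
  qed
  have 1: "coef (ap (lamw l) F) (\<pi> (a, S, w)) = zeta l S * f a S w"
    using coef_monomial[of "lamw l" \<pi> "\<lambda>(a, S, w). zeta l S" F "(a, S, w)"] inj1
    by (auto simp: lamw_bas \<pi>_def f_def)
  have "\<pi> (a, S, w) = \<rho> (a \<circ> ?\<tau>, ?\<tau> -` S, ?\<sigma> \<circ> w \<circ> ?\<tau>)"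
    by (simp add: \<pi>_def \<rho>_def comp_assoc c)
  hence 2: "coef (ap (Rw ?\<sigma>) F) (\<pi> (a, S, w)) = f (a \<circ> ?\<tau>) (?\<tau> -` S) (?\<sigma> \<circ> w \<circ> ?\<tau>)"
    using coef_monomial[of "Rw ?\<sigma>" \<rho> "\<lambda>_. 1" F "(a \<circ> ?\<tau>, ?\<tau> -` S, ?\<sigma> \<circ> w \<circ> ?\<tau>)"] inj2
    by (auto simp: Rw_bas \<rho>_def f_def)
  show ?thesis using 1 2 lamw_F[OF assms] by simp
qed

text \<open>From \<open>c_i F = F c_i\<close>. On the left this is \<open>Cl i\<close> with the sign
  \<open>(-1)^(a i)\<close>. On the right \<open>c_(w i)\<close> enters from behind
  \<open>c^S\<close>; as \<open>card S\<close> is even, this differs from \<open>Cl (w i)\<close>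
  only by the sign of the letter \<open>c_(w i)\<close> itself, that is by \<open>kap {w i}\<close>.
  The involution \<open>Cl i\<close> is then moved to the other side.\<close>

lemma Clifford_relation:
  assumes "i \<in> {1..n}"
  shows "(\<lambda>S. f a S w) = (if even (a i) then Cl i (Cl (w i) (kap {w i} (\<lambda>S. f a S w)))
    else - Cl i (Cl (w i) (kap {w i} (\<lambda>S. f a S w))))"
proof -
  let ?\<phi> = "\<lambda>S. f a S w" and ?j = "w i"
  have i: "gC i \<in> sergeev_gens n" using assms by (auto simp: sergeev_gens_def)
  have inj1: "inj (\<lambda>(a, S, w). (a, tog S i, w) :: idx)"
    by (rule inj_on_inverseI[of _ "\<lambda>(a, S, w). (a, tog S i, w)"]) auto
  have inj2: "inj (\<lambda>(a, S, w). (a, tog S (w i), w) :: idx)"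
    by (rule inj_on_inverseI[of _ "\<lambda>(a, S, w). (a, tog S (w i), w)"]) auto
  have A1: "ap (opc i) (bas k) = Poly_Mapping.single ((\<lambda>(a, S, w). (a, tog S i, w)) k)
      ((\<lambda>(a, S, w). if even (a i + nlt S i) then 1 else -1 :: 'f) k)" for k
    by (cases k) auto
  have A2: "ap (ropc i) (bas k) = Poly_Mapping.single ((\<lambda>(a, S, w). (a, tog S (w i), w)) k)
      ((\<lambda>(a, S, w). if even (card S + nlt S (w i) + (if w i \<in> S then 1 else 0)) then 1 else -1 :: 'f) k)" for k
    by (cases k) (auto simp: ropc_bas)
  have main: "(if even (a i) then Cl i ?\<phi> S else - Cl i ?\<phi> S) = Cl ?j (kap {?j} ?\<phi>) S" for S
  proof -
    let ?T = "tog S i" and ?U = "tog S ?j"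
    have 1: "coef (ap (opc i) F) (a, S, w) = (if even (a i + nlt ?T i) then 1 else -1) * f a ?T w"
      using coef_monomial[OF A1 inj1, of F "(a, ?T, w)"] by (simp add: f_def)
    have 2: "coef (ap (ropc i) F) (a, S, w) = (if even (card ?U + nlt ?U ?j + (if ?j \<in> ?U then 1 else 0)) then 1 else -1) * f a ?U w"
      using coef_monomial[OF A2 inj2, of F "(a, ?U, w)"] by (simp add: f_def)
    have "f a ?U w = 0 \<or> even (card ?U)" using f_even by blast
    moreover have "card (tog S ?j \<inter> {?j}) = (if ?j \<in> ?U then 1 else 0)"
      by (cases "?j \<in> S") (auto simp del: One_nat_def intro!: card_eq_0_iff[THEN iffD2])
    ultimately show ?thesis
      using 1 2 F_central[OF i] by (auto simp: Cl_def kap_def even_nlt_tog split: if_splits, (metis minus_minus)+)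
  qed
  have "Cl i (\<lambda>S. if even (a i) then Cl i ?\<phi> S else - Cl i ?\<phi> S) = Cl i (Cl ?j (kap {?j} ?\<phi>))"
    using main by presburger
  moreover have "(\<lambda>S. if even (a i) then Cl i ?\<phi> S else - Cl i ?\<phi> S) = (if even (a i) then Cl i ?\<phi> else - Cl i ?\<phi>)"
    by (auto simp: fun_eq_iff)
  ultimately show ?thesis by (auto simp: Cl_Cl Cl_uminus intro: fun_minus_swap)
qed

lemma c_move:
  assumes "f a S w \<noteq> 0" "i \<in> {1..n}"
  shows "f a (tog (tog S i) (w i)) w \<noteq> 0"
  using fun_cong[OF Clifford_relation[OF assms(2), of a w], of S] assms(1)
  by (auto simp: Cl_def kap_def split: if_splits)

text \<open>In \<open>F x_i\<close> the monomial \<open>x_i x^a c^S w\<close> can come only from the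
  one whose exponent at \<open>w i\<close> is smaller by one. So a unit of exponent moves from
  \<open>w i\<close> to \<open>i\<close>.\<close>

lemma x_move:
  assumes nz: "f a S w \<noteq> 0" and i: "i \<in> {1..n}" and ai: "Suc (a i) < d" and wi: "w i \<noteq> i"
  shows "0 < a (w i)" "f (a(i := Suc (a i), w i := a (w i) - 1)) S w \<noteq> 0"
proof -
  have y: "gX i \<in> sergeev_gens n" using i by (auto simp: sergeev_gens_def)
  have inj1: "inj (\<lambda>(a, S, w). (a(i := Suc (a i)), S, w) :: idx)"
    by (rule inj_on_inverseI[of _ "\<lambda>(a, S, w). (a(i := a i - 1), S, w)"]) auto
  have inj2: "inj (\<lambda>(a, S, w). (a(w i := Suc (a (w i))), S, w) :: idx)"
    by (rule inj_on_inverseI[of _ "\<lambda>(a, S, w). (a(w i := a (w i) - 1), S, w)"]) auto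
  have A1: "ap (lamx i) (bas k) = Poly_Mapping.single ((\<lambda>(a, S, w). (a(i := Suc (a i)), S, w)) k)
      ((\<lambda>(a, S, w). if a i = d - 1 then 0 else 1 :: 'f) k)" for k
    by (cases k) (auto simp: lamx_bas)
  let ?b = "a(i := Suc (a i))"
  have 1: "coef (ap (lamx i) F) (?b, S, w) = f a S w"
    using coef_monomial[OF A1 inj1, of F "(a, S, w)"] ai by (auto simp: f_def)
  have A: "ap (ropx i) (bas k) = Poly_Mapping.single ((\<lambda>(a, S, w). (a(w i := Suc (a (w i))), S, w)) k)
      ((\<lambda>(a, S, w). if a (w i) = d - 1 then 0 else if w i \<in> S then -1 else 1) k)" for k
    by (cases k) (auto simp: ropx_bas)
  have ne: "coef (ap (ropx i) F) (?b, S, w) \<noteq> 0" using 1 F_central[OF y] nz by simp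
  show pos: "0 < a (w i)"
  proof (rule ccontr)
    assume "\<not> 0 < a (w i)"
    hence "(?b, S, w) \<notin> range (\<lambda>(a, S, w). (a(w i := Suc (a (w i))), S, w))"
      using wi by (auto simp: fun_eq_iff dest!: spec[of _ "w i"])
    from coef_monomial_notin[OF A this] ne show False by simp
  qed
  let ?c = "a(i := Suc (a i), w i := a (w i) - 1)"
  have "?b = ?c(w i := Suc (?c (w i)))" using pos wi by (auto simp: fun_eq_iff)
  hence "(?b, S, w) = (\<lambda>(a, S, w). (a(w i := Suc (a (w i))), S, w)) (?c, S, w)" by simp
  hence "coef (ap (ropx i) F) (?b, S, w) = (\<lambda>(a, S, w). if a (w i) = d - 1 then 0 else if w i \<in> S then -1 else 1) (?c, S, w) * coef F (?c, S, w)"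
    using coef_monomial[OF A inj2, of F "(?c, S, w)"] by (simp only:)
  with ne show "f ?c S w \<noteq> 0" unfolding f_def by auto
qed

end

lemma sum_less_two:
  fixes h h' :: "nat \<Rightarrow> nat"
  assumes "finite I" "x \<in> I" "y \<in> I" "x \<noteq> y" "\<And>z. z \<in> I \<Longrightarrow> z \<noteq> x \<Longrightarrow> z \<noteq> y \<Longrightarrow> h' z = h z"
    "h' x + h' y < h x + h y"
  shows "sum h' I < sum h I"
proof -
  have e: "sum k I = k x + k y + sum k (I - {x, y})" for k :: "nat \<Rightarrow> nat"
  proof -
    have "I = insert x (insert y (I - {x, y}))" using assms by auto
    hence "sum k I = sum k (insert x (insert y (I - {x, y})))" by simp
    also have "\<dots> = k x + k y + sum k (I - {x, y})"
      using assms(1,4) by (subst sum.insert; auto)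
    finally show ?thesis .
  qed
  have "sum h' (I - {x, y}) = sum h (I - {x, y})" by (rule sum.cong) (use assms in auto)
  thus ?thesis using assms(6) by (simp add: e)
qed

lemma image_mset_eq_bij:
  assumes "finite A" "finite B" "image_mset h (mset_set A) = image_mset k (mset_set B)"
  shows "\<exists>\<tau>. bij_betw \<tau> A B \<and> (\<forall>x\<in>A. k (\<tau> x) = h x)"
  using assms
proof (induction A arbitrary: B rule: finite_induct)
  case empty
  hence "B = {}" by (simp add: mset_set_empty_iff)
  thus ?case by (auto simp: bij_betw_def)
next
  case (insert x A)
  have "h x \<in># image_mset k (mset_set B)"
    unfolding insert.prems(2)[symmetric] using insert.hyps by simp
  then obtain y where y: "y \<in> B" "k y = h x" using insert.prems(1) by auto
  have B: "mset_set B = add_mset y (mset_set (B - {y}))"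
    by (rule mset_set.remove[OF insert.prems(1) y(1)])
  have "image_mset h (mset_set A) = image_mset k (mset_set (B - {y}))"
  proof -
    have "image_mset h (mset_set (insert x A)) = add_mset (h x) (image_mset h (mset_set A))"
      using insert.hyps by simp
    moreover have "image_mset k (mset_set B) = add_mset (k y) (image_mset k (mset_set (B - {y})))"
      by (subst B) (simp only: image_mset_add_mset)
    ultimately show ?thesis using insert.prems(2) y(2) by (simp only: add_mset_add_mset_same_iff)
  qed
  then obtain \<tau> where \<tau>: "bij_betw \<tau> A (B - {y})" "\<forall>x\<in>A. k (\<tau> x) = h x"
    using insert.IH[of "B - {y}"] insert.prems(1) by auto
  have "bij_betw (\<tau>(x := y)) (insert x A) (insert y (B - {y}))"
  proof (rule bij_betw_imageI)
    show "inj_on (\<tau>(x := y)) (insert x A)"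
      using \<tau>(1) insert.hyps by (auto simp: bij_betw_def inj_on_def)
    show "(\<tau>(x := y)) ` insert x A = insert y (B - {y})"
      using \<tau>(1) insert.hyps by (auto simp: bij_betw_def)
  qed
  moreover have "insert y (B - {y}) = B" using y by auto
  ultimately have "bij_betw (\<tau>(x := y)) (insert x A) B" by (simp only:)
  moreover have "\<forall>z\<in>insert x A. k ((\<tau>(x := y)) z) = h z" using \<tau>(2) y insert.hyps by auto
  ultimately show ?case by blast
qed

text \<open>Eliminates an intermediate point \<open>y\<close> of a path: \<open>kap {y}\<close>
  absorbs the sign, and the two copies of \<open>Cl y\<close> cancel.\<close>

lemma Clifford_cancel:
  fixes \<phi> :: "nat set \<Rightarrow> 'f::field"
  assumes "finite A" "y \<notin> A" "r \<noteq> y"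
  shows "Cl y (kap {y} (- Cl y (Cl r (kap A \<phi>)))) = Cl r (kap (insert y A) \<phi>)"
proof -
  have m: "- (- \<psi>) = \<psi>" for \<psi> :: "nat set \<Rightarrow> 'f" by (rule ext) simp
  have 1: "kap {y} (- Cl y \<psi>) = Cl y (kap {y} \<psi>)" for \<psi> :: "nat set \<Rightarrow> 'f"
    unfolding kap_uminus using kap_Cl[of "{y}" y \<psi>] by (simp add: m)
  have 2: "kap {y} (Cl r (kap A \<phi>)) = Cl r (kap {y} (kap A \<phi>))" using kap_Cl[of "{y}" r "kap A \<phi>"] assms by simp
  have 3: "kap {y} (kap A \<phi>) = kap (insert y A) \<phi>" using kap_kap[of "{y}" A \<phi>] assms by simp
  show ?thesis unfolding 1 2 3 Cl_Cl ..
qed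

section \<open>Normal elements and their types\<close>

context cyclotomic_space
begin

text \<open>The condition on \<open>S\<close> is what \<open>Clifford_parity\<close> forces on a
  nonzero coefficient once exponents and letters sit as required.\<close>

definition normal :: "idx \<Rightarrow> bool" where
  "normal = (\<lambda>(a, S, w). (a, S, w) \<in> Bs \<and> (\<forall>x\<in>{1..n} - Rt n w. a x = d - 1) \<and> S = {r \<in> Rt n w. odd (a r)})"

text \<open>The color \<open>d - 1 - a r\<close> is the total deficit of exponents on the cycle of
  \<open>r\<close>, which moving exponents along the cycle does not change. Color 0 will give the
  parts of the second partition.\<close>

definition ctype :: "idx \<Rightarrow> (nat \<times> nat) multiset" where
  "ctype = (\<lambda>(a, S, w). image_mset (\<lambda>r. (clen n w r, d - 1 - a r)) (mset_set (Rt n w)))"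

end

context central_top
begin

lemma Bs_rooted: "(a, S, w) \<in> Bs \<Longrightarrow> rooted n w"
  by unfold_locales (simp add: Bs_def)

text \<open>Missing exponents and Clifford letters, weighted by the distance to the root. Roots have
  weight zero, so a minimum has both only there.\<close>

definition potential :: "(nat \<Rightarrow> nat) \<Rightarrow> (nat \<Rightarrow> nat) \<Rightarrow> nat set \<Rightarrow> nat" where
  "potential w a S = (\<Sum>x\<in>{1..n}. dst n w x * ((d - 1 - a x) + (if x \<in> S then 1 else 0)))"

text \<open>Take a nonzero coefficient of least potential. Away from the roots,
  \<open>x_move\<close> would shift a unit of deficit one step closer to the root, and
  \<open>c_move\<close> would shift a letter or cancel it against the one at \<open>w x\<close>;
  either lowers the potential.\<close>

lemma concentrate:
  assumes "f a S w \<noteq> 0"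
  obtains a' S' where "f a' S' w \<noteq> 0" "\<forall>x\<in>{1..n} - Rt n w. a' x = d - 1" "S' \<subseteq> Rt n w"
proof -
  interpret rooted n w using Bs_rooted f_Bs[OF assms] .
  obtain p where p: "f (fst p) (snd p) w \<noteq> 0"
    "\<And>q. f (fst q) (snd q) w \<noteq> 0 \<Longrightarrow> potential w (fst p) (snd p) \<le> potential w (fst q) (snd q)"
    using ex_has_least_nat[of "\<lambda>p. f (fst p) (snd p) w \<noteq> 0" "(a, S)" "\<lambda>p. potential w (fst p) (snd p)"] assms by auto
  define b T where "b = fst p" and "T = snd p"
  have nz: "f b T w \<noteq> 0" using p(1) by (simp add: b_def T_def)
  have min: "potential w b T \<le> potential w b' T'" if "f b' T' w \<noteq> 0" for b' T'
    using p(2)[of "(b', T')"] that by (simp add: b_def T_def)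
  have Bs: "(b, T, w) \<in> Bs" by (rule f_Bs[OF nz])
  have lt: "b x < d" for x using Bs by (simp add: Bs_def)
  have step: "w x \<noteq> x \<and> w x \<in> {1..n} \<and> dst n w x = Suc (dst n w (w x))" if "x \<in> {1..n} - Rt n w" for x
    using dst_Suc[of x] w_in[of x] that by auto
  have "b x = d - 1" if x: "x \<in> {1..n} - Rt n w" for x
  proof (rule ccontr)
    assume "b x \<noteq> d - 1"
    hence bx: "Suc (b x) < d" using lt[of x] by linarith
    note s = step[OF x]
    have xi: "x \<in> {1..n}" using x by simp
    let ?y = "w x" and ?b = "b(x := Suc (b x), w x := b (w x) - 1)"
    have m: "0 < b ?y" "f ?b T w \<noteq> 0" using x_move[OF nz xi bx] s by auto
    have "potential w ?b T < potential w b T"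
      unfolding potential_def
    proof (rule sum_less_two[of _ x ?y])
      have 1: "d - 1 - b x = Suc (d - 1 - Suc (b x))" using bx by simp
      have 2: "d - 1 - (b ?y - 1) = Suc (d - 1 - b ?y)" using m(1) lt[of ?y] by simp
      show "dst n w x * ((d - 1 - ?b x) + (if x \<in> T then 1 else 0)) + dst n w ?y * ((d - 1 - ?b ?y) + (if ?y \<in> T then 1 else 0))
        < dst n w x * ((d - 1 - b x) + (if x \<in> T then 1 else 0)) + dst n w ?y * ((d - 1 - b ?y) + (if ?y \<in> T then 1 else 0))"
        using s 1 2 by (auto simp: algebra_simps)
    qed (use s xi in auto)
    thus False using min[OF m(2)] by simp
  qed
  moreover have "T \<subseteq> Rt n w"
  proof
    fix x assume xT: "x \<in> T"
    have xi: "x \<in> {1..n}" using xT Bs by (auto simp: Bs_def)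
    show "x \<in> Rt n w"
    proof (rule ccontr)
      assume "x \<notin> Rt n w"
      hence s: "w x \<noteq> x \<and> w x \<in> {1..n} \<and> dst n w x = Suc (dst n w (w x))" using step xi by blast
      let ?T = "tog (tog T x) (w x)"
      have m: "f b ?T w \<noteq> 0" by (rule c_move[OF nz xi])
      have "potential w b ?T < potential w b T"
        unfolding potential_def
        by (rule sum_less_two[of _ x "w x"]) (use s xi xT in \<open>auto simp: algebra_simps\<close>)
      thus False using min[OF m] by simp
    qed
  qed
  ultimately show ?thesis using that[OF nz] by blast
qed

text \<open>\<open>Clifford_relation\<close> is chained along the path from \<open>x\<close> to its
  root, with \<open>A\<close> collecting the points passed. Odd exponents give the sign at each
  step. The bound on distances ensures that the next point is not yet in \<open>A\<close>, as the
  cancellation requires.\<close>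

lemma Clifford_path:
  assumes w: "w permutes {1..n}" and a: "\<forall>x\<in>{1..n} - Rt n w. odd (a x)"
    and x: "x \<in> {1..n} - Rt n w"
  shows "\<exists>A. finite A \<and> A \<inter> Rt n w = {rt n w x} \<and> (\<forall>z\<in>A. dst n w z < dst n w x) \<and>
    (\<lambda>S. f a S w) = - Cl x (Cl (rt n w x) (kap A (\<lambda>S. f a S w)))"
  using x
proof (induction "dst n w x" arbitrary: x rule: less_induct)
  case less
  interpret rooted n w by unfold_locales (rule w)
  let ?\<phi> = "\<lambda>S. f a S w" and ?y = "w x" and ?r = "rt n w x"
  have x: "x \<in> {1..n}" "x \<notin> Rt n w" using less(2) by auto
  have y: "?y \<in> {1..n}" by (rule w_in[OF x(1)])
  have ds: "dst n w x = Suc (dst n w ?y)" by (rule dst_Suc[OF x])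
  have rx: "rt n w ?y = ?r" by (rule rt_step[OF x])
  have rel: "?\<phi> = - Cl x (Cl ?y (kap {?y} ?\<phi>))"
    using Clifford_relation[OF x(1), of a w] a less(2) by auto
  show ?case
  proof (cases "?y \<in> Rt n w")
    case True
    hence "?r = ?y" using rt_root rx by metis
    thus ?thesis using rel True ds by (intro exI[of _ "{?y}"]) auto
  next
    case False
    then obtain A where A: "finite A" "A \<inter> Rt n w = {?r}" "\<forall>z\<in>A. dst n w z < dst n w ?y"
      "?\<phi> = - Cl ?y (Cl ?r (kap A ?\<phi>))"
      using less(1)[of ?y] ds y rx by auto
    have yA: "?y \<notin> A" using A(3) by blast
    have "?r \<in> A \<inter> Rt n w" unfolding A(2) by (rule singletonI)
    hence yr: "?r \<noteq> ?y" using yA by (metis IntD1)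
    have "- Cl x (Cl ?y (kap {?y} ?\<phi>)) = - Cl x (Cl ?y (kap {?y} (- Cl ?y (Cl ?r (kap A ?\<phi>)))))"
      by (rule arg_cong[OF A(4), of "\<lambda>\<psi>. - Cl x (Cl ?y (kap {?y} \<psi>))"])
    with rel have "?\<phi> = - Cl x (Cl ?y (kap {?y} (- Cl ?y (Cl ?r (kap A ?\<phi>)))))"
      by (rule trans)
    also have "\<dots> = - Cl x (Cl ?r (kap (insert ?y A) ?\<phi>))"
      unfolding Clifford_cancel[OF A(1) yA yr] ..
    finally have "?\<phi> = - Cl x (Cl ?r (kap (insert ?y A) ?\<phi>))" .
    moreover have "insert ?y A \<inter> Rt n w = {?r}" using A(2) False by auto
    moreover have "\<forall>z\<in>insert ?y A. dst n w z < dst n w x" using A(3) ds by auto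
    ultimately show ?thesis using A(1) by (intro exI[of _ "insert ?y A"] conjI finite.insertI)
  qed
qed

text \<open>The path from \<open>w r\<close> closes up at \<open>r\<close> and all Clifford
  operators cancel: the coefficient function is \<open>kap A\<close> of itself, up to the sign
  \<open>(-1)^(a r)\<close>. As \<open>S\<close> consists of roots and \<open>r\<close> is the only
  root in \<open>A\<close>, evaluation at \<open>S\<close> compares this sign with the one for
  \<open>r \<in> S\<close>; a mismatch would give \<open>z = - z\<close>.\<close>

lemma Clifford_parity:
  assumes nz: "f a S w \<noteq> 0" and a: "\<forall>x\<in>{1..n} - Rt n w. a x = d - 1" and S: "S \<subseteq> Rt n w"
    and r: "r \<in> Rt n w"
  shows "r \<in> S \<longleftrightarrow> odd (a r)"
proof -
  have Bs: "(a, S, w) \<in> Bs" by (rule f_Bs[OF nz])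
  interpret rooted n w by (rule Bs_rooted[OF Bs])
  let ?\<phi> = "\<lambda>S. f a S w"
  have ri: "r \<in> {1..n}" using r Rt_in by blast
  have odd: "\<forall>x\<in>{1..n} - Rt n w. odd (a x)" using a d_even d_pos by auto
  have "\<exists>A. finite A \<and> A \<inter> Rt n w = {r} \<and> ?\<phi> = (if even (a r) then kap A ?\<phi> else - kap A ?\<phi>)"
  proof (cases "w r = r")
    case True
    have "?\<phi> = (if even (a r) then kap {r} ?\<phi> else - kap {r} ?\<phi>)"
      by (rule Clifford_relation[OF ri, of a w, unfolded True Cl_Cl])
    thus ?thesis using r by (intro exI[of _ "{r}"] conjI) (rule finite.insertI[OF finite.emptyI], blast, assumption)
  next
    case False
    let ?x = "w r"
    have x: "?x \<in> {1..n}" by (rule w_in[OF ri])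
    have rx: "rt n w ?x = r" by (rule rt_w_root[OF r])
    have xn: "?x \<notin> Rt n w" using rt_root[of ?x] rx False by auto
    have "?x \<in> {1..n} - Rt n w" using x xn by (rule DiffI)
    from Clifford_path[OF w odd this, unfolded rx]
    obtain A where A: "finite A" "A \<inter> Rt n w = {r}" "\<forall>z\<in>A. dst n w z < dst n w ?x"
      "?\<phi> = - Cl ?x (Cl r (kap A ?\<phi>))"
      by (elim exE conjE)
    have xA: "?x \<notin> A" using A(3) by blast
    have "Cl r (Cl ?x (kap {?x} ?\<phi>)) = Cl r (Cl ?x (kap {?x} (- Cl ?x (Cl r (kap A ?\<phi>)))))"
      by (rule arg_cong[OF A(4), of "\<lambda>\<psi>. Cl r (Cl ?x (kap {?x} \<psi>))"])
    also have "\<dots> = kap (insert ?x A) ?\<phi>"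
      unfolding Clifford_cancel[OF A(1) xA False[symmetric]] Cl_Cl ..
    finally have "Cl r (Cl ?x (kap {?x} ?\<phi>)) = kap (insert ?x A) ?\<phi>" .
    moreover have "insert ?x A \<inter> Rt n w = {r}" using A(2) xn by auto
    moreover note Clifford_relation[OF ri, of a w]
    ultimately show ?thesis using A(1)
      by (intro exI[of _ "insert ?x A"] conjI finite.insertI) (simp_all only:)
  qed
  then obtain A where A: "finite A" "A \<inter> Rt n w = {r}" "?\<phi> = (if even (a r) then kap A ?\<phi> else - kap A ?\<phi>)"
    by blast
  have "S \<inter> A = (if r \<in> S then {r} else {})" using S A(2) by auto
  hence "kap A ?\<phi> S = (if r \<in> S then - f a S w else f a S w)" by (simp add: kap_def)
  with fun_cong[OF A(3), of S] nz eq_uminus_imp_0[of "f a S w"] show ?thesis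
    by (auto split: if_splits)
qed

lemma exists_normal:
  assumes "F \<noteq> 0"
  obtains a S w where "f a S w \<noteq> 0" "normal (a, S, w)"
proof -
  obtain b where "coef F b \<noteq> 0" using assms by (metis lookup_zero poly_mapping_eqI)
  then obtain a S w where "f a S w \<noteq> 0" by (cases b) (auto simp: f_def)
  then obtain a' S' where *: "f a' S' w \<noteq> 0" "\<forall>x\<in>{1..n} - Rt n w. a' x = d - 1" "S' \<subseteq> Rt n w"
    by (rule concentrate)
  have "S' = {r \<in> Rt n w. odd (a' r)}" using Clifford_parity[OF *] *(3) by auto
  thus ?thesis using * f_Bs[OF *(1)] by (intro that[of a' S' w]) (auto simp: normal_def)
qed

text \<open>Conjugation by the permutation that extends \<open>\<tau>\<close> along the cycles.
  Normality makes exponents and letters correspond away from the roots as well.\<close>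

lemma transport:
  assumes nz: "f a S w \<noteq> 0" and nb: "normal (a, S, w)" and nb': "normal (a', S', w')"
    and \<tau>: "bij_betw \<tau> (Rt n w) (Rt n w')"
    and k: "\<And>r. r \<in> Rt n w \<Longrightarrow> clen n w' (\<tau> r) = clen n w r \<and> a' (\<tau> r) = a r"
  obtains l where "set l \<subseteq> {1..<n}" "zeta l S * f a S w = f a' S' w'" "\<And>r. r \<in> Rt n w \<Longrightarrow> pw l r = \<tau> r"
proof -
  have w: "w permutes {1..n}" and w': "w' permutes {1..n}"
    using nb nb' by (auto simp: normal_def Bs_def)
  obtain \<sigma> where \<sigma>: "\<sigma> permutes {1..n}" "\<sigma> \<circ> w = w' \<circ> \<sigma>" "\<And>r. r \<in> Rt n w \<Longrightarrow> \<sigma> r = \<tau> r"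
    "\<And>x. x \<in> {1..n} \<Longrightarrow> \<sigma> x \<in> Rt n w' \<longleftrightarrow> x \<in> Rt n w"
    using conjugator[OF w w' \<tau>] k by blast
  obtain l where l: "set l \<subseteq> {1..<n}" "\<sigma> = pw l" using permutes_pw[OF \<sigma>(1)] by blast
  have 1: "pw l (pw (rev l) x) = x" "pw (rev l) (pw l x) = x" for x
    using fun_cong[OF pw_rev(2)[of l], of x] fun_cong[OF pw_rev(1)[of l], of x] by simp_all
  have a: "a' (\<sigma> x) = a x" for x
  proof (cases "x \<in> {1..n}")
    case False
    hence "\<sigma> x = x" using permutes_not_in[OF \<sigma>(1)] by blast
    thus ?thesis using nb nb' False by (simp add: normal_def Bs_def)
  next
    case x: True
    have sx: "\<sigma> x \<in> {1..n}" using permutes_in_image[OF \<sigma>(1)] x by blast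
    show ?thesis
    proof (cases "x \<in> Rt n w")
      case True
      thus ?thesis using k \<sigma>(3) by simp
    next
      case False
      hence "\<sigma> x \<notin> Rt n w'" using \<sigma>(4)[OF x] by simp
      thus ?thesis using nb nb' x sx False by (simp add: normal_def)
    qed
  qed
  have "a \<circ> pw (rev l) = a'"
    by (rule ext) (simp only: comp_apply, subst a[symmetric], simp only: l(2) 1)
  moreover have "pw (rev l) -` S = S'"
  proof (unfold set_eq_iff, rule allI)
    fix x
    let ?x = "pw (rev l) x"
    have sx: "\<sigma> ?x = x" by (simp add: l(2) 1)
    have R: "?x \<in> Rt n w \<longleftrightarrow> x \<in> Rt n w'"
    proof (cases "x \<in> {1..n}")
      case True
      hence "?x \<in> {1..n}" using permutes_in_image[OF \<sigma>(1), of ?x] sx by simp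
      thus ?thesis using \<sigma>(4)[of ?x] sx by simp
    next
      case False
      hence "?x \<notin> {1..n}" using permutes_in_image[OF \<sigma>(1), of ?x] sx by auto
      thus ?thesis using False by (auto simp: Rt_def)
    qed
    have "S = {r \<in> Rt n w. odd (a r)}" "S' = {r \<in> Rt n w'. odd (a' r)}" using nb nb' by (simp_all add: normal_def)
    thus "x \<in> pw (rev l) -` S \<longleftrightarrow> x \<in> S'" using R a[of ?x] sx by auto
  qed
  moreover have "pw l \<circ> w \<circ> pw (rev l) = w'"
    using \<sigma>(2) by (auto simp: fun_eq_iff l(2) 1)
  ultimately have "zeta l S * f a S w = f a' S' w'" using conj_coef[OF l(1), of S a w] by simp
  thus ?thesis using that l \<sigma>(3) by blast
qed

text \<open>Equal types provide a bijection of roots that respects lengths and exponents, and the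
  sign \<open>zeta\<close> met in the transport is not zero.\<close>

lemma same_type:
  assumes nz: "f a S w \<noteq> 0" and nb: "normal (a, S, w)" and nb': "normal b'" and t: "ctype (a, S, w) = ctype b'"
  shows "coef F b' \<noteq> 0"
proof -
  obtain a' S' w' where b': "b' = (a', S', w')" by (cases b')
  interpret W: rooted n w by (rule Bs_rooted[OF f_Bs[OF nz]])
  interpret W': rooted n w' using nb' by unfold_locales (simp add: b' normal_def Bs_def)
  obtain \<tau> where \<tau>: "bij_betw \<tau> (Rt n w) (Rt n w')"
    "\<forall>r\<in>Rt n w. (clen n w' (\<tau> r), d - 1 - a' (\<tau> r)) = (clen n w r, d - 1 - a r)"
    using image_mset_eq_bij[OF W.finite_Rt W'.finite_Rt t[unfolded ctype_def b' prod.case]] by auto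
  have lt: "a x < d" "a' x < d" for x using nb nb' by (auto simp: b' normal_def Bs_def)
  have k: "clen n w' (\<tau> r) = clen n w r \<and> a' (\<tau> r) = a r" if "r \<in> Rt n w" for r
    using \<tau>(2) that lt(1)[of r] lt(2)[of "\<tau> r"] by auto
  obtain l where "zeta l S * f a S w = f a' S' w'"
    using transport[OF nz nb nb'[unfolded b'] \<tau>(1) k] by blast
  thus ?thesis using nz zeta_nz[of l S] by (auto simp: b' f_def)
qed

text \<open>The exchange of two such roots carries the normal element to itself but swaps two
  letters of \<open>c^S\<close>, so its coefficient would equal its own negative.\<close>

lemma odd_roots_distinct:
  assumes nz: "f a S w \<noteq> 0" and nb: "normal (a, S, w)" and r: "r \<in> Rt n w" "r' \<in> Rt n w"
    and e: "clen n w r = clen n w r'" "a r = a r'" "odd (a r)"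
  shows "r = r'"
proof (rule ccontr)
  assume ne: "r \<noteq> r'"
  interpret rooted n w by (rule Bs_rooted[OF f_Bs[OF nz]])
  let ?\<tau> = "Transposition.transpose r r'"
  have b: "bij_betw ?\<tau> (Rt n w) (Rt n w)"
    using r by (intro bij_betw_imageI) (auto intro: inj_on_subset[OF inj_transpose] simp: Transposition.transpose_def image_iff)
  have k: "clen n w (?\<tau> x) = clen n w x \<and> a (?\<tau> x) = a x" if "x \<in> Rt n w" for x
    using e by (auto simp: Transposition.transpose_def)
  obtain l where l: "zeta l S * f a S w = f a S w" "\<And>x. x \<in> Rt n w \<Longrightarrow> pw l x = ?\<tau> x"
    using transport[OF nz nb nb b k] by blast
  have S: "S = {r \<in> Rt n w. odd (a r)}" using nb by (simp add: normal_def)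
  have rS: "r \<in> S" "r' \<in> S" using r e S by auto
  have "zeta l (insert r (insert r' (S - {r, r'}))) = (-1 :: 'f)"
  proof (rule zeta_swap)
    show "finite (S - {r, r'})" unfolding S by simp
    show "pw l x = x" if "x \<in> S - {r, r'}" for x
    proof -
      have "x \<in> Rt n w" using that S by auto
      thus ?thesis using l(2) that by (simp add: Transposition.transpose_def)
    qed
  qed (use ne r l(2) in \<open>auto\<close>)
  moreover have "insert r (insert r' (S - {r, r'})) = S" using rS by auto
  ultimately have "zeta l S = (-1 :: 'f)" by simp
  hence "f a S w = - f a S w" using l(1) by simp
  thus False using nz eq_uminus_imp_0 by blast
qed

end

section \<open>The index set\<close>

lemma length_le_sum_list: "(\<forall>p\<in>set l. 0 < (p::nat)) \<Longrightarrow> length l \<le> sum_list l"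
  by (induction l) auto

lemma finite_hat: "finite (hat_colored_partitions d n)"
proof -
  define X where "X = {l :: nat list. set l \<subseteq> {..n + d} \<and> length l \<le> n}"
  have X: "finite X" unfolding X_def by (rule finite_lists_length_le) simp
  have part: "l \<in> X" if "\<forall>p\<in>set l. 0 < p" "sum_list l \<le> n" for l
  proof -
    have "\<forall>p\<in>set l. p \<le> sum_list l" using member_le_sum_list by blast
    thus ?thesis using that length_le_sum_list[of l] by (force simp: X_def)
  qed
  have "hat_colored_partitions d n \<subseteq> X \<times> X \<times> X"
  proof
    fix \<beta> assume "\<beta> \<in> hat_colored_partitions d n"
    then obtain l clr m s where b: "\<beta> = (l, clr, m)" and s: "s \<le> n" and
      l: "opposite_partition s l" and c: "color_datum d l clr" and m: "std_partition (n - s) m"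
      by (auto simp: hat_colored_partitions_def colored_partitions_def)
    have 1: "l \<in> X" using l s by (intro part) (auto simp: opposite_partition_def)
    have 2: "m \<in> X" using m by (intro part) (auto simp: std_partition_def)
    have "clr \<in> X" using c 1 by (force simp: color_datum_def X_def)
    thus "\<beta> \<in> X \<times> X \<times> X" using 1 2 b by simp
  qed
  thus ?thesis using X by (metis finite_SigmaI finite_subset)
qed

lemma nth_eq_count:
  assumes "i < length Z" "j < length Z" "i \<noteq> j" "Z ! i = Z ! j"
  shows "2 \<le> count (mset Z) (Z ! i)"
proof -
  have "card {i, j} \<le> card {k. k < length Z \<and> Z ! k = Z ! i}"
    by (rule card_mono) (use assms in auto)
  also have "\<dots> = length (filter (\<lambda>x. x = Z ! i) Z)" by (simp add: length_filter_conv_card)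
  also have "\<dots> = count (mset Z) (Z ! i)" 
    unfolding count_mset count_list_eq_length_filter by (rule arg_cong[of _ _ length], rule filter_cong) auto
  finally show ?thesis using assms(3) by simp
qed

text \<open>Pairs with color 0 form the second partition, the others the colored one; the two
  conditions on even colors are statements about multiplicity and size of \<open>M\<close>.\<close>

lemma exists_hat:
  fixes M :: "(nat \<times> nat) multiset"
  assumes pos: "\<And>x. x \<in># M \<Longrightarrow> 0 < fst x \<and> snd x < d" and sum: "sum_mset (image_mset fst M) = n"
    and dist: "\<And>x. even (snd x) \<Longrightarrow> count M x \<le> 1" and ev: "even (size (filter_mset (\<lambda>x. even (snd x)) M))"
  shows "\<exists>\<beta>\<in>hat_colored_partitions d n. mset (zip (all_parts \<beta>) (all_colors \<beta>)) = M"
proof -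
  \<comment> \<open>Sorting by \<open>key\<close> puts smaller parts first and, among equal parts,
    larger colors first, as a color datum demands. Colors are below \<open>d\<close>, so the second
    summand never outweighs the first.\<close>
  define key where "key x = fst x * d + (d - 1 - snd x)" for x :: "nat \<times> nat"
  obtain xs where xs: "mset xs = filter_mset (\<lambda>x. snd x \<noteq> 0) M" using ex_mset by blast
  obtain ys where ys: "mset ys = filter_mset (\<lambda>x. snd x = 0) M" using ex_mset by blast
  define L where "L = sort_key key xs"
  define l clr m where "l = map fst L" and "clr = map snd L" and "m = rev (sort (map fst ys))"
  have mL: "mset L = filter_mset (\<lambda>x. snd x \<noteq> 0) M" by (simp add: L_def xs)
  have setL: "set L = {x \<in> set_mset M. snd x \<noteq> 0}" using arg_cong[OF mL, of set_mset] by auto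
  have setys: "set ys = {x \<in> set_mset M. snd x = 0}" using arg_cong[OF ys, of set_mset] by auto
  have key: "key (L ! i) \<le> key (L ! j)" if "i \<le> j" "j < length L" for i j
    using sorted_nth_mono[of "map key L" i j] that by (simp add: L_def)
  have inM: "L ! i \<in># M" "snd (L ! i) \<noteq> 0" if "i < length L" for i
    using nth_mem[OF that] setL by auto
  have fst_mono: "fst (L ! i) \<le> fst (L ! j)" if "i \<le> j" "j < length L" for i j
  proof (rule ccontr)
    assume "\<not> ?thesis"
    hence "fst (L ! j) + 1 \<le> fst (L ! i)" by simp
    hence "(fst (L ! j) + 1) * d \<le> fst (L ! i) * d" by (rule mult_le_mono1)
    moreover have "snd (L ! j) < d" using pos inM(1)[OF that(2)] by blast
    ultimately have "key (L ! j) < key (L ! i)" unfolding key_def by (simp add: algebra_simps)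
    thus False using key[OF that] by simp
  qed
  define Z where "Z = zip (l @ m) (clr @ replicate (length m) 0)"
  have Z: "Z = L @ map (\<lambda>p. (p, 0)) m"
  proof -
    have "zip l clr = L" by (simp add: l_def clr_def zip_map_fst_snd)
    moreover have "zip m (replicate (length m) 0) = map (\<lambda>p. (p, 0 :: nat)) m"
      by (simp add: zip_replicate2)
    ultimately show ?thesis unfolding Z_def by (subst zip_append) (auto simp: l_def clr_def)
  qed
  have mm: "mset (map (\<lambda>p. (p, 0)) m) = mset ys"
  proof -
    have "mset (map (\<lambda>p. (p, 0)) m) = image_mset (\<lambda>p. (p, 0)) (mset m)" by simp
    also have "mset m = image_mset fst (mset ys)" by (simp add: m_def)
    also have "image_mset (\<lambda>p. (p, 0)) (image_mset fst (mset ys)) = image_mset (\<lambda>x. x) (mset ys)"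
      unfolding multiset.map_comp by (rule image_mset_cong) (use setys in \<open>auto simp: prod_eq_iff\<close>)
    finally show ?thesis by simp
  qed
  have MZ: "mset Z = M"
    unfolding Z mset_append mm mL ys by (rule multiset_eqI) simp
  have len: "length Z = length (l @ m)" by (simp add: Z_def l_def clr_def)
  have lenc: "length (clr @ replicate (length m) 0) = length (l @ m)" by (simp add: l_def clr_def)
  have nthZ: "Z ! i = ((l @ m) ! i, (clr @ replicate (length m) 0) ! i)" if "i < length (l @ m)" for i
    unfolding Z_def by (rule nth_zip) (use that lenc in simp_all)
  have sumZ: "sum_list l + sum_list m = n"
  proof -
    have "map fst Z = l @ m" unfolding Z_def by (rule map_fst_zip) (rule lenc[symmetric])
    hence "sum_list (l @ m) = sum_mset (mset (map fst Z))" by (simp only: sum_mset_sum_list)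
    also have "\<dots> = n" using sum by (simp add: MZ del: sum_mset_sum_list)
    finally show ?thesis by simp
  qed
  have "opposite_partition (sum_list l) l"
    unfolding opposite_partition_def
  proof (intro conjI refl)
    show "sorted l" unfolding sorted_iff_nth_mono using fst_mono by (auto simp: l_def)
    show "\<forall>p\<in>set l. 0 < p" using pos setL by (auto simp: l_def)
  qed
  moreover have "color_datum d l clr"
    unfolding color_datum_def
  proof (intro conjI allI impI)
    show "length clr = length l" by (simp add: l_def clr_def)
    show "set clr \<subseteq> {1..d - 1}"
    proof
      fix c assume "c \<in> set clr"
      then obtain x where "x \<in># M" "snd x \<noteq> 0" "c = snd x" using setL by (auto simp: clr_def)
      thus "c \<in> {1..d - 1}" using pos[of x] by auto
    qed
    fix i assume i: "Suc i < length l" "l ! i = l ! Suc i"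
    hence "fst (L ! i) = fst (L ! Suc i)" "Suc i < length L" by (auto simp: l_def)
    moreover have "key (L ! i) \<le> key (L ! Suc i)" by (rule key) (use i in \<open>auto simp: l_def\<close>)
    moreover have "snd (L ! i) < d" "snd (L ! Suc i) < d" using pos inM(1) calculation(2) by (auto simp: Suc_lessD)
    ultimately show "clr ! Suc i \<le> clr ! i" by (simp add: clr_def key_def)
  qed
  moreover have "std_partition (n - sum_list l) m"
    unfolding std_partition_def
  proof (intro conjI)
    show "sorted_wrt (\<ge>) m" unfolding m_def sorted_wrt_rev using sorted_sort[of "map fst ys"] by (simp add: sorted_wrt_iff_nth_less sorted_iff_nth_mono_less)
    show "\<forall>p\<in>set m. 0 < p" using pos setys by (auto simp: m_def)
    show "sum_list m = n - sum_list l" using sumZ by simp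
  qed
  moreover have "sum_list l \<le> n" using sumZ by simp
  ultimately have C: "(l, clr, m) \<in> colored_partitions d n"
    unfolding colored_partitions_def by blast
  have "(l, clr, m) \<in> hat_colored_partitions d n"
    unfolding hat_colored_partitions_def mem_Collect_eq all_parts.simps all_colors.simps
  proof (intro conjI allI impI C notI)
    fix i j assume i: "i < length (l @ m)" and j: "j < length (l @ m)" and ij: "i \<noteq> j"
      and c: "(clr @ replicate (length m) 0) ! i = (clr @ replicate (length m) 0) ! j"
      and e: "even ((clr @ replicate (length m) 0) ! i)" and p: "(l @ m) ! i = (l @ m) ! j"
    have "Z ! i = Z ! j" using nthZ[OF i] nthZ[OF j] c p by simp
    then have "2 \<le> count M (Z ! i)" 
      using nth_eq_count[OF i[folded len] j[folded len] ij \<open>Z ! i = Z ! j\<close>] by (simp only: MZ)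
    moreover have "even (snd (Z ! i))" using nthZ[OF i] e by simp
    ultimately show False using dist[of "Z ! i"] by simp
  next
    have "card {i. i < length (l @ m) \<and> even ((clr @ replicate (length m) 0) ! i)} = card {i. i < length Z \<and> even (snd (Z ! i))}"
      by (rule arg_cong[of _ _ card]) (use nthZ len in auto)
    also have "\<dots> = length (filter (\<lambda>x. even (snd x)) Z)" by (simp add: length_filter_conv_card)
    also have "\<dots> = size (filter_mset (\<lambda>x. even (snd x)) M)"
      unfolding MZ[symmetric] by (simp only: mset_filter[symmetric] size_mset)
    finally show "even (card {i. i < length (l @ m) \<and> even ((clr @ replicate (length m) 0) ! i)})" using ev by simp
  qed
  moreover have "mset (zip (all_parts (l, clr, m)) (all_colors (l, clr, m))) = M" using MZ by (simp add: Z_def)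
  ultimately show ?thesis by blast
qed

context cyclotomic_space
begin

text \<open>The choice is meaningful only if some normal element has this type; in
  \<open>detects\<close> such an element is at hand.\<close>

definition rep :: "nat list \<times> nat list \<times> nat list \<Rightarrow> idx" where
  "rep \<beta> = (SOME b. normal b \<and> ctype b = mset (zip (all_parts \<beta>) (all_colors \<beta>)))"

end

context central_top
begin

text \<open>The type of a normal element with nonzero coefficient lies in the index set: cycle
  lengths add up to \<open>n\<close>, \<open>odd_roots_distinct\<close> bounds the multiplicities,
  and the roots of even color are the elements of \<open>S\<close>, of even number. The coefficient
  is then moved to the chosen representative.\<close>

lemma detects:
  assumes "F \<noteq> 0"
  shows "\<exists>\<beta>\<in>hat_colored_partitions d n. coef F (rep \<beta>) \<noteq> 0"
proof -
  obtain a S w where nz: "f a S w \<noteq> 0" and nb: "normal (a, S, w)" by (rule exists_normal[OF assms])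
  interpret rooted n w by (rule Bs_rooted[OF f_Bs[OF nz]])
  let ?h = "\<lambda>r. (clen n w r, d - 1 - a r)"
  define M where "M = image_mset ?h (mset_set (Rt n w))"
  have lt: "a x < d" for x using nb by (simp add: normal_def Bs_def)
  have par: "even (d - 1 - a r) \<longleftrightarrow> odd (a r)" for r using lt[of r] d_even d_pos by auto
  have S: "S = {r \<in> Rt n w. odd (a r)}" using nb by (simp add: normal_def)
  have "\<exists>\<beta>\<in>hat_colored_partitions d n. mset (zip (all_parts \<beta>) (all_colors \<beta>)) = M"
  proof (rule exists_hat)
    show "0 < fst x \<and> snd x < d" if "x \<in># M" for x using that d_pos by (auto simp: M_def clen_def)
    show "sum_mset (image_mset fst M) = n"
      unfolding M_def multiset.map_comp using sum_clen by (simp add: o_def sum_unfold_sum_mset)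
    show "count M x \<le> 1" if "even (snd x)" for x
    proof -
      have "count M x = card (?h -` {x} \<inter> Rt n w)" by (simp add: M_def count_image_mset)
      also have "\<dots> \<le> 1"
      proof (rule card_le_Suc0_iff_eq[THEN iffD2, folded One_nat_def])
        show "\<forall>r\<in>?h -` {x} \<inter> Rt n w. \<forall>r'\<in>?h -` {x} \<inter> Rt n w. r = r'"
        proof (intro ballI)
          fix r r' assume r: "r \<in> ?h -` {x} \<inter> Rt n w" "r' \<in> ?h -` {x} \<inter> Rt n w"
          have h: "?h r = x" "?h r' = x" using r by blast+
          have "even (snd (?h r))" unfolding h(1) by (rule that)
          hence o: "odd (a r)" using par[of r] unfolding snd_conv by blast
          have "?h r = ?h r'" unfolding h ..
          with o have "clen n w r = clen n w r'" "d - 1 - a r = d - 1 - a r'" "odd (a r)"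
            unfolding prod.inject by blast+
          moreover from this(2) have "a r = a r'" using lt[of r] lt[of r'] by linarith
          ultimately show "r = r'" using odd_roots_distinct[OF nz nb, of r r'] r by blast
        qed
      qed simp
      finally show ?thesis .
    qed
    have "size (filter_mset (\<lambda>x. even (snd x)) M) = size (filter_mset (\<lambda>r. even (snd (?h r))) (mset_set (Rt n w)))"
      unfolding M_def filter_mset_image_mset by simp
    also have "\<dots> = card {r \<in> Rt n w. even (d - 1 - a r)}" by (simp add: filter_mset_mset_set)
    also have "{r \<in> Rt n w. even (d - 1 - a r)} = S" unfolding S using par by blast
    finally show "even (size (filter_mset (\<lambda>x. even (snd x)) M))" using f_even[OF nz] by simp
  qed
  then obtain \<beta> where \<beta>: "\<beta> \<in> hat_colored_partitions d n" "mset (zip (all_parts \<beta>) (all_colors \<beta>)) = M" by blast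
  have "normal (a, S, w) \<and> ctype (a, S, w) = mset (zip (all_parts \<beta>) (all_colors \<beta>))"
    using nb \<beta>(2) by (simp add: ctype_def M_def)
  hence r: "normal (rep \<beta>)" "ctype (rep \<beta>) = mset (zip (all_parts \<beta>) (all_colors \<beta>))"
    unfolding rep_def by (metis (mono_tags, lifting) someI_ex)+
  have "coef F (rep \<beta>) \<noteq> 0"
    by (rule same_type[OF nz nb r(1)]) (unfold r(2) \<beta>(2), simp add: ctype_def M_def)
  thus ?thesis using \<beta>(1) by blast
qed

end

section \<open>Spanning words\<close>

lemma free_carrier_0: "0 \<in> free_carrier n" by (simp add: free_carrier_def)
lemma free_carrier_add: "p \<in> free_carrier n \<Longrightarrow> q \<in> free_carrier n \<Longrightarrow> p + q \<in> free_carrier n"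
  using keys_add[of p q] by (force simp: free_carrier_def)
lemma free_carrier_uminus: "p \<in> free_carrier n \<Longrightarrow> - p \<in> free_carrier n"
  by (simp add: free_carrier_def)
lemma free_carrier_diff: "p \<in> free_carrier n \<Longrightarrow> q \<in> free_carrier n \<Longrightarrow> p - q \<in> free_carrier n"
  using free_carrier_add[OF _ free_carrier_uminus, of p n q] by simp
lemma free_carrier_single: "set u \<subseteq> sergeev_gens n \<Longrightarrow> Poly_Mapping.single (Word u) z \<in> free_carrier n"
  by (simp add: free_carrier_def)
lemma free_carrier_const: "Poly_Mapping.single 0 z \<in> free_carrier n"
  unfolding zero_free_word_def by (rule free_carrier_single) simp
lemma free_carrier_1: "1 \<in> free_carrier n"
  using free_carrier_const[of 1 n] by simp
lemma free_carrier_mult: "p \<in> free_carrier n \<Longrightarrow> q \<in> free_carrier n \<Longrightarrow> p * q \<in> free_carrier n"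
  using keys_mult[of p q] by (force simp: free_carrier_def)
lemma free_carrier_sum: "(\<And>i. i \<in> A \<Longrightarrow> h i \<in> free_carrier n) \<Longrightarrow> sum h A \<in> free_carrier n"
  by (induction A rule: infinite_finite_induct) (auto simp: free_carrier_0 free_carrier_add)
lemma free_carrier_power: "p \<in> free_carrier n \<Longrightarrow> p ^ k \<in> free_carrier n"
  by (induction k) (auto simp: free_carrier_1 free_carrier_mult)

text \<open>\<open>J\<close> will be the kernel of the map from the free algebra to the cyclotomic
  one. Keeping it abstract avoids cosets; the last assumption links the presentation to the action
  on \<open>spn Bs\<close>.\<close>

locale cyclotomic_relations = cyclotomic_space d g n for d n :: nat and g :: "'f::field poly" +
  fixes J :: "'f sergeev_free set"
  assumes J_0: "0 \<in> J" and J_add: "p \<in> J \<Longrightarrow> q \<in> J \<Longrightarrow> p + q \<in> J"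
    and J_left: "p \<in> J \<Longrightarrow> q \<in> free_carrier n \<Longrightarrow> q * p \<in> J"
    and J_right: "p \<in> J \<Longrightarrow> q \<in> free_carrier n \<Longrightarrow> p * q \<in> J"
    and J_rel: "sergeev_rel n p q \<Longrightarrow> p - q \<in> J" and J_gpoly: "gpoly \<in> J"
    and J_annih: "p \<in> J \<Longrightarrow> annih p"
begin

lemma J_uminus: "p \<in> J \<Longrightarrow> - p \<in> J"
proof -
  assume p: "p \<in> J"
  have "(- 1 :: 'f sergeev_free) \<in> free_carrier n" by (rule free_carrier_uminus[OF free_carrier_1])
  from J_left[OF p this] show ?thesis by simp
qed
lemma J_diff: "p \<in> J \<Longrightarrow> q \<in> J \<Longrightarrow> p - q \<in> J"
  using J_add[OF _ J_uminus, of p q] by simp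

definition W :: "sergeev_gen list \<Rightarrow> 'f sergeev_free" where
  "W u = Poly_Mapping.single (Word u) 1"

lemma W_append: "W (u @ v) = W u * W v"
  by (simp add: W_def mult_single plus_free_word_def)
lemma W_Nil: "W [] = 1"
  by (simp add: W_def zero_free_word_def[symmetric])
lemma W_Cons: "W (l # u) = gen l * W u"
  using W_append[of "[l]" u] by (simp add: W_def)
lemma W_carrier: "set u \<subseteq> sergeev_gens n \<Longrightarrow> W u \<in> free_carrier n"
  unfolding W_def by (rule free_carrier_single)
lemma W_replicate: "W (replicate k l) = gen l ^ k"
  by (induction k) (simp_all add: W_Nil W_Cons)

definition lw :: "nat \<Rightarrow> 'f sergeev_free set" where
  "lw k = {q \<in> free_carrier n. \<forall>w\<in>keys q. xdeg (letters w) < k}"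

lemma lw_0: "0 \<in> lw k" by (simp add: lw_def free_carrier_0)
lemma lw_add: "p \<in> lw k \<Longrightarrow> q \<in> lw k \<Longrightarrow> p + q \<in> lw k"
  using keys_add[of p q] free_carrier_add[of p n q] by (force simp: lw_def)
lemma lw_uminus: "p \<in> lw k \<Longrightarrow> - p \<in> lw k"
  by (simp add: lw_def free_carrier_uminus)
lemma lw_sum: "(\<And>i. i \<in> A \<Longrightarrow> h i \<in> lw k) \<Longrightarrow> sum h A \<in> lw k"
  by (induction A rule: infinite_finite_induct) (auto simp: lw_0 lw_add)
lemma lw_mono: "k \<le> l \<Longrightarrow> p \<in> lw k \<Longrightarrow> p \<in> lw l" by (force simp: lw_def)
lemma lw_single: "set u \<subseteq> sergeev_gens n \<Longrightarrow> xdeg u < k \<Longrightarrow> Poly_Mapping.single (Word u) z \<in> lw k"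
  by (simp add: lw_def free_carrier_single)
lemma lw_W: "set u \<subseteq> sergeev_gens n \<Longrightarrow> xdeg u < k \<Longrightarrow> W u \<in> lw k"
  unfolding W_def by (rule lw_single)
lemma lw_left: "q \<in> lw k \<Longrightarrow> set u \<subseteq> sergeev_gens n \<Longrightarrow> W u * q \<in> lw (xdeg u + k)"
  using keys_mult[of "W u" q] free_carrier_mult[OF W_carrier, of u q] by (force simp: lw_def W_def)
lemma lw_right: "q \<in> lw k \<Longrightarrow> set u \<subseteq> sergeev_gens n \<Longrightarrow> q * W u \<in> lw (k + xdeg u)"
  using keys_mult[of q "W u"] free_carrier_mult[OF _ W_carrier, of q u] by (force simp: lw_def W_def)

definition lowJ :: "nat \<Rightarrow> 'f sergeev_free set" where
  "lowJ k = {p. \<exists>q\<in>lw k. p - q \<in> J}"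

lemma lowJ_J: "p \<in> J \<Longrightarrow> p \<in> lowJ k" unfolding lowJ_def using lw_0 by force
lemma lowJ_add: "p \<in> lowJ k \<Longrightarrow> q \<in> lowJ k \<Longrightarrow> p + q \<in> lowJ k"
proof -
  assume "p \<in> lowJ k" "q \<in> lowJ k"
  then obtain r s where r: "r \<in> lw k" "s \<in> lw k" "p - r \<in> J" "q - s \<in> J" by (auto simp: lowJ_def)
  have "(p + q) - (r + s) \<in> J" using J_add[OF r(3,4)] by (simp add: algebra_simps)
  thus ?thesis using lw_add[OF r(1,2)] by (auto simp: lowJ_def)
qed
lemma lowJ_uminus: "p \<in> lowJ k \<Longrightarrow> - p \<in> lowJ k"
proof -
  assume "p \<in> lowJ k"
  then obtain r where r: "r \<in> lw k" "p - r \<in> J" by (auto simp: lowJ_def)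
  have "- p - (- r) \<in> J" using J_uminus[OF r(2)] by (simp add: algebra_simps)
  thus ?thesis using lw_uminus[OF r(1)] unfolding lowJ_def by blast
qed
lemma lowJ_left: "p \<in> lowJ k \<Longrightarrow> set u \<subseteq> sergeev_gens n \<Longrightarrow> W u * p \<in> lowJ (xdeg u + k)"
proof -
  assume "p \<in> lowJ k" and u: "set u \<subseteq> sergeev_gens n"
  then obtain r where r: "r \<in> lw k" "p - r \<in> J" by (auto simp: lowJ_def)
  have "W u * p - W u * r \<in> J" using J_left[OF r(2) W_carrier[OF u]] by (simp add: right_diff_distrib)
  thus ?thesis using lw_left[OF r(1) u] by (auto simp: lowJ_def)
qed
lemma lowJ_right: "p \<in> lowJ k \<Longrightarrow> set u \<subseteq> sergeev_gens n \<Longrightarrow> p * W u \<in> lowJ (k + xdeg u)"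
proof -
  assume "p \<in> lowJ k" and u: "set u \<subseteq> sergeev_gens n"
  then obtain r where r: "r \<in> lw k" "p - r \<in> J" by (auto simp: lowJ_def)
  have "p * W u - r * W u \<in> J" using J_right[OF r(2) W_carrier[OF u]] by (simp add: left_diff_distrib)
  thus ?thesis using lw_right[OF r(1) u] by (auto simp: lowJ_def)
qed
lemma lowJ_sign: "p \<in> lowJ k \<Longrightarrow> e \<in> {1, -1} \<Longrightarrow> e * p \<in> lowJ k"
  using lowJ_uminus by auto

text \<open>Words are compared up to a sign and up to words with fewer letters \<open>gX\<close>.\<close>

definition eqv :: "sergeev_gen list \<Rightarrow> sergeev_gen list \<Rightarrow> bool" where
  "eqv u v \<longleftrightarrow> set u \<subseteq> sergeev_gens n \<and> set v \<subseteq> sergeev_gens n \<and> xdeg u = xdeg v \<and>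
    (\<exists>e\<in>{1, -1}. W u - e * W v \<in> lowJ (xdeg u))"

lemma eqv_gens: "eqv u v \<Longrightarrow> set u \<subseteq> sergeev_gens n" "eqv u v \<Longrightarrow> set v \<subseteq> sergeev_gens n"
  by (simp_all add: eqv_def)

lemma eqvI:
  assumes "set u \<subseteq> sergeev_gens n" "set v \<subseteq> sergeev_gens n" "xdeg u = xdeg v" "e \<in> {1, -1}"
    "W u - (e * W v + r) \<in> J" "r \<in> lw (xdeg u)"
  shows "eqv u v"
proof -
  have "(W u - e * W v) - r \<in> J" using assms(5) by (simp add: algebra_simps)
  hence "W u - e * W v \<in> lowJ (xdeg u)" using assms(6) by (auto simp: lowJ_def)
  thus ?thesis using assms by (auto simp: eqv_def)
qed

lemma eqv_refl: "set u \<subseteq> sergeev_gens n \<Longrightarrow> eqv u u"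
  by (rule eqvI[of u u 1 0]) (auto simp: J_0 lw_0)

lemma eqv_sym: "eqv u v \<Longrightarrow> eqv v u"
proof -
  assume a: "eqv u v"
  then obtain e where e: "e \<in> {1, -1}" "W u - e * W v \<in> lowJ (xdeg u)" unfolding eqv_def by blast
  have "- (e * (W u - e * W v)) \<in> lowJ (xdeg u)" by (intro lowJ_uminus lowJ_sign e)
  moreover have "- (e * (W u - e * W v)) = W v - e * W u" using e(1) by auto
  ultimately show ?thesis using a e(1) by (auto simp: eqv_def)
qed

lemma eqv_trans [trans]: "eqv u v \<Longrightarrow> eqv v w \<Longrightarrow> eqv u w"
proof -
  assume a: "eqv u v" "eqv v w"
  then obtain e e' where e: "e \<in> {1, -1}" "W u - e * W v \<in> lowJ (xdeg u)"
    "e' \<in> {1, -1}" "W v - e' * W w \<in> lowJ (xdeg v)" unfolding eqv_def by blast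
  have "W u - e * W v + e * (W v - e' * W w) \<in> lowJ (xdeg u)"
    using e(2,4) a(1) by (intro lowJ_add lowJ_sign e(1)) (simp_all add: eqv_def)
  moreover have "W u - e * W v + e * (W v - e' * W w) = W u - (e * e') * W w"
    by (simp add: right_diff_distrib mult.assoc)
  moreover have "e * e' \<in> {1, -1}" using e by auto
  ultimately have "\<exists>e\<in>{1, -1}. W u - e * W w \<in> lowJ (xdeg u)" by metis
  thus ?thesis using a by (simp add: eqv_def)
qed

lemma eqv_cong:
  assumes "eqv u v" "set a \<subseteq> sergeev_gens n" "set b \<subseteq> sergeev_gens n"
  shows "eqv (a @ u @ b) (a @ v @ b)"
proof -
  obtain e where e: "e \<in> {1, -1}" "W u - e * W v \<in> lowJ (xdeg u)" using assms(1) unfolding eqv_def by blast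
  have "W a * ((W u - e * W v) * W b) \<in> lowJ (xdeg a + (xdeg u + xdeg b))"
    by (intro lowJ_left lowJ_right e assms)
  moreover have "W a * ((W u - e * W v) * W b) = W (a @ u @ b) - e * W (a @ v @ b)"
    using e(1) by (auto simp: W_append algebra_simps)
  ultimately show ?thesis using assms e(1) by (auto simp: eqv_def)
qed

lemma eqv_left: "eqv u v \<Longrightarrow> set a \<subseteq> sergeev_gens n \<Longrightarrow> eqv (a @ u) (a @ v)"
  using eqv_cong[of u v a "[]"] by simp
lemma eqv_right: "eqv u v \<Longrightarrow> set b \<subseteq> sergeev_gens n \<Longrightarrow> eqv (u @ b) (v @ b)"
  using eqv_cong[of u v "[]" b] by simp
lemma eqv_append: "eqv u v \<Longrightarrow> eqv u' v' \<Longrightarrow> eqv (u @ u') (v @ v')"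
  using eqv_trans[OF eqv_right[of u v u'] eqv_left[of u' v' v]] eqv_gens by blast
lemma eqv_Cons: "eqv u v \<Longrightarrow> l \<in> sergeev_gens n \<Longrightarrow> eqv (l # u) (l # v)"
  using eqv_left[of u v "[l]"] by simp

text \<open>The word is zero in the associated graded algebra.\<close>

definition null :: "sergeev_gen list \<Rightarrow> bool" where
  "null u \<longleftrightarrow> set u \<subseteq> sergeev_gens n \<and> W u \<in> lowJ (xdeg u)"

lemma null_cong:
  assumes "null u" "set a \<subseteq> sergeev_gens n" "set b \<subseteq> sergeev_gens n"
  shows "null (a @ u @ b)"
proof -
  have "W a * (W u * W b) \<in> lowJ (xdeg a + (xdeg u + xdeg b))"
    by (intro lowJ_left lowJ_right) (use assms in \<open>auto simp: null_def\<close>)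
  thus ?thesis using assms by (simp add: null_def W_append)
qed

lemma null_eqv: "eqv u v \<Longrightarrow> null v \<Longrightarrow> null u"
proof -
  assume a: "eqv u v" "null v"
  then obtain e where e: "e \<in> {1, -1}" "W u - e * W v \<in> lowJ (xdeg u)" unfolding eqv_def by blast
  have "(W u - e * W v) + e * W v \<in> lowJ (xdeg u)"
    using a e by (intro lowJ_add lowJ_sign) (auto simp: null_def eqv_def)
  thus ?thesis using a by (simp add: null_def eqv_def)
qed

lemma gens_iff [simp]: "gS i \<in> sergeev_gens n \<longleftrightarrow> 1 \<le> i \<and> i < n" "gX i \<in> sergeev_gens n \<longleftrightarrow> 1 \<le> i \<and> i \<le> n"
    "gC i \<in> sergeev_gens n \<longleftrightarrow> 1 \<le> i \<and> i \<le> n"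
  using n_pos by (auto simp: sergeev_gens_def)

lemma eqv_s_sq: "1 \<le> i \<Longrightarrow> i < n \<Longrightarrow> eqv [gS i, gS i] []"
  using J_rel[OF s_sq[of i n]] by (intro eqvI[of _ _ 1 0]) (auto simp: W_Cons W_Nil lw_0)

lemma eqv_c_sq: "1 \<le> i \<Longrightarrow> i \<le> n \<Longrightarrow> eqv [gC i, gC i] []"
  using J_rel[OF c_sq[of i n]] by (intro eqvI[of _ _ 1 0]) (auto simp: W_Cons W_Nil lw_0)

lemma eqv_s_comm: "1 \<le> i \<Longrightarrow> i < n \<Longrightarrow> 1 \<le> j \<Longrightarrow> j < n \<Longrightarrow> Suc i < j \<or> Suc j < i \<Longrightarrow> eqv [gS i, gS j] [gS j, gS i]"
  using J_rel[OF s_comm[of i n j]] by (intro eqvI[of _ _ 1 0]) (auto simp: W_Cons W_Nil lw_0)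

lemma eqv_braid: "1 \<le> i \<Longrightarrow> Suc i < n \<Longrightarrow> eqv [gS i, gS (Suc i), gS i] [gS (Suc i), gS i, gS (Suc i)]"
  using J_rel[OF s_braid[of i n]] by (intro eqvI[of _ _ 1 0]) (auto simp: W_Cons W_Nil lw_0 mult.assoc)

lemma eqv_xx: "i \<in> {1..n} \<Longrightarrow> j \<in> {1..n} \<Longrightarrow> eqv [gX i, gX j] [gX j, gX i]"
  using J_rel[OF x_comm[of i n j]] by (intro eqvI[of _ _ 1 0]) (auto simp: W_Cons W_Nil lw_0)

lemma eqv_cc: "i \<in> {1..n} \<Longrightarrow> j \<in> {1..n} \<Longrightarrow> eqv [gC i, gC j] [gC j, gC i]"
proof (cases "i = j")
  case False
  assume "i \<in> {1..n}" "j \<in> {1..n}"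
  thus ?thesis using J_rel[OF c_anticomm[of i n j]] False
    by (intro eqvI[of _ _ "-1" 0]) (auto simp: W_Cons W_Nil lw_0)
qed (auto intro: eqv_refl)

lemma eqv_cx: "i \<in> {1..n} \<Longrightarrow> j \<in> {1..n} \<Longrightarrow> eqv [gC i, gX j] [gX j, gC i]"
proof -
  assume ij: "i \<in> {1..n}" "j \<in> {1..n}"
  have "eqv [gX j, gC i] [gC i, gX j]"
  proof (cases "i = j")
    case True
    thus ?thesis using J_rel[OF x_c[of j n]] ij
      by (intro eqvI[of _ _ "-1" 0]) (auto simp: W_Cons W_Nil lw_0)
  next
    case False
    thus ?thesis using J_rel[OF x_c_comm[of j n i]] ij
      by (intro eqvI[of _ _ 1 0]) (auto simp: W_Cons W_Nil lw_0)
  qed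
  thus ?thesis by (rule eqv_sym)
qed

lemma eqv_sc: "1 \<le> i \<Longrightarrow> i < n \<Longrightarrow> j \<in> {1..n} \<Longrightarrow> eqv [gS i, gC j] [gC (tp i j), gS i]"
proof -
  assume i: "1 \<le> i" "i < n" and j: "j \<in> {1..n}"
  consider "j = i" | "j = Suc i" | "j \<noteq> i" "j \<noteq> Suc i" by blast
  thus ?thesis
  proof cases
    case 1
    thus ?thesis using J_rel[OF s_c[of i n]] i
      by (intro eqvI[of _ _ 1 0]) (auto simp: W_Cons W_Nil lw_0 tp_apply)
  next
    case 2
    thus ?thesis using J_rel[OF s_c_Suc[of i n]] i
      by (intro eqvI[of _ _ 1 0]) (auto simp: W_Cons W_Nil lw_0 tp_apply)
  next
    case 3
    thus ?thesis using J_rel[OF s_c_comm[of i n j]] i j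
      by (intro eqvI[of _ _ 1 0]) (auto simp: W_Cons W_Nil lw_0 tp_apply)
  qed
qed

lemma eqv_s_x: "1 \<le> i \<Longrightarrow> i < n \<Longrightarrow> eqv [gS i, gX i] [gX (Suc i), gS i]"
proof (rule eqvI[of _ _ 1 "- (W [] + W [gC i, gC (Suc i)])"])
  assume i: "1 \<le> i" "i < n"
  show "W [gS i, gX i] - (1 * W [gX (Suc i), gS i] + - (W [] + W [gC i, gC (Suc i)])) \<in> J"
    using J_rel[OF s_x[of i n]] i by (simp add: W_Cons W_Nil algebra_simps)
  show "- (W [] + W [gC i, gC (Suc i)]) \<in> lw (xdeg [gS i, gX i])"
    using i by (intro lw_uminus lw_add lw_W) auto
qed auto

lemma eqv_sx: "1 \<le> i \<Longrightarrow> i < n \<Longrightarrow> j \<in> {1..n} \<Longrightarrow> eqv [gS i, gX j] [gX (tp i j), gS i]"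
proof -
  assume i: "1 \<le> i" "i < n" and j: "j \<in> {1..n}"
  consider "j = i" | "j = Suc i" | "j \<noteq> i" "j \<noteq> Suc i" by blast
  thus ?thesis
  proof cases
    case 1
    thus ?thesis using eqv_s_x[OF i] by (simp add: tp_apply)
  next
    case 2
    \<comment> \<open>This relation is not among the defining ones; it follows from the one for
      \<open>x_i\<close> on multiplying by \<open>s_i\<close> from both sides.\<close>
    have "eqv [gS i, gX (Suc i)] [gS i, gX (Suc i), gS i, gS i]"
      using eqv_left[OF eqv_sym[OF eqv_s_sq[OF i]], of "[gS i, gX (Suc i)]"] i by simp
    also have "eqv \<dots> [gS i, gS i, gX i, gS i]"
      using eqv_cong[OF eqv_sym[OF eqv_s_x[OF i]], of "[gS i]" "[gS i]"] i by simp
    also have "eqv \<dots> [gX i, gS i]"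
      using eqv_right[OF eqv_s_sq[OF i], of "[gX i, gS i]"] i by simp
    finally show ?thesis using 2 by (simp add: tp_apply)
  next
    case 3
    thus ?thesis using J_rel[OF s_x_comm[of i n j]] i j
      by (intro eqvI[of _ _ 1 0]) (auto simp: W_Cons W_Nil lw_0 tp_apply)
  qed
qed

lemma slide:
  assumes "\<And>y. y \<in> set ys \<Longrightarrow> eqv [l, h y] [h' y, l]" "l \<in> sergeev_gens n"
  shows "eqv (l # map h ys) (map h' ys @ [l])"
  using assms
proof (induction ys)
  case Nil
  thus ?case by (simp add: eqv_refl)
next
  case (Cons y ys)
  have g: "h' y \<in> sergeev_gens n" using eqv_gens(2)[OF Cons.prems(1)[of y]] by simp
  have b: "set (map h ys) \<subseteq> sergeev_gens n" using eqv_gens(1)[OF Cons.prems(1)] by auto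
  have "eqv (l # map h (y # ys)) (h' y # l # map h ys)"
    using eqv_right[OF Cons.prems(1)[of y] b] by simp
  also have "eqv \<dots> (h' y # map h' ys @ [l])" using Cons g by (intro eqv_Cons) auto
  finally show ?case by simp
qed

lemma eqv_rearrange:
  assumes "\<And>i j. i \<in> A \<Longrightarrow> j \<in> A \<Longrightarrow> eqv [h i, h j] [h j, h i]"
  shows "mset xs = mset ys \<Longrightarrow> set xs \<subseteq> A \<Longrightarrow> eqv (map h xs) (map h ys)"
proof (induction xs arbitrary: ys)
  case Nil
  thus ?case by (simp add: eqv_refl)
next
  case (Cons x xs)
  have "x \<in> set ys" using Cons.prems(1) by (metis list.set_intros(1) mset_eq_setD)
  then obtain ys1 ys2 where ys: "ys = ys1 @ x # ys2" by (meson split_list)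
  have m: "mset xs = mset (ys1 @ ys2)" using Cons.prems(1) by (simp add: ys)
  have sA: "set ys \<subseteq> A" using Cons.prems by (metis mset_eq_setD)
  have gA: "h i \<in> sergeev_gens n" if "i \<in> A" for i using eqv_gens(1)[OF assms[OF that that]] by simp
  have "eqv (h x # map h xs) (h x # map h (ys1 @ ys2))"
    using Cons.IH[OF m] Cons.prems(2) gA by (intro eqv_Cons) auto
  also have "h x # map h (ys1 @ ys2) = (h x # map h ys1) @ map h ys2" by simp
  also have "eqv ((h x # map h ys1) @ map h ys2) ((map h ys1 @ [h x]) @ map h ys2)"
    by (intro eqv_right slide assms) (use sA gA Cons.prems(2) in \<open>auto simp: ys\<close>)
  finally show ?case by (simp add: ys)
qed

lemma eqv_xs: "mset xs = mset ys \<Longrightarrow> set xs \<subseteq> {1..n} \<Longrightarrow> eqv (map gX xs) (map gX ys)"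
  by (rule eqv_rearrange[of "{1..n}"]) (auto intro: eqv_xx)
lemma eqv_cs: "mset xs = mset ys \<Longrightarrow> set xs \<subseteq> {1..n} \<Longrightarrow> eqv (map gC xs) (map gC ys)"
  by (rule eqv_rearrange[of "{1..n}"]) (auto intro: eqv_cc)

lemma eqv_Clifford:
  "set cs \<subseteq> {1..n} \<Longrightarrow> \<exists>S\<subseteq>{1..n}. eqv (map gC cs) (map gC (sorted_list_of_set S))"
proof (induction "length cs" arbitrary: cs rule: less_induct)
  case less
  show ?case
  proof (cases "distinct cs")
    case True
    have "mset cs = mset (sorted_list_of_set (set cs))" by (simp add: sorted_list_of_set_sort_remdups distinct_remdups_id[OF True])
    thus ?thesis using less.prems by (intro exI[of _ "set cs"] conjI eqv_cs)
  next
    case False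
    then obtain a b c x where cs: "cs = a @ [x] @ b @ [x] @ c" using not_distinct_decomp by blast
    have x: "1 \<le> x" "x \<le> n" and abc: "set (a @ b @ c) \<subseteq> {1..n}" using less.prems by (auto simp: cs)
    have "eqv (map gC cs) (map gC ([x, x] @ (a @ b @ c)))"
      using less.prems by (intro eqv_cs) (auto simp: cs)
    also have "map gC ([x, x] @ (a @ b @ c)) = [gC x, gC x] @ map gC (a @ b @ c)" by simp
    also have "eqv \<dots> ([] @ map gC (a @ b @ c))"
      using eqv_c_sq[OF x] abc by (intro eqv_right) auto
    finally have 1: "eqv (map gC cs) (map gC (a @ b @ c))" by simp
    obtain S where "S \<subseteq> {1..n}" "eqv (map gC (a @ b @ c)) (map gC (sorted_list_of_set S))"
      using less.hyps[of "a @ b @ c"] abc by (auto simp: cs)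
    thus ?thesis using eqv_trans[OF 1] by blast
  qed
qed

lemma eqv_normal_form:
  "set u \<subseteq> sergeev_gens n \<Longrightarrow> \<exists>xs cs ss. set xs \<subseteq> {1..n} \<and> set cs \<subseteq> {1..n} \<and> set ss \<subseteq> {1..<n} \<and>
    eqv u (map gX xs @ map gC cs @ map gS ss)"
proof (induction u)
  case Nil
  show ?case by (intro exI[of _ "[]"]) (simp add: eqv_refl)
next
  case (Cons l u)
  then obtain xs cs ss where *: "set xs \<subseteq> {1..n}" "set cs \<subseteq> {1..n}" "set ss \<subseteq> {1..<n}"
    "eqv u (map gX xs @ map gC cs @ map gS ss)" by auto
  have l: "l \<in> sergeev_gens n" using Cons.prems by simp
  have 0: "eqv (l # u) (l # map gX xs @ map gC cs @ map gS ss)" by (rule eqv_Cons[OF *(4) l])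
  have gc: "set (map gC cs) \<subseteq> sergeev_gens n" and gs: "set (map gS ss) \<subseteq> sergeev_gens n" and gx: "set (map gX xs) \<subseteq> sergeev_gens n"
    using * by auto
  show ?case
  proof (cases l)
    case (gX i)
    thus ?thesis using 0 * l by (intro exI[of _ "i # xs"] exI[of _ cs] exI[of _ ss]) auto
  next
    case (gC i)
    have "eqv (l # map gX xs) (map gX xs @ [l])"
      by (rule slide[OF _ l]) (use eqv_cx[of i] *(1) gC l in auto)
    from eqv_right[OF this, of "map gC cs @ map gS ss"] gc gs
    have "eqv (l # map gX xs @ map gC cs @ map gS ss) (map gX xs @ map gC (i # cs) @ map gS ss)"
      using gC by simp
    thus ?thesis using eqv_trans[OF 0] * l gC by (intro exI[of _ xs] exI[of _ "i # cs"] exI[of _ ss]) auto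
  next
    case (gS i)
    have i: "1 \<le> i" "i < n" using l gS by auto
    have t: "tp i j \<in> {1..n}" if "j \<in> {1..n}" for j using that i by (auto simp: tp_apply)
    have 1: "eqv (l # map gX xs) (map (\<lambda>j. gX (tp i j)) xs @ [l])"
      by (rule slide[OF _ l]) (use eqv_sx[OF i] *(1) gS in auto)
    have 2: "eqv (l # map gC cs) (map (\<lambda>j. gC (tp i j)) cs @ [l])"
      by (rule slide[OF _ l]) (use eqv_sc[OF i] *(2) gS in auto)
    have "eqv ((l # map gX xs) @ map gC cs @ map gS ss) ((map (\<lambda>j. gX (tp i j)) xs @ [l]) @ map gC cs @ map gS ss)"
      by (rule eqv_right[OF 1]) (use gc gs in auto)
    also have "eqv ((map (\<lambda>j. gX (tp i j)) xs @ [l]) @ map gC cs @ map gS ss)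
        (map (\<lambda>j. gX (tp i j)) xs @ (map (\<lambda>j. gC (tp i j)) cs @ [l]) @ map gS ss)"
      using eqv_cong[OF 2, of "map (\<lambda>j. gX (tp i j)) xs" "map gS ss"] eqv_gens(2)[OF 1] gs by simp
    finally have "eqv (l # map gX xs @ map gC cs @ map gS ss)
        (map gX (map (tp i) xs) @ map gC (map (tp i) cs) @ map gS (i # ss))"
      using gS by (simp add: comp_def)
    moreover have "set (map (tp i) xs) \<subseteq> {1..n}" "set (map (tp i) cs) \<subseteq> {1..n}" using t * by (auto simp del: atLeastAtMost_iff)
    moreover have "set (i # ss) \<subseteq> {1..<n}" using * i by auto
    ultimately show ?thesis using eqv_trans[OF 0] by blast
  qed
qed

text \<open>Two words in the letters \<open>gS\<close> with the same permutation are equivalent: every word in the first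
  \<open>m\<close> letters can be brought to the form \<open>k, k + 1, \<dots>, m\<close> followed by a word in the first \<open>m - 1\<close>
  letters, and \<open>k\<close> is read off as the image of \<open>m + 1\<close>.\<close>

definition seqv :: "nat list \<Rightarrow> nat list \<Rightarrow> bool" where
  "seqv l l' \<longleftrightarrow> eqv (map gS l) (map gS l') \<and> pw l = pw l'"

lemma gS_gens: "set l \<subseteq> {1..<n} \<Longrightarrow> set (map gS l) \<subseteq> sergeev_gens n"
  by (auto simp: subset_iff)

lemma seqv_trans [trans]: "seqv u v \<Longrightarrow> seqv v w \<Longrightarrow> seqv u w"
  unfolding seqv_def using eqv_trans[of "map gS u" "map gS v" "map gS w"] by simp
lemma seqv_refl: "set l \<subseteq> {1..<n} \<Longrightarrow> seqv l l"
  unfolding seqv_def using eqv_refl[OF gS_gens] by simp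
lemma seqv_cong: "seqv u v \<Longrightarrow> set a \<subseteq> {1..<n} \<Longrightarrow> set b \<subseteq> {1..<n} \<Longrightarrow> seqv (a @ u @ b) (a @ v @ b)"
  using eqv_cong[of "map gS u" "map gS v" "map gS a" "map gS b"] gS_gens[of a] gS_gens[of b]
  by (simp add: seqv_def pw_append)

lemma seqv_sq: "i \<in> {1..<n} \<Longrightarrow> seqv [i, i] []"
  using eqv_s_sq by (auto simp: seqv_def fun_eq_iff)
lemma seqv_braid: "1 \<le> i \<Longrightarrow> Suc i < n \<Longrightarrow> seqv [Suc i, i, Suc i] [i, Suc i, i]"
  using eqv_sym[OF eqv_braid[of i]] by (auto simp: seqv_def fun_eq_iff tp_apply)
lemma seqv_slide:
  assumes "i \<in> {1..<n}" "set ys \<subseteq> {1..<n}" "\<And>y. y \<in> set ys \<Longrightarrow> Suc i < y \<or> Suc y < i"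
  shows "seqv (i # ys) (ys @ [i])"
proof -
  have "eqv (gS i # map gS ys) (map gS ys @ [gS i])"
    by (rule slide) (use assms eqv_s_comm[of i] in \<open>auto simp: subset_iff\<close>)
  moreover have "tp i \<circ> pw ys = pw ys \<circ> tp i"
    using assms(3)
  proof (induction ys)
    case (Cons y ys)
    have "tp i \<circ> tp y = tp y \<circ> tp i" using Cons.prems[of y] by (auto simp: fun_eq_iff tp_apply)
    hence "tp i \<circ> pw (y # ys) = tp y \<circ> (tp i \<circ> pw ys)" by (simp add: fun_eq_iff)
    also have "tp i \<circ> pw ys = pw ys \<circ> tp i" by (rule Cons.IH) (rule Cons.prems, simp)
    finally show ?case by (simp add: comp_assoc)
  qed simp
  ultimately show ?thesis by (simp add: seqv_def pw_append)
qed

lemma seqv_staircase: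
  "Suc m \<le> n \<Longrightarrow> set l \<subseteq> {1..<Suc m} \<Longrightarrow> \<exists>k t. k \<in> {1..Suc m} \<and> set t \<subseteq> {1..<m} \<and> seqv l ([k..<Suc m] @ t)"
proof (induction l)
  case Nil
  have "seqv [] ([Suc m..<Suc m] @ [])" by (simp add: seqv_refl)
  moreover have "Suc m \<in> {1..Suc m}" "set [] \<subseteq> {1..<m}" by auto
  ultimately show ?case by blast
next
  case (Cons i l)
  then obtain k t where *: "k \<in> {1..Suc m}" "set t \<subseteq> {1..<m}" "seqv l ([k..<Suc m] @ t)" by auto
  have i: "1 \<le> i" "i \<le> m" "m < n" using Cons.prems by auto
  have t: "set t \<subseteq> {1..<n}" using *(2) i by auto
  have 0: "seqv (i # l) (i # [k..<Suc m] @ t)" using seqv_cong[OF *(3), of "[i]" "[]"] i by simp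
  consider "Suc i < k" | "Suc i = k" | "i = k" | "k < i" by linarith
  thus ?case
  proof cases
    case 1
    have "seqv (i # [k..<Suc m]) ([k..<Suc m] @ [i])"
      by (rule seqv_slide) (use 1 i *(1) in auto)
    from seqv_trans[OF 0 seqv_cong[OF this, of "[]" t, simplified append_Nil append_Cons append_assoc]] t
    have "seqv (i # l) ([k..<Suc m] @ (i # t))" by simp
    moreover have "set (i # t) \<subseteq> {1..<m}" using *(1,2) i 1 by auto
    ultimately show ?thesis using *(1) by blast
  next
    case 2
    have e: "[i..<Suc m] = i # [k..<Suc m]" using 2 i by (simp add: upt_conv_Cons del: upt_Suc)
    have "seqv (i # l) ([i..<Suc m] @ t)" unfolding e append_Cons by (rule 0)
    thus ?thesis using *(2) i by (intro exI[of _ i] exI[of _ t]) auto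
  next
    case 3
    have e: "[k..<Suc m] = i # [Suc i..<Suc m]" using 3 i by (simp add: upt_conv_Cons del: upt_Suc)
    have 1: "seqv ([] @ [i, i] @ ([Suc i..<Suc m] @ t)) ([] @ [] @ ([Suc i..<Suc m] @ t))"
      by (rule seqv_cong[OF seqv_sq]) (use i t in auto)
    have "i # [k..<Suc m] @ t = [] @ [i, i] @ ([Suc i..<Suc m] @ t)" unfolding e by (simp only: append_Cons append_Nil)
    hence "seqv (i # l) ([] @ [i, i] @ ([Suc i..<Suc m] @ t))" using 0 by (simp only:)
    from seqv_trans[OF this 1] have "seqv (i # l) ([Suc i..<Suc m] @ t)" by (simp only: append_Nil)
    moreover have "Suc i \<in> {1..Suc m}" using i by auto
    ultimately show ?thesis using *(2) by blast
  next
    case 4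
    \<comment> \<open>Now \<open>i = j + 1\<close> lies inside the staircase. It slides up to
      \<open>j, j + 1\<close>, the braid relation turns \<open>j + 1, j, j + 1\<close> into
      \<open>j, j + 1, j\<close>, and the last \<open>j\<close> slides out to the right and joins
      \<open>t\<close>.\<close>
    define j where "j = i - 1"
    have j: "Suc j = i" "k \<le> j" "1 \<le> j" "Suc j \<le> m" using 4 *(1) i by (auto simp: j_def)
    have e: "[k..<Suc m] = [k..<j] @ [j, Suc j] @ [Suc (Suc j)..<Suc m]"
    proof -
      have "[k..<Suc m] = [k..<j] @ [j..<Suc m]" 
      proof -
        have "j + (Suc m - j) = Suc m" using j by simp
        thus ?thesis using upt_add_eq_append[of k j "Suc m - j"] j(2) by (simp only:)
      qed
      also have "[j..<Suc m] = j # Suc j # [Suc (Suc j)..<Suc m]"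
        using j by (simp add: upt_conv_Cons del: upt_Suc)
      finally show ?thesis by simp
    qed
    let ?u = "[Suc (Suc j)..<Suc m]"
    have su: "set ?u \<subseteq> {1..<n}" using i j by auto
    have sk: "set [k..<j] \<subseteq> {1..<n}" using i j *(1) by auto
    have "seqv ((i # [k..<j]) @ ([j, Suc j] @ ?u @ t)) (([k..<j] @ [i]) @ ([j, Suc j] @ ?u @ t))"
      using seqv_cong[OF seqv_slide[of i "[k..<j]"], of "[]" "[j, Suc j] @ ?u @ t"] sk su t i j by auto
    also have "([k..<j] @ [i]) @ ([j, Suc j] @ ?u @ t) = [k..<j] @ [Suc j, j, Suc j] @ (?u @ t)" using j by simp
    also have "seqv ([k..<j] @ [Suc j, j, Suc j] @ (?u @ t)) ([k..<j] @ [j, Suc j, j] @ (?u @ t))"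
      using sk su t i j by (intro seqv_cong seqv_braid) auto
    also have "[k..<j] @ [j, Suc j, j] @ (?u @ t) = ([k..<j] @ [j, Suc j]) @ (j # ?u) @ t" by simp
    also have "seqv (([k..<j] @ [j, Suc j]) @ (j # ?u) @ t) (([k..<j] @ [j, Suc j]) @ (?u @ [j]) @ t)"
      using sk su t i j by (intro seqv_cong seqv_slide) auto
    also have "([k..<j] @ [j, Suc j]) @ (?u @ [j]) @ t = [k..<Suc m] @ (j # t)" by (simp add: e del: upt_Suc)
    finally have "seqv (i # [k..<Suc m] @ t) ([k..<Suc m] @ (j # t))" by (simp add: e del: upt_Suc)
    hence "seqv (i # l) ([k..<Suc m] @ (j # t))" by (rule seqv_trans[OF 0])
    moreover have "set (j # t) \<subseteq> {1..<m}" using *(2) j by auto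
    ultimately show ?thesis using *(1) by blast
  qed
qed

lemma pw_staircase: "k \<le> m \<Longrightarrow> pw [k..<m] m = k"
proof (induction m rule: dec_induct)
  case (step m)
  have "[k..<Suc m] = [k..<m] @ [m]" using step by simp
  thus ?case using step by (simp add: pw_append tp_apply del: upt_Suc)
qed simp

lemma seqv_Coxeter:
  "m \<le> n \<Longrightarrow> set l \<subseteq> {1..<m} \<Longrightarrow> set l' \<subseteq> {1..<m} \<Longrightarrow> pw l = pw l' \<Longrightarrow> eqv (map gS l) (map gS l')"
proof (induction m arbitrary: l l')
  case 0
  thus ?case by (simp add: eqv_refl)
next
  case (Suc m)
  obtain k t where k: "k \<in> {1..Suc m}" "set t \<subseteq> {1..<m}" "seqv l ([k..<Suc m] @ t)"
    using seqv_staircase[OF Suc.prems(1,2)] by blast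
  obtain k' t' where k': "k' \<in> {1..Suc m}" "set t' \<subseteq> {1..<m}" "seqv l' ([k'..<Suc m] @ t')"
    using seqv_staircase[OF Suc.prems(1,3)] by blast
  have fx: "pw t (Suc m) = Suc m" if "set t \<subseteq> {1..<m}" for t
    using permutes_not_in[OF pw_permutes[OF that], of "Suc m"] by simp
  have "pw l (Suc m) = k" "pw l' (Suc m) = k'"
    using k k' fx pw_staircase[of k "Suc m"] pw_staircase[of k' "Suc m"]
    by (simp_all add: seqv_def pw_append del: upt_Suc)
  hence kk: "k = k'" using Suc.prems(4) by simp
  have "pw [k..<Suc m] \<circ> pw t = pw [k..<Suc m] \<circ> pw t'"
    using k(3) k'(3) Suc.prems(4) by (simp add: seqv_def pw_append kk del: upt_Suc)
  hence "(pw (rev [k..<Suc m]) \<circ> pw [k..<Suc m]) \<circ> pw t = (pw (rev [k..<Suc m]) \<circ> pw [k..<Suc m]) \<circ> pw t'"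
    by (simp only: comp_assoc)
  hence "pw t = pw t'" unfolding pw_rev by simp
  hence "eqv (map gS t) (map gS t')" using Suc.IH[of t t'] k k' Suc.prems(1) by simp
  hence "eqv (map gS ([k..<Suc m] @ t)) (map gS ([k..<Suc m] @ t'))"
    unfolding map_append using k(1) Suc.prems(1) by (intro eqv_left) auto
  thus ?case using k(3) k'(3) eqv_trans eqv_sym unfolding seqv_def kk by blast
qed

text \<open>\<open>g\<close> is monic of degree \<open>d\<close>, so \<open>x_1^d\<close> is
  congruent to a combination of lower powers.\<close>

lemma null_gX_1: "null (replicate d (gX 1))"
proof -
  have t: "gX 1 \<in> sergeev_gens n" using n_pos by simp
  have x: "xdeg (replicate k (gX 1)) = k" for k by (induction k) auto
  have s: "set (replicate k (gX 1)) \<subseteq> sergeev_gens n" for k using t by auto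
  let ?r = "\<Sum>k<d. Poly_Mapping.single (Word (replicate k (gX 1))) (coeff g k)"
  have e: "Poly_Mapping.single 0 c * gx 1 ^ k = Poly_Mapping.single (Word (replicate k (gX 1))) c" for c :: 'f and k
    unfolding W_replicate[symmetric] W_def zero_free_word_def by (simp add: mult_single plus_free_word_def)
  have "gpoly = ?r + W (replicate d (gX 1))"
    unfolding gpoly_def degree_g e lessThan_Suc_atMost[symmetric] sum.lessThan_Suc lead_g W_def ..
  hence "W (replicate d (gX 1)) - (- ?r) \<in> J" using J_gpoly by (simp add: algebra_simps)
  moreover have "- ?r \<in> lw d" by (intro lw_uminus lw_sum lw_single s) (simp add: x del: One_nat_def)
  ultimately have "W (replicate d (gX 1)) \<in> lowJ d" unfolding lowJ_def by blast
  thus ?thesis unfolding null_def x using s by blast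
qed

text \<open>Up to words of lower degree, \<open>x_(i+1)^d\<close> is the conjugate of
  \<open>x_i^d\<close> by \<open>s_i\<close>.\<close>

lemma null_gX: "1 \<le> i \<Longrightarrow> i \<le> n \<Longrightarrow> null (replicate d (gX i))"
proof (induction i rule: dec_induct)
  case base
  show ?case by (rule null_gX_1)
next
  case (step i)
  have i: "1 \<le> i" "i < n" using step by auto
  have g: "set (replicate k (gX j)) \<subseteq> sergeev_gens n" if "j \<in> {1..n}" for k j using that by auto
  have 1: "eqv (gS i # map gX (replicate d (Suc i))) (map (\<lambda>j. gX (tp i j)) (replicate d (Suc i)) @ [gS i])"
    by (rule slide) (use eqv_sx[OF i, of "Suc i"] i in auto)
  have "eqv ([] @ replicate d (gX (Suc i))) ([gS i, gS i] @ replicate d (gX (Suc i)))"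
    by (rule eqv_right[OF eqv_sym[OF eqv_s_sq[OF i]]]) (use g i in auto)
  also have "eqv ([gS i, gS i] @ replicate d (gX (Suc i))) ([gS i] @ replicate d (gX i) @ [gS i])"
    using eqv_Cons[OF 1, of "gS i"] i by (simp add: tp_apply)
  finally have "eqv (replicate d (gX (Suc i))) ([gS i] @ replicate d (gX i) @ [gS i])" by simp
  thus ?case by (rule null_eqv) (rule null_cong, use step i in auto)
qed

lemma null_xs:
  assumes "set xs \<subseteq> {1..n}" "d \<le> count (mset xs) i"
  shows "null (map gX xs)"
proof -
  have "i \<in> set xs" using assms(2) d_pos by (metis count_eq_zero_iff in_multiset_in_set le_zero_eq not_numeral_le_zero)
  hence i: "1 \<le> i" "i \<le> n" using assms(1) by auto
  have "replicate_mset d i \<subseteq># mset xs" using assms(2) by (simp only: count_le_replicate_mset_subset_eq)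
  then obtain M where M: "mset xs = replicate_mset d i + M" by (meson subset_mset.le_iff_add)
  obtain zs where zs: "mset zs = M" using ex_mset by blast
  have e: "mset xs = mset (replicate d i @ zs)" by (simp add: M zs)
  have z: "set zs \<subseteq> {1..n}" using mset_eq_setD[OF e] assms(1) by auto
  have "null ([] @ replicate d (gX i) @ map gX zs)"
    by (rule null_cong[OF null_gX[OF i]]) (use z in auto)
  thus ?thesis using null_eqv[OF eqv_xs[OF e assms(1)]] by simp
qed

section \<open>The monomial words and their span\<close>

primrec xlist :: "nat \<Rightarrow> (nat \<Rightarrow> nat) \<Rightarrow> nat list" where
  "xlist 0 a = []"
| "xlist (Suc m) a = xlist m a @ replicate (a (Suc m)) (Suc m)"

lemma count_xlist: "count (mset (xlist m a)) j = (if j \<in> {1..m} then a j else 0)"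
  by (induction m) (auto simp: le_Suc_eq)
lemma set_xlist: "set (xlist m a) \<subseteq> {1..m}" by (induction m) auto
lemma length_xlist: "length (xlist m a) = exdeg m a" by (induction m) (simp_all add: exdeg_def)

text \<open>Any word for \<open>w\<close> serves, since all of them are equivalent by
  \<open>seqv_Coxeter\<close>.\<close>

definition sword :: "(nat \<Rightarrow> nat) \<Rightarrow> nat list" where
  "sword w = (SOME l. set l \<subseteq> {1..<n} \<and> pw l = w)"

lemma sword: "w permutes {1..n} \<Longrightarrow> set (sword w) \<subseteq> {1..<n}" "w permutes {1..n} \<Longrightarrow> pw (sword w) = w"
proof -
  assume "w permutes {1..n}"
  hence "\<exists>l. set l \<subseteq> {1..<n} \<and> pw l = w" using permutes_pw by metis
  hence "set (sword w) \<subseteq> {1..<n} \<and> pw (sword w) = w" unfolding sword_def by (rule someI_ex)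
  thus "set (sword w) \<subseteq> {1..<n}" "pw (sword w) = w" by auto
qed

definition mword :: "idx \<Rightarrow> sergeev_gen list" where
  "mword = (\<lambda>(a, S, w). map gX (xlist n a) @ map gC (sorted_list_of_set S) @ map gS (sword w))"

lemma xdeg_maps: "xdeg (map gX xs) = length xs" "xdeg (map gC xs) = 0" "xdeg (map gS xs) = 0"
  by (induction xs) auto

lemma mword_gens:
  assumes "b \<in> Bs"
  shows "set (mword b) \<subseteq> sergeev_gens n" "xdeg (mword b) = exdeg n (fst b)"
proof -
  obtain a S w where b: "b = (a, S, w)" by (cases b)
  have S: "S \<subseteq> {1..n}" "w permutes {1..n}" using assms by (auto simp: b Bs_def)
  have "finite S" using S(1) finite_subset by blast
  thus "set (mword b) \<subseteq> sergeev_gens n" using S set_xlist[of n a] sword(1)[OF S(2)] by (auto simp: b mword_def)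
  show "xdeg (mword b) = exdeg n (fst b)" by (simp add: b mword_def xdeg_maps length_xlist)
qed

lemma lam_s_word: "ap (wop lam (map gS l)) v0 = bas (\<lambda>_. 0, {}, pw l)"
proof (induction l)
  case Nil
  show ?case by (simp add: v0_def id_def)
next
  case (Cons i l)
  have "ap (wop lam (map gS (i # l))) v0 = ap (opt i) (ap (wop lam (map gS l)) v0)" by simp
  also have "\<dots> = bas (\<lambda>_. 0, {}, pw (i # l))" unfolding Cons by (simp add: comp_def)
  finally show ?case .
qed

lemma lam_c_word:
  "sorted_wrt (<) cs \<Longrightarrow> ap (wop lam (map gC cs)) (bas (\<lambda>_. 0, {}, w)) = (bas (\<lambda>_. 0, set cs, w) :: idx \<Rightarrow>\<^sub>0 'f)"
proof (induction cs)
  case (Cons c cs)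
  have "{j \<in> set cs. j < c} = {}" "c \<notin> set cs" using Cons.prems by auto
  hence "nlt (set cs) c = 0" "tog (set cs) c = insert c (set cs)" by (auto simp: nlt_def)
  thus ?case using Cons by simp
qed simp

lemma lam_x_word:
  "\<forall>j. count (mset xs) j < d \<Longrightarrow>
    ap (wop lam (map gX xs)) (bas (\<lambda>_. 0, S, w)) = (bas (count (mset xs), S, w) :: idx \<Rightarrow>\<^sub>0 'f)"
proof (induction xs)
  case Nil
  have "count (mset []) = (\<lambda>_ :: nat. 0)" by (rule ext) simp
  thus ?case by (simp only: list.simps wop_simps ap_simps)
next
  case (Cons x xs)
  have c: "count (mset (x # xs)) = (count (mset xs))(x := Suc (count (mset xs) x))" by (auto simp: fun_eq_iff)
  have lt: "\<forall>j. count (mset xs) j < d"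
  proof
    fix j
    have "count (mset (x # xs)) j < d" using Cons.prems by blast
    thus "count (mset xs) j < d" unfolding c by (cases "j = x") simp_all
  qed
  have "count (mset (x # xs)) x < d" using Cons.prems by blast
  hence ne: "count (mset xs) x \<noteq> d - 1" unfolding c by simp
  have "ap (wop lam (map gX (x # xs))) V = ap (lamx x) (ap (wop lam (map gX xs)) V)" for V by simp
  thus ?case unfolding c using Cons.IH[OF lt] ne by (simp only: lamx_bas if_False)
qed

text \<open>The symbols of the monomial words send \<open>v0\<close> to distinct basis vectors, with
  neither sign nor correction. This is the linear independence that keeps a leading term from
  vanishing.\<close>

lemma lam_mword:
  assumes "b \<in> Bs"
  shows "ap (wop lam (mword b)) v0 = bas b"
proof -
  obtain a S w where b: "b = (a, S, w)" by (cases b)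
  have a: "\<And>j. a j < d" "\<And>j. j \<notin> {1..n} \<Longrightarrow> a j = 0" and S: "S \<subseteq> {1..n}" and w: "w permutes {1..n}"
    using assms by (auto simp: b Bs_def)
  have fS: "finite S" using S finite_subset by blast
  have c: "count (mset (xlist n a)) = a" using a(2) by (auto simp: fun_eq_iff count_xlist)
  have 1: "ap (wop lam (map gS (sword w))) v0 = bas (\<lambda>_. 0, {}, w)" by (simp add: lam_s_word sword(2)[OF w])
  have 2: "ap (wop lam (map gC (sorted_list_of_set S))) (bas (\<lambda>_. 0, {}, w)) = (bas (\<lambda>_. 0, S, w) :: idx \<Rightarrow>\<^sub>0 'f)"
    using lam_c_word[of "sorted_list_of_set S" w] fS by simp
  have 3: "ap (wop lam (map gX (xlist n a))) (bas (\<lambda>_. 0, S, w)) = (bas (a, S, w) :: idx \<Rightarrow>\<^sub>0 'f)"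
    using lam_x_word[of "xlist n a" S w] a(1) unfolding c by simp
  show ?thesis unfolding b mword_def prod.case wop_simps ap_simps 1 2 3 ..
qed

lemma eqv_mword:
  assumes "set u \<subseteq> sergeev_gens n"
  shows "null u \<or> (\<exists>b\<in>Bs. exdeg n (fst b) = xdeg u \<and> eqv u (mword b))"
proof -
  obtain xs cs ss where *: "set xs \<subseteq> {1..n}" "set cs \<subseteq> {1..n}" "set ss \<subseteq> {1..<n}"
    "eqv u (map gX xs @ map gC cs @ map gS ss)" using eqv_normal_form[OF assms] by blast
  have gc: "set (map gC cs) \<subseteq> sergeev_gens n" and gs: "set (map gS ss) \<subseteq> sergeev_gens n"
    using * by auto
  show ?thesis
  proof (cases "\<exists>i. d \<le> count (mset xs) i")
    case True
    then obtain i where "d \<le> count (mset xs) i" by blast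
    from null_cong[OF null_xs[OF *(1) this], of "[]" "map gC cs @ map gS ss"] gc gs
    have "null (map gX xs @ map gC cs @ map gS ss)" by simp
    thus ?thesis using null_eqv[OF *(4)] by blast
  next
    case False
    define a where "a = count (mset xs)"
    have a: "a j < d" "j \<notin> {1..n} \<Longrightarrow> a j = 0" for j
      using False *(1) by (auto simp: a_def not_le count_eq_zero_iff simp del: atLeastAtMost_iff)
    obtain S where S: "S \<subseteq> {1..n}" "eqv (map gC cs) (map gC (sorted_list_of_set S))"
      using eqv_Clifford[OF *(2)] by blast
    have w: "pw ss permutes {1..n}" by (rule pw_permutes[OF *(3)])
    have b: "(a, S, pw ss) \<in> Bs" using a S w by (simp add: Bs_def)
    have "mset xs = mset (xlist n a)" by (rule multiset_eqI) (use a(2) in \<open>auto simp: count_xlist a_def\<close>)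
    hence "eqv (map gX xs) (map gX (xlist n a))" using *(1) by (rule eqv_xs)
    moreover have "eqv (map gS ss) (map gS (sword (pw ss)))"
      by (rule seqv_Coxeter[of n]) (use *(3) sword[OF w] in auto)
    ultimately have "eqv (map gX xs @ map gC cs @ map gS ss) (mword (a, S, pw ss))"
      unfolding mword_def prod.case by (intro eqv_append S)
    hence e: "eqv u (mword (a, S, pw ss))" by (rule eqv_trans[OF *(4)])
    hence "xdeg u = exdeg n (fst (a, S, pw ss))" using mword_gens(2)[OF b] by (simp add: eqv_def)
    thus ?thesis using b e by (intro disjI2 bexI[of _ "(a, S, pw ss)"]) auto
  qed
qed

definition Sp :: "nat \<Rightarrow> 'f sergeev_free set" where
  "Sp k = {p. \<exists>q\<in>free_carrier n. p - q \<in> J \<and> (\<forall>w\<in>keys q. \<exists>b\<in>Bl k. letters w = mword b)}"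

lemma Sp_0: "0 \<in> Sp k" unfolding Sp_def using J_0 free_carrier_0 by force
lemma Sp_add: "p \<in> Sp k \<Longrightarrow> q \<in> Sp k \<Longrightarrow> p + q \<in> Sp k"
proof -
  assume "p \<in> Sp k" "q \<in> Sp k"
  then obtain r s where r: "r \<in> free_carrier n" "p - r \<in> J" "\<forall>w\<in>keys r. \<exists>b\<in>Bl k. letters w = mword b"
    and s: "s \<in> free_carrier n" "q - s \<in> J" "\<forall>w\<in>keys s. \<exists>b\<in>Bl k. letters w = mword b"
    unfolding Sp_def by blast
  have "(p + q) - (r + s) \<in> J" using J_add[OF r(2) s(2)] by (simp add: algebra_simps)
  moreover have "\<forall>w\<in>keys (r + s). \<exists>b\<in>Bl k. letters w = mword b" using keys_add[of r s] r(3) s(3) by blast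
  ultimately show ?thesis unfolding Sp_def using free_carrier_add[OF r(1) s(1)] by blast
qed
lemma Sp_const: "p \<in> Sp k \<Longrightarrow> Poly_Mapping.single 0 z * p \<in> Sp k"
proof -
  assume "p \<in> Sp k"
  then obtain r where r: "r \<in> free_carrier n" "p - r \<in> J" "\<forall>w\<in>keys r. \<exists>b\<in>Bl k. letters w = mword b"
    unfolding Sp_def by blast
  let ?z = "Poly_Mapping.single 0 z :: 'f sergeev_free"
  have "?z * p - ?z * r \<in> J" using J_left[OF r(2) free_carrier_const] by (simp add: right_diff_distrib)
  moreover have "keys (?z * r) \<subseteq> keys r" using keys_mult[of ?z r] by (auto split: if_splits)
  ultimately show ?thesis unfolding Sp_def using r free_carrier_mult[OF free_carrier_const r(1), of z] by blast
qed
lemma Sp_sum: "(\<And>i. i \<in> A \<Longrightarrow> h i \<in> Sp k) \<Longrightarrow> sum h A \<in> Sp k"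
  by (induction A rule: infinite_finite_induct) (auto simp: Sp_0 Sp_add)
lemma Sp_mono: "k \<le> l \<Longrightarrow> p \<in> Sp k \<Longrightarrow> p \<in> Sp l"
  unfolding Sp_def using Bl_mono[of k l] by blast
lemma Sp_cong: "p - q \<in> J \<Longrightarrow> q \<in> Sp k \<Longrightarrow> p \<in> Sp k"
proof -
  assume "p - q \<in> J" "q \<in> Sp k"
  then obtain r where r: "r \<in> free_carrier n" "q - r \<in> J" "\<forall>w\<in>keys r. \<exists>b\<in>Bl k. letters w = mword b"
    unfolding Sp_def by blast
  have "p - r \<in> J" using J_add[OF \<open>p - q \<in> J\<close> r(2)] by simp
  thus ?thesis using r unfolding Sp_def by blast
qed
lemma Sp_W: "b \<in> Bl k \<Longrightarrow> e \<in> {1, -1} \<Longrightarrow> e * W (mword b) \<in> Sp k"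
proof -
  assume b: "b \<in> Bl k" and e: "e \<in> {1, -1}"
  have "W (mword b) \<in> Sp k"
    unfolding Sp_def using b J_0 W_carrier[OF mword_gens(1)[of b]] Bl_subset_Bs[of k]
    by (intro CollectI bexI[of _ "W (mword b)"]) (auto simp: W_def)
  moreover have "Poly_Mapping.single 0 (-1) = (- 1 :: 'f sergeev_free)"
    by (metis single_one single_uminus)
  ultimately show ?thesis using Sp_const[of "W (mword b)" k "-1"] e by auto
qed

text \<open>Up to sign and words of lower degree, every word is a monomial word or zero; the
  remainder falls under the induction hypothesis.\<close>

lemma lw_Sp: "p \<in> lw k \<Longrightarrow> p \<in> Sp k"
proof (induction k arbitrary: p)
  case 0
  hence "p = 0" by (auto simp: lw_def)
  thus ?case by (simp add: Sp_0)
next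
  case (Suc k)
  have w: "W u \<in> Sp (Suc k)" if u: "set u \<subseteq> sergeev_gens n" "xdeg u \<le> k" for u
  proof -
    have low: "r \<in> Sp (Suc k)" if "r \<in> lw (xdeg u)" for r
      using Suc.IH[OF lw_mono[OF u(2) that]] by (rule Sp_mono[rotated]) simp
    consider "null u" | b where "b \<in> Bs" "exdeg n (fst b) = xdeg u" "eqv u (mword b)"
      using eqv_mword[OF u(1)] by blast
    thus ?thesis
    proof cases
      case 1
      thus ?thesis using low Sp_cong unfolding null_def lowJ_def by blast
    next
      case (2 b)
      then obtain e r where e: "e \<in> {1, -1}" "r \<in> lw (xdeg u)" "(W u - e * W (mword b)) - r \<in> J"
        unfolding eqv_def lowJ_def by blast
      have "b \<in> Bl (Suc k)" using 2 u by (simp add: Bl_def)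
      hence "e * W (mword b) + r \<in> Sp (Suc k)" by (intro Sp_add Sp_W low e)
      moreover have "W u - (e * W (mword b) + r) \<in> J" using e(3) by (simp add: algebra_simps)
      ultimately show ?thesis using Sp_cong by blast
    qed
  qed
  have "(\<Sum>v\<in>keys p. Poly_Mapping.single 0 (coef p v) * W (letters v)) \<in> Sp (Suc k)"
    by (intro Sp_sum Sp_const w) (use Suc.prems in \<open>auto simp: lw_def free_carrier_def less_Suc_eq_le\<close>)
  moreover have "Poly_Mapping.single 0 (coef p v) * W (letters v) = Poly_Mapping.single v (coef p v)" for v
    by (cases v) (simp add: W_def mult_single)
  ultimately show ?case using free_expansion[of p] by simp
qed

lemma free_carrier_Sp:
  assumes "p \<in> free_carrier n"
  shows "\<exists>q\<in>free_carrier n. p - q \<in> J \<and> (\<forall>w\<in>keys q. \<exists>b\<in>Bs. letters w = mword b)"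
proof -
  have "xdeg (letters w) < Suc (Max (xdeg ` letters ` keys p))" if "w \<in> keys p" for w
    using that by (simp add: less_Suc_eq_le)
  hence "p \<in> lw (Suc (Max (xdeg ` letters ` keys p)))" using assms unfolding lw_def by blast
  from lw_Sp[OF this] show ?thesis using Bl_subset_Bs unfolding Sp_def by blast
qed

text \<open>\<open>p\<close> is replaced by a combination \<open>q\<close> of monomial words modulo
  \<open>J\<close>, and the claim is \<open>q = 0\<close>. Evenness is known for \<open>p\<close>
  only, but \<open>p\<close> and \<open>q\<close> act alike on \<open>v0\<close>, so the leading
  term \<open>F\<close> of \<open>q\<close> shares its coefficients in top degree with
  \<open>p v0\<close>. For the same reason a nonzero coefficient of \<open>F\<close> at a
  representative contradicts the last hypothesis.\<close>

lemma even_central_zero: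
  assumes p: "p \<in> free_carrier n" "\<forall>w\<in>keys p. even (odd_letters w)"
    and c: "\<And>y. y \<in> sergeev_gens n \<Longrightarrow> gen y * p - p * gen y \<in> J" and two: "(2 :: 'f) \<noteq> 0"
    and z: "\<And>\<beta>. \<beta> \<in> hat_colored_partitions d n \<Longrightarrow> coef (ap (evalf opl p) v0) (rep \<beta>) = 0"
  shows "p \<in> J"
proof -
  obtain q where q': "q \<in> free_carrier n" "p - q \<in> J" "\<forall>w\<in>keys q. \<exists>b\<in>Bs. letters w = mword b"
    using free_carrier_Sp[OF p(1)] by blast
  note q = q'(1,2) bspec[OF q'(3)]
  have "q = 0"
  proof (rule ccontr)
    assume "q \<noteq> 0"
    hence ne: "keys q \<noteq> {}" by simp
    define K where "K = Max (xdeg ` letters ` keys q)"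
    have K: "xdeg (letters u) \<le> K" if "u \<in> keys q" for u unfolding K_def using that by (intro Max_ge) auto
    have "K \<in> xdeg ` letters ` keys q" unfolding K_def using ne by (intro Max_in) auto
    then obtain u0 where u0: "u0 \<in> keys q" "xdeg (letters u0) = K" by auto
    obtain b0 where b0: "b0 \<in> Bs" "letters u0 = mword b0" using q(3)[OF u0(1)] by blast
    define F where "F = ap (toppart K q) v0"
    let ?E = "ap (evalf opl p) v0"
    let ?U = "{u \<in> keys q. xdeg (letters u) = K}"
    have "F = (\<Sum>u\<in>?U. scl (coef q u) (ap (wop lam (letters u)) v0))"
      unfolding F_def toppart_def by (simp add: ap_sum_lop)
    hence "coef F b0 = (\<Sum>u\<in>?U. coef q u * coef (ap (wop lam (letters u)) v0) b0)"
      by (simp only: lookup_sum coef_scl)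
    also have "\<dots> = (\<Sum>u\<in>?U. if u = u0 then coef q u else 0)"
    proof (rule sum.cong[OF refl])
      fix u assume "u \<in> ?U"
      then obtain b where b: "b \<in> Bs" "letters u = mword b" using q(3) by blast
      have "ap (wop lam (letters u)) v0 = bas b" unfolding b(2) by (rule lam_mword[OF b(1)])
      moreover have "b = b0 \<longleftrightarrow> u = u0"
      proof
        assume "b = b0"
        thus "u = u0" using b b0 by (metis free_word.collapse)
      next
        assume "u = u0"
        hence "(bas b :: idx \<Rightarrow>\<^sub>0 'f) = bas b0" using lam_mword[OF b(1)] lam_mword[OF b0(1)] b b0 by metis
        hence "coef (bas b :: idx \<Rightarrow>\<^sub>0 'f) b0 = coef (bas b0) b0" by (rule arg_cong)
        thus "b = b0" by (auto simp: lookup_single when_def split: if_splits)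
      qed
      ultimately show "coef q u * coef (ap (wop lam (letters u)) v0) b0 = (if u = u0 then coef q u else 0)"
        by (auto simp: lookup_single when_def)
    qed
    also have "\<dots> = coef q u0" using u0 by (simp add: sum.delta)
    finally have F0: "F \<noteq> 0" using u0(1) by (auto simp: in_keys_iff)
    have FBd: "F \<in> spn (Bd K)" unfolding F_def by (rule toppart_Bd[OF q(1)])
    have "ap (evalf opl (p - q)) v0 = 0" using J_annih[OF q(2)] v0_Bs unfolding annih_def by blast
    hence Eq: "?E = ap (evalf opl q) v0" by (simp add: evalf_diff)
    have "symb K (evalf opl q) (toppart K q)" by (rule symb_eval[OF q(1) K])
    hence D: "ap (evalf opl q) v0 - F \<in> spn (Bl K)"
      using v0_Bl unfolding symb_def low_order_def F_def by fastforce
    have EF: "coef ?E b = coef F b" if "b \<in> Bd K" for b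
    proof -
      have "b \<notin> Bl K" using that by (auto simp: Bl_def Bd_def)
      hence "coef (ap (evalf opl q) v0 - F) b = 0" using D unfolding spn_iff by blast
      thus ?thesis unfolding Eq by (simp add: lookup_minus)
    qed
    have ev: "?E \<in> spn (PE True)" by (rule even_eval[OF p])
    have Feven: "F \<in> spn (PE True)"
      unfolding spn_iff
    proof (intro allI impI)
      fix b assume "b \<notin> PE True"
      hence "coef ?E b = 0" using ev unfolding spn_iff by blast
      show "coef F b = 0"
      proof (cases "b \<in> Bd K")
        case True
        thus ?thesis using EF[OF True] \<open>coef ?E b = 0\<close> by (simp only:)
      next
        case False
        thus ?thesis using FBd unfolding spn_iff by blast
      qed
    qed
    have Fc: "ap (lam y) F = ap (rop y) F" if y: "y \<in> sergeev_gens n" for y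
      unfolding F_def
    proof (rule central_toppart[OF q(1) K y])
      have gy: "gen y \<in> free_carrier n" using y by (intro free_carrier_single) simp
      have "(gen y * p - p * gen y) - (gen y * (p - q) - (p - q) * gen y) \<in> J"
        by (intro J_diff c y J_left J_right q(2) gy)
      moreover have "(gen y * p - p * gen y) - (gen y * (p - q) - (p - q) * gen y) = gen y * q - q * gen y"
        by (simp add: algebra_simps)
      ultimately show "annih (gen y * q - q * gen y)" using J_annih by simp
    qed
    interpret top: central_top d n g F
      by unfold_locales (use FBd Bd_subset_Bs[of K] spn_mono Feven Fc two in blast)+
    obtain \<beta> where b: "\<beta> \<in> hat_colored_partitions d n" "coef F (rep \<beta>) \<noteq> 0"
      using top.detects[OF F0] by blast
    have "rep \<beta> \<in> Bd K" using b(2) FBd unfolding spn_iff by blast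
    thus False using EF z[OF b(1)] b(2) by simp
  qed
  thus ?thesis using q(2) by simp
qed

end

section \<open>Quotient algebras\<close>

lemma ideal_intro:
  fixes R (structure)
  assumes "ring R" "I \<subseteq> carrier R" "\<zero> \<in> I" "\<And>x y. x \<in> I \<Longrightarrow> y \<in> I \<Longrightarrow> x \<oplus> y \<in> I"
    "\<And>x a. x \<in> I \<Longrightarrow> a \<in> carrier R \<Longrightarrow> a \<otimes> x \<in> I" "\<And>x a. x \<in> I \<Longrightarrow> a \<in> carrier R \<Longrightarrow> x \<otimes> a \<in> I"
  shows "ideal I R"
proof -
  interpret ring R by fact
  have inv: "\<ominus> x \<in> I" if "x \<in> I" for x
  proof -
    have "(\<ominus> \<one>) \<otimes> x \<in> I" by (rule assms(5)[OF that]) simp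
    moreover have "(\<ominus> \<one>) \<otimes> x = \<ominus> x" using that assms(2) by (simp add: l_minus subsetD)
    ultimately show ?thesis by simp
  qed
  show ?thesis
  proof (rule idealI[OF assms(1)])
    show "subgroup I (add_monoid R)"
      by (rule add.subgroupI) (use assms inv in auto)
  qed (use assms in auto)
qed

text \<open>The quotient superalgebra copies the operations of the factor ring into a larger record,
  so ring and ideal properties have to be carried from one record to the other.\<close>

lemma ring_cong:
  assumes R: "ring R" and e: "carrier S = carrier R" "monoid.mult S = monoid.mult R" "one S = one R" "zero S = zero R" "add S = add R"
  shows "ring S"
proof -
  interpret R: ring R by fact
  show ?thesis
  proof (rule ringI)
    show "abelian_group S"
    proof (rule abelian_groupI)
      fix x assume "x \<in> carrier S"
      thus "\<exists>y\<in>carrier S. y \<oplus>\<^bsub>S\<^esub> x = \<zero>\<^bsub>S\<^esub>"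
        by (intro bexI[of _ "\<ominus>\<^bsub>R\<^esub> x"]) (simp_all add: e R.l_neg)
    next
      fix x y assume "x \<in> carrier S" "y \<in> carrier S"
      thus "x \<oplus>\<^bsub>S\<^esub> y = y \<oplus>\<^bsub>S\<^esub> x" unfolding e by (rule R.a_comm)
    qed (simp_all add: e R.a_assoc)
    show "monoid S" by (rule monoidI) (simp_all add: e R.m_assoc)
  qed (simp_all add: e R.l_distr R.r_distr)
qed

lemma ideal_cong:
  assumes I: "ideal I R" and e: "carrier S = carrier R" "monoid.mult S = monoid.mult R" "one S = one R" "zero S = zero R" "add S = add R"
  shows "ideal I S"
proof -
  interpret I: ideal I R by fact
  show ?thesis
  proof (rule ideal_intro)
    show "ring S" by (rule ring_cong[OF I.ring_axioms e])
  qed (use I.a_subset I.I_l_closed I.I_r_closed additive_subgroup.zero_closed[OF ideal.axioms(1)[OF I]]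
      additive_subgroup.a_closed[OF ideal.axioms(1)[OF I]] in \<open>auto simp: e\<close>)
qed

lemma quot_ring: "ideal I A \<Longrightarrow> ring (quot_superalgebra A I)"
  by (rule ring_cong[OF ideal.quotient_is_ring]) (simp_all add: quot_superalgebra_def)

lemma quot_carrier: "carrier (quot_superalgebra A I) = (\<lambda>x. I +>\<^bsub>A\<^esub> x) ` carrier A"
  by (auto simp: quot_superalgebra_def FactRing_def A_RCOSETS_def')

lemma quot_hom:
  assumes "ideal I A" "x \<in> carrier A" "y \<in> carrier A"
  shows quot_add: "(I +>\<^bsub>A\<^esub> x) \<oplus>\<^bsub>quot_superalgebra A I\<^esub> (I +>\<^bsub>A\<^esub> y) = I +>\<^bsub>A\<^esub> (x \<oplus>\<^bsub>A\<^esub> y)"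
    and quot_mult: "(I +>\<^bsub>A\<^esub> x) \<otimes>\<^bsub>quot_superalgebra A I\<^esub> (I +>\<^bsub>A\<^esub> y) = I +>\<^bsub>A\<^esub> (x \<otimes>\<^bsub>A\<^esub> y)"
  using ring_hom_add[OF ideal.rcos_ring_hom[OF assms(1)] assms(2,3)]
    ring_hom_mult[OF ideal.rcos_ring_hom[OF assms(1)] assms(2,3)]
  by (simp_all add: quot_superalgebra_def)

lemma quot_one: "ideal I A \<Longrightarrow> \<one>\<^bsub>quot_superalgebra A I\<^esub> = I +>\<^bsub>A\<^esub> \<one>\<^bsub>A\<^esub>"
  using ring_hom_one[OF ideal.rcos_ring_hom, of I A] by (simp add: quot_superalgebra_def)

lemma quot_zero:
  assumes "ideal I A"
  shows "\<zero>\<^bsub>quot_superalgebra A I\<^esub> = I +>\<^bsub>A\<^esub> \<zero>\<^bsub>A\<^esub>"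
proof -
  interpret ideal I A by fact
  show ?thesis
    using ring_hom_zero[OF rcos_ring_hom ring_axioms quotient_is_ring] by (simp add: quot_superalgebra_def)
qed

lemma quot_zero_iff:
  assumes "ideal I A" "x \<in> carrier A"
  shows "I +>\<^bsub>A\<^esub> x = I +>\<^bsub>A\<^esub> \<zero>\<^bsub>A\<^esub> \<longleftrightarrow> x \<in> I"
proof -
  interpret ideal I A by fact
  have "x \<ominus>\<^bsub>A\<^esub> \<zero>\<^bsub>A\<^esub> = x" using assms(2) by (simp add: a_minus_def)
  moreover have "\<zero>\<^bsub>A\<^esub> \<in> carrier A" by simp
  ultimately show ?thesis using quotient_eq_iff_same_a_r_cos[OF assms(1,2), of "\<zero>\<^bsub>A\<^esub>"] by simp
qed

text \<open>If scalars act through multiplication by an element \<open>c\<close>, all cosets in the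
  union that defines scalar multiplication coincide.\<close>

lemma quot_smult:
  assumes I: "ideal I A" and c: "c \<in> carrier A" "\<And>x. x \<in> carrier A \<Longrightarrow> a \<odot>\<^bsub>A\<^esub> x = c \<otimes>\<^bsub>A\<^esub> x"
    and X: "X \<in> carrier (quot_superalgebra A I)"
  shows "a \<odot>\<^bsub>quot_superalgebra A I\<^esub> X = (I +>\<^bsub>A\<^esub> c) \<otimes>\<^bsub>quot_superalgebra A I\<^esub> X"
proof -
  interpret ideal I A by fact
  let ?Q = "quot_superalgebra A I"
  interpret Q: ring ?Q by (rule quot_ring[OF I])
  obtain x where x: "x \<in> carrier A" "X = I +>\<^bsub>A\<^esub> x" using X by (auto simp: quot_carrier)
  have mem: "y \<in> X \<longleftrightarrow> (\<exists>i\<in>I. y = i \<oplus>\<^bsub>A\<^esub> x)" for y by (auto simp: x(2) a_r_coset_def')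
  have "I +>\<^bsub>A\<^esub> (a \<odot>\<^bsub>A\<^esub> y) = (I +>\<^bsub>A\<^esub> c) \<otimes>\<^bsub>?Q\<^esub> X" if "y \<in> X" for y
  proof -
    from iffD1[OF mem that] obtain i where i: "i \<in> I" "y = i \<oplus>\<^bsub>A\<^esub> x" by (rule bexE)
    have ic: "i \<in> carrier A" by (rule subsetD[OF additive_subgroup.a_subset[OF ideal.axioms(1)[OF I]] i(1)])
    have y: "y \<in> carrier A" unfolding i(2) by (rule ring.ring_simprules(1)[OF ideal.axioms(2)[OF I] ic x(1)])
    have "I +>\<^bsub>A\<^esub> i = \<zero>\<^bsub>?Q\<^esub>" unfolding quot_zero[OF I] by (rule iffD2[OF quot_zero_iff[OF I ic] i(1)])
    moreover have "I +>\<^bsub>A\<^esub> y = (I +>\<^bsub>A\<^esub> i) \<oplus>\<^bsub>?Q\<^esub> X"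
      unfolding i(2) x(2) by (rule quot_add[OF I ic x(1), symmetric])
    ultimately have yX: "I +>\<^bsub>A\<^esub> y = X" using Q.l_zero[OF X] by (metis (no_types))
    show ?thesis unfolding c(2)[OF y] quot_mult[OF I c(1) y, symmetric] yX ..
  qed
  moreover have "\<zero>\<^bsub>A\<^esub> \<oplus>\<^bsub>A\<^esub> x \<in> X"
    unfolding mem by (rule bexI[OF refl additive_subgroup.zero_closed[OF ideal.axioms(1)[OF I]]])
  ultimately have "(\<Union>y\<in>X. I +>\<^bsub>A\<^esub> (a \<odot>\<^bsub>A\<^esub> y)) = (I +>\<^bsub>A\<^esub> c) \<otimes>\<^bsub>?Q\<^esub> X" by blast
  thus ?thesis by (simp add: quot_superalgebra_def)
qed

section \<open>Bounding a dimension by linear functionals\<close>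

text \<open>Gaussian elimination: an equation with nonzero coefficient at \<open>u\<close> is solved
  for the unknown \<open>a u\<close> and substituted into the others, whose new coefficients are
  \<open>\<psi>\<close>.\<close>

lemma homogeneous_system:
  fixes \<phi> :: "'b \<Rightarrow> 'v \<Rightarrow> 'f::field"
  assumes "finite H" "finite A" "card H < card A"
  shows "\<exists>a. (\<exists>v\<in>A. a v \<noteq> 0) \<and> (\<forall>\<beta>\<in>H. (\<Sum>v\<in>A. a v * \<phi> \<beta> v) = 0)"
  using assms
proof (induction H arbitrary: A \<phi> rule: finite_induct)
  case empty
  hence "A \<noteq> {}" by auto
  thus ?case by (intro exI[of _ "\<lambda>_. 1"]) auto
next
  case (insert \<beta> H)
  have lt: "card H < card A" using insert by simp
  show ?case
  proof (cases "\<forall>v\<in>A. \<phi> \<beta> v = 0")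
    case True
    obtain a where "\<exists>v\<in>A. a v \<noteq> 0" "\<forall>\<gamma>\<in>H. (\<Sum>v\<in>A. a v * \<phi> \<gamma> v) = 0"
      using insert.IH[OF insert.prems(1) lt, of \<phi>] by blast
    moreover have "(\<Sum>v\<in>A. a v * \<phi> \<beta> v) = 0" using True by (intro sum.neutral) simp
    ultimately show ?thesis by blast
  next
    case False
    then obtain u where u: "u \<in> A" "\<phi> \<beta> u \<noteq> 0" by blast
    define \<psi> where "\<psi> \<gamma> v = \<phi> \<gamma> v - \<phi> \<beta> v / \<phi> \<beta> u * \<phi> \<gamma> u" for \<gamma> v
    have "card H < card (A - {u})" using insert u by simp
    then obtain a where a: "\<exists>v\<in>A - {u}. a v \<noteq> 0" "\<forall>\<gamma>\<in>H. (\<Sum>v\<in>A - {u}. a v * \<psi> \<gamma> v) = 0"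
      using insert.IH[of "A - {u}" \<psi>] insert.prems(1) by blast
    define s where "s = (\<Sum>v\<in>A - {u}. a v * \<phi> \<beta> v)"
    define a' where "a' = a(u := - s / \<phi> \<beta> u)"
    have e: "(\<Sum>v\<in>A. a' v * \<phi> \<gamma> v) = - s / \<phi> \<beta> u * \<phi> \<gamma> u + (\<Sum>v\<in>A - {u}. a v * \<phi> \<gamma> v)" for \<gamma>
    proof -
      have "(\<Sum>v\<in>A - {u}. a' v * \<phi> \<gamma> v) = (\<Sum>v\<in>A - {u}. a v * \<phi> \<gamma> v)"
        by (rule sum.cong) (auto simp: a'_def)
      thus ?thesis using sum.remove[OF insert.prems(1) u(1), of "\<lambda>v. a' v * \<phi> \<gamma> v"] by (simp add: a'_def)
    qed
    have "(\<Sum>v\<in>A. a' v * \<phi> \<gamma> v) = 0" if g: "\<gamma> \<in> H" for \<gamma>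
    proof -
      have t: "a v * \<psi> \<gamma> v = a v * \<phi> \<gamma> v - a v * \<phi> \<beta> v * (\<phi> \<gamma> u / \<phi> \<beta> u)" for v
        unfolding \<psi>_def by (simp add: right_diff_distrib mult.assoc)
      have "0 = (\<Sum>v\<in>A - {u}. a v * \<psi> \<gamma> v)" using a(2) g by simp
      also have "\<dots> = (\<Sum>v\<in>A - {u}. a v * \<phi> \<gamma> v - a v * \<phi> \<beta> v * (\<phi> \<gamma> u / \<phi> \<beta> u))"
        unfolding t ..
      also have "\<dots> = (\<Sum>v\<in>A - {u}. a v * \<phi> \<gamma> v) - s * (\<phi> \<gamma> u / \<phi> \<beta> u)"
        unfolding s_def sum_subtractf sum_distrib_right ..
      finally show ?thesis unfolding e by simp
    qed
    moreover have "(\<Sum>v\<in>A. a' v * \<phi> \<beta> v) = 0" unfolding e using u(2) by (simp add: s_def)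
    moreover have "\<exists>v\<in>A. a' v \<noteq> 0" using a(1) by (auto simp: a'_def)
    ultimately show ?thesis by blast
  qed
qed

text \<open>An independent set larger than \<open>H\<close> would have a nontrivial combination on
  which all functionals vanish. The bound also produces a finite maximal independent set, hence
  finite dimension, on which the meaning of \<open>dim\<close> rests.\<close>

lemma dim_le_card_functionals:
  fixes V :: "('f::field, 'v, 'm) module_scheme" and \<phi> :: "'b \<Rightarrow> 'v \<Rightarrow> 'f"
  assumes vs: "vectorspace class_ring V" and H: "finite H"
    and add: "\<And>\<beta> x y. x \<in> carrier V \<Longrightarrow> y \<in> carrier V \<Longrightarrow> \<phi> \<beta> (x \<oplus>\<^bsub>V\<^esub> y) = \<phi> \<beta> x + \<phi> \<beta> y"
    and smult: "\<And>\<beta> a x. x \<in> carrier V \<Longrightarrow> \<phi> \<beta> (a \<odot>\<^bsub>V\<^esub> x) = a * \<phi> \<beta> x"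
    and inj: "\<And>x. x \<in> carrier V \<Longrightarrow> (\<And>\<beta>. \<beta> \<in> H \<Longrightarrow> \<phi> \<beta> x = 0) \<Longrightarrow> x = \<zero>\<^bsub>V\<^esub>"
  shows "vectorspace.fin_dim class_ring V \<and> vectorspace.dim class_ring V \<le> card H"
proof -
  interpret vectorspace class_ring V by fact
  have z: "\<phi> \<beta> \<zero>\<^bsub>V\<^esub> = 0" for \<beta>
  proof -
    have "\<phi> \<beta> (\<zero>\<^bsub>V\<^esub> \<oplus>\<^bsub>V\<^esub> \<zero>\<^bsub>V\<^esub>) = \<phi> \<beta> \<zero>\<^bsub>V\<^esub> + \<phi> \<beta> \<zero>\<^bsub>V\<^esub>" by (rule add) simp_all
    moreover have "\<zero>\<^bsub>V\<^esub> \<oplus>\<^bsub>V\<^esub> \<zero>\<^bsub>V\<^esub> = \<zero>\<^bsub>V\<^esub>" by simp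
    ultimately have "\<phi> \<beta> \<zero>\<^bsub>V\<^esub> = \<phi> \<beta> \<zero>\<^bsub>V\<^esub> + \<phi> \<beta> \<zero>\<^bsub>V\<^esub>" by (simp only:)
    thus ?thesis by (simp only: add_cancel_right_right)
  qed
  have comb: "lincomb a A \<in> carrier V \<and> \<phi> \<beta> (lincomb a A) = (\<Sum>v\<in>A. a v * \<phi> \<beta> v)"
    if "finite A" "A \<subseteq> carrier V" for a A \<beta>
    using that
  proof (induction A rule: finite_induct)
    case empty
    thus ?case by (simp add: lincomb_def z)
  next
    case (insert x A)
    have s: "a v \<odot>\<^bsub>V\<^esub> v \<in> carrier V" if "v \<in> carrier V" for v using that smult_closed by simp
    have "lincomb a (insert x A) = a x \<odot>\<^bsub>V\<^esub> x \<oplus>\<^bsub>V\<^esub> lincomb a A"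
      unfolding lincomb_def by (rule M.finsum_insert) (use insert s in auto)
    thus ?case using insert s[of x] by (simp add: add smult)
  qed
  have fin_card: "card A \<le> card H" if A: "finite A" "A \<subseteq> carrier V" "lin_indpt A" for A
  proof (rule ccontr)
    assume "\<not> ?thesis"
    hence "card H < card A" by simp
    from homogeneous_system[OF H A(1) this, of \<phi>]
    obtain a v where a: "v \<in> A" "a v \<noteq> 0" "\<forall>\<beta>\<in>H. (\<Sum>v\<in>A. a v * \<phi> \<beta> v) = 0" by blast
    have "lincomb a A = \<zero>\<^bsub>V\<^esub>" by (rule inj) (use comb[OF A(1,2)] a(3) in auto)
    hence "lin_dep A" unfolding lin_dep_def using A(1) a(1,2)
      by (intro exI[of _ A] exI[of _ a] exI[of _ v]) auto
    thus False using A(3) by blast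
  qed
  have li: "finite A \<and> card A \<le> card H" if A: "A \<subseteq> carrier V \<and> lin_indpt A" for A
  proof (cases "finite A")
    case False
    then obtain B where B: "B \<subseteq> A" "finite B" "card B = Suc (card H)" by (meson infinite_arbitrarily_large)
    have "lin_indpt B" by (rule subset_li_is_li[where A = A and B = B]) (use A B(1) in auto)
    thus ?thesis using fin_card[of B] A B by auto
  qed (use fin_card A in blast)
  have e: "{} \<subseteq> carrier V \<and> lin_indpt {}" by (auto simp: lin_dep_def)
  have "\<exists>A. finite A \<and> maximal A (\<lambda>S. S \<subseteq> carrier V \<and> lin_indpt S)"
    by (rule maximal_exists[where N = "card H" and B = "{}"]) (rule li, assumption, rule e)
  then obtain A where A: "finite A" "maximal A (\<lambda>S. S \<subseteq> carrier V \<and> lin_indpt S)" by blast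
  have b: "basis A" by (rule max_li_is_basis[OF A(2)])
  have "fin_dim" using A(1) b unfolding fin_dim_def basis_def by blast
  moreover have "dim = card A" by (rule dim_basis[OF A(1) b])
  moreover have "card A \<le> card H" using li[of A] b unfolding basis_def by blast
  ultimately show ?thesis by simp
qed

section \<open>The even center\<close>

lemma free_fields [simp]: "carrier (free_sergeev n) = free_carrier n" "monoid.mult (free_sergeev n) = (*)"
    "one (free_sergeev n) = 1" "zero (free_sergeev n) = 0" "add (free_sergeev n) = (+)"
    "a \<odot>\<^bsub>free_sergeev n\<^esub> p = Poly_Mapping.single 0 a * p"
  by (simp_all add: free_sergeev_def)

lemma ring_free: "ring (free_sergeev n :: ('f::field, 'f sergeev_free) superalgebra)"
proof (rule ringI)
  show "abelian_group (free_sergeev n :: ('f, 'f sergeev_free) superalgebra)"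
  proof (rule abelian_groupI)
    fix x :: "'f sergeev_free" assume "x \<in> carrier (free_sergeev n)"
    thus "\<exists>y\<in>carrier (free_sergeev n). y \<oplus>\<^bsub>free_sergeev n\<^esub> x = \<zero>\<^bsub>free_sergeev n\<^esub>"
      by (intro bexI[of _ "- x"]) (simp_all add: free_carrier_uminus)
  qed (simp_all add: free_carrier_0 free_carrier_add ac_simps)
  show "monoid (free_sergeev n :: ('f, 'f sergeev_free) superalgebra)"
    by (rule monoidI) (simp_all add: free_carrier_1 free_carrier_mult mult.assoc)
qed (simp_all add: distrib_left distrib_right)

lemma rel_carrier: "sergeev_rel n p q \<Longrightarrow> p \<in> free_carrier n \<and> q \<in> free_carrier n"
  by (induction rule: sergeev_rel.induct)
    (auto simp: sergeev_gens_def intro!: free_carrier_diff free_carrier_add free_carrier_uminus free_carrier_mult free_carrier_single free_carrier_1)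

lemma rel_diff_carrier: "sergeev_rel n p q \<Longrightarrow> p - q \<in> free_carrier n"
  by (rule free_carrier_diff[OF conjunct1[OF rel_carrier] conjunct2[OF rel_carrier]])

lemma const_commute:
  fixes a :: "'f::field" and p :: "'f sergeev_free"
  shows "Poly_Mapping.single 0 a * p = p * Poly_Mapping.single 0 a"
proof -
  have "Poly_Mapping.single 0 a * (\<Sum>w\<in>keys p. Poly_Mapping.single w (coef p w))
      = (\<Sum>w\<in>keys p. Poly_Mapping.single w (coef p w)) * Poly_Mapping.single 0 a"
    unfolding sum_distrib_left sum_distrib_right by (simp add: mult_single mult.commute)
  thus ?thesis by (simp only: free_expansion[of p, symmetric])
qed

section \<open>From the free algebra to the cyclotomic quotient\<close>

context cyclotomic_space
begin

definition h1 :: "'f sergeev_free \<Rightarrow> 'f sergeev_free set" where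
  "h1 p = sergeev_ideal n +>\<^bsub>free_sergeev n\<^esub> p"

lemma ideal1: "ideal (sergeev_ideal n) (free_sergeev n :: ('f, 'f sergeev_free) superalgebra)"
  unfolding sergeev_ideal_def
  by (rule ring.genideal_ideal[OF ring_free]) (auto intro: rel_diff_carrier)

lemma rel_in_ideal1: "sergeev_rel n p q \<Longrightarrow> p - (q :: 'f sergeev_free) \<in> sergeev_ideal n"
  unfolding sergeev_ideal_def
  by (rule subsetD[OF ring.genideal_self[OF ring_free]]) (force intro: rel_diff_carrier, blast)

lemma h1_facts:
  shows "ring (affine_sergeev n :: ('f, 'f sergeev_free set) superalgebra)"
    and "carrier (affine_sergeev n) = h1 ` free_carrier n"
    and "p \<in> free_carrier n \<Longrightarrow> q \<in> free_carrier n \<Longrightarrow> h1 p \<oplus>\<^bsub>affine_sergeev n\<^esub> h1 q = h1 (p + q)"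
    and "p \<in> free_carrier n \<Longrightarrow> q \<in> free_carrier n \<Longrightarrow> h1 p \<otimes>\<^bsub>affine_sergeev n\<^esub> h1 q = h1 (p * q)"
    and "\<one>\<^bsub>affine_sergeev n\<^esub> = h1 1" and "\<zero>\<^bsub>affine_sergeev n\<^esub> = h1 0"
    and "p \<in> free_carrier n \<Longrightarrow> h1 p = h1 0 \<longleftrightarrow> p \<in> sergeev_ideal n"
    and "p \<in> free_carrier n \<Longrightarrow> a \<odot>\<^bsub>affine_sergeev n\<^esub> h1 p = h1 (Poly_Mapping.single 0 a) \<otimes>\<^bsub>affine_sergeev n\<^esub> h1 p"
proof -
  show "ring (affine_sergeev n :: ('f, 'f sergeev_free set) superalgebra)"
    unfolding affine_sergeev_def by (rule quot_ring[OF ideal1])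
  show "carrier (affine_sergeev n) = h1 ` free_carrier n"
    unfolding affine_sergeev_def quot_carrier by (simp add: h1_def[abs_def])
  show "h1 p \<oplus>\<^bsub>affine_sergeev n\<^esub> h1 q = h1 (p + q)" if "p \<in> free_carrier n" "q \<in> free_carrier n"
    unfolding affine_sergeev_def h1_def using quot_add[OF ideal1, of p q] that by simp
  show "h1 p \<otimes>\<^bsub>affine_sergeev n\<^esub> h1 q = h1 (p * q)" if "p \<in> free_carrier n" "q \<in> free_carrier n"
    unfolding affine_sergeev_def h1_def using quot_mult[OF ideal1, of p q] that by simp
  show "\<one>\<^bsub>affine_sergeev n\<^esub> = h1 1"
    unfolding affine_sergeev_def h1_def using quot_one[OF ideal1] by simp
  show "\<zero>\<^bsub>affine_sergeev n\<^esub> = h1 0"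
    unfolding affine_sergeev_def h1_def using quot_zero[OF ideal1] by simp
  show "h1 p = h1 0 \<longleftrightarrow> p \<in> sergeev_ideal n" if "p \<in> free_carrier n"
    unfolding h1_def using quot_zero_iff[OF ideal1, of p] that by simp
  show "a \<odot>\<^bsub>affine_sergeev n\<^esub> h1 p = h1 (Poly_Mapping.single 0 a) \<otimes>\<^bsub>affine_sergeev n\<^esub> h1 p" if "p \<in> free_carrier n"
    unfolding affine_sergeev_def h1_def
    by (rule quot_smult[OF ideal1]) (use that in \<open>auto simp: free_carrier_const quot_carrier\<close>)
qed

lemma h1_pow: "p \<in> free_carrier n \<Longrightarrow> h1 p [^]\<^bsub>affine_sergeev n\<^esub> k = h1 (p ^ (k :: nat))"
proof (induction k)
  case (Suc k)
  interpret A: ring "affine_sergeev n :: ('f, 'f sergeev_free set) superalgebra" by (rule h1_facts)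
  show ?case using Suc h1_facts(4)[OF free_carrier_power[OF Suc.prems] Suc.prems, of k]
    by (simp add: power_Suc2 del: power_Suc)
next
  case 0
  interpret A: ring "affine_sergeev n :: ('f, 'f sergeev_free set) superalgebra" by (rule h1_facts)
  show ?case by (simp add: h1_facts(5))
qed

lemma h1_sum: "(\<And>i. F i \<in> free_carrier n) \<Longrightarrow> (\<Oplus>\<^bsub>affine_sergeev n\<^esub>i\<in>{..m}. h1 (F i)) = h1 (\<Sum>i\<le>(m::nat). F i)"
proof (induction m)
  case 0
  interpret A: ring "affine_sergeev n :: ('f, 'f sergeev_free set) superalgebra" by (rule h1_facts)
  show ?case using 0 by (subst A.finsum_0) (auto simp: h1_facts(2))
next
  case (Suc m)
  interpret A: ring "affine_sergeev n :: ('f, 'f sergeev_free set) superalgebra" by (rule h1_facts)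
  have "(\<Oplus>\<^bsub>affine_sergeev n\<^esub>i\<in>{..Suc m}. h1 (F i)) = h1 (F (Suc m)) \<oplus>\<^bsub>affine_sergeev n\<^esub> h1 (\<Sum>i\<le>m. F i)"
    using Suc by (subst A.finsum_Suc) (auto simp: h1_facts(2))
  also have "\<dots> = h1 (F (Suc m) + (\<Sum>i\<le>m. F i))" by (intro h1_facts(3) free_carrier_sum Suc.prems)
  finally show ?case by (simp add: add.commute)
qed

lemma gx_carrier: "gx 1 \<in> free_carrier n"
  using n_pos by (intro free_carrier_single) (auto simp: sergeev_gens_def)

lemma gpoly_carrier: "gpoly \<in> free_carrier n"
  unfolding gpoly_def by (intro free_carrier_sum free_carrier_mult free_carrier_const free_carrier_power gx_carrier)

lemma eval_gpoly: "algebra_eval (affine_sergeev n) g (affine_x n 1) = h1 gpoly"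
proof -
  have x: "affine_x n 1 = h1 (gx 1)" by (simp add: affine_x_def h1_def)
  have "coeff g i \<odot>\<^bsub>affine_sergeev n\<^esub> (h1 (gx 1) [^]\<^bsub>affine_sergeev n\<^esub> i) = h1 (Poly_Mapping.single 0 (coeff g i) * gx 1 ^ i)" for i
    unfolding h1_pow[OF gx_carrier] h1_facts(8)[OF free_carrier_power[OF gx_carrier]]
    by (rule h1_facts(4)[OF free_carrier_const free_carrier_power[OF gx_carrier]])
  thus ?thesis
    unfolding algebra_eval_def x gpoly_def
    by (simp only: h1_sum free_carrier_mult free_carrier_const free_carrier_power gx_carrier)
qed

text \<open>Elements of the cyclotomic algebra are cosets of cosets; this is the composite
  projection from the free algebra.\<close>

definition hq :: "'f sergeev_free \<Rightarrow> 'f sergeev_free set set" where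
  "hq p = cyclotomic_ideal n g +>\<^bsub>affine_sergeev n\<^esub> h1 p"

lemma ideal2: "ideal (cyclotomic_ideal n g) (affine_sergeev n)"
  unfolding cyclotomic_ideal_def eval_gpoly
  by (rule ring.genideal_ideal[OF h1_facts(1)]) (use gpoly_carrier in \<open>auto simp: h1_facts(2)\<close>)

lemma h1_carrier: "p \<in> free_carrier n \<Longrightarrow> h1 p \<in> carrier (affine_sergeev n)"
  by (simp add: h1_facts(2))

lemma hq_facts:
  shows "ring (cyclotomic_sergeev n g)"
    and "carrier (cyclotomic_sergeev n g) = hq ` free_carrier n"
    and "p \<in> free_carrier n \<Longrightarrow> q \<in> free_carrier n \<Longrightarrow> hq p \<oplus>\<^bsub>cyclotomic_sergeev n g\<^esub> hq q = hq (p + q)"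
    and "p \<in> free_carrier n \<Longrightarrow> q \<in> free_carrier n \<Longrightarrow> hq p \<otimes>\<^bsub>cyclotomic_sergeev n g\<^esub> hq q = hq (p * q)"
    and "\<zero>\<^bsub>cyclotomic_sergeev n g\<^esub> = hq 0"
    and "p \<in> free_carrier n \<Longrightarrow> hq p = hq 0 \<longleftrightarrow> h1 p \<in> cyclotomic_ideal n g"
    and "p \<in> free_carrier n \<Longrightarrow> a \<odot>\<^bsub>cyclotomic_sergeev n g\<^esub> hq p = hq (Poly_Mapping.single 0 a * p)"
proof -
  show "ring (cyclotomic_sergeev n g)" unfolding cyclotomic_sergeev_def by (rule quot_ring[OF ideal2])
  show "carrier (cyclotomic_sergeev n g) = hq ` free_carrier n"
    unfolding cyclotomic_sergeev_def quot_carrier h1_facts(2) by (simp add: image_image hq_def[abs_def])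
  show "hq p \<oplus>\<^bsub>cyclotomic_sergeev n g\<^esub> hq q = hq (p + q)" if "p \<in> free_carrier n" "q \<in> free_carrier n"
    unfolding cyclotomic_sergeev_def hq_def
    by (simp only: quot_add[OF ideal2 h1_carrier h1_carrier] that h1_facts(3))
  show m: "hq p \<otimes>\<^bsub>cyclotomic_sergeev n g\<^esub> hq q = hq (p * q)" if "p \<in> free_carrier n" "q \<in> free_carrier n" for p q
    unfolding cyclotomic_sergeev_def hq_def
    by (simp only: quot_mult[OF ideal2 h1_carrier h1_carrier] that h1_facts(4))
  show "\<zero>\<^bsub>cyclotomic_sergeev n g\<^esub> = hq 0"
    unfolding cyclotomic_sergeev_def hq_def quot_zero[OF ideal2] h1_facts(6) ..
  show "hq p = hq 0 \<longleftrightarrow> h1 p \<in> cyclotomic_ideal n g" if "p \<in> free_carrier n"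
    using quot_zero_iff[OF ideal2 h1_carrier[OF that]] unfolding hq_def h1_facts(6) .
  show "a \<odot>\<^bsub>cyclotomic_sergeev n g\<^esub> hq p = hq (Poly_Mapping.single 0 a * p)" if p: "p \<in> free_carrier n"
  proof -
    have "a \<odot>\<^bsub>cyclotomic_sergeev n g\<^esub> hq p = hq (Poly_Mapping.single 0 a) \<otimes>\<^bsub>cyclotomic_sergeev n g\<^esub> hq p"
      unfolding cyclotomic_sergeev_def hq_def
      by (rule quot_smult[OF ideal2 h1_carrier[OF free_carrier_const]])
        (use p in \<open>auto simp: h1_facts(2) h1_facts(8) quot_carrier\<close>)
    thus ?thesis using m[OF free_carrier_const p] by simp
  qed
qed

definition kerJ :: "'f sergeev_free set" where
  "kerJ = {p \<in> free_carrier n. hq p = hq 0}"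

text \<open>Closure under multiplication from the right rests on the fact that every element of the
  free algebra maps \<open>spn Bs\<close> to itself.\<close>

lemma annih_ideal: "ideal {p \<in> free_carrier n. annih p} (free_sergeev n)"
proof (rule ideal_intro[OF ring_free])
  fix p q :: "'f sergeev_free"
  assume p: "p \<in> {p \<in> free_carrier n. annih p}"
  { assume "q \<in> carrier (free_sergeev n)"
    hence q: "q \<in> free_carrier n" by simp
    show "q \<otimes>\<^bsub>free_sergeev n\<^esub> p \<in> {p \<in> free_carrier n. annih p}"
      using p q by (simp add: free_carrier_mult annih_def evalf_mult)
    show "p \<otimes>\<^bsub>free_sergeev n\<^esub> q \<in> {p \<in> free_carrier n. annih p}"
      using p q evalf_Bs[OF q] by (simp add: free_carrier_mult annih_def evalf_mult) }
  assume "q \<in> {p \<in> free_carrier n. annih p}"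
  thus "p \<oplus>\<^bsub>free_sergeev n\<^esub> q \<in> {p \<in> free_carrier n. annih p}"
    using p by (simp add: free_carrier_add annih_def evalf_add)
qed (auto simp: free_carrier_0 annih_def)

text \<open>The annihilator contains the Sergeev relations, and its image in the affine algebra is
  an ideal containing \<open>g(x_1)\<close>, hence the cyclotomic ideal. So the action on
  \<open>spn Bs\<close> factors through the cyclotomic algebra.\<close>

lemma kerJ_annih: "p \<in> kerJ \<Longrightarrow> annih p"
proof -
  assume "p \<in> kerJ"
  hence p': "p \<in> free_carrier n" "hq p = hq 0" by (simp_all add: kerJ_def)
  note p = p'(1) iffD1[OF hq_facts(6)[OF p'(1)] p'(2)]
  let ?N = "{p \<in> free_carrier n. annih p}"
  have 1: "sergeev_ideal n \<subseteq> ?N"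
    unfolding sergeev_ideal_def
    by (rule ring.genideal_minimal[OF ring_free annih_ideal]) (auto intro: rel_diff_carrier annih_rel)
  have "ideal (h1 ` ?N) (affine_sergeev n)"
    unfolding affine_sergeev_def h1_def[abs_def]
    by (rule ideal_cong[OF ring.ring_ideal_imp_quot_ideal[OF ring_free ideal1 annih_ideal]])
      (simp_all add: quot_superalgebra_def)
  hence "cyclotomic_ideal n g \<subseteq> h1 ` ?N"
    unfolding cyclotomic_ideal_def eval_gpoly
    by (rule ring.genideal_minimal[OF h1_facts(1)]) (use gpoly_carrier annih_gpoly in auto)
  then obtain r where r: "r \<in> ?N" "h1 p = h1 r" using p(2) by blast
  have nr: "- r \<in> free_carrier n" using r(1) free_carrier_uminus by blast
  have "h1 (p + - r) = h1 (r + - r)"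
    using h1_facts(3)[OF p(1) nr] h1_facts(3)[OF _ nr, of r] r by simp
  hence "p - r \<in> sergeev_ideal n" using h1_facts(7)[of "p - r"] free_carrier_diff[OF p(1), of r] r(1) by simp
  hence "annih (p - r)" using 1 by blast
  thus ?thesis using r(1) by (simp add: annih_def evalf_diff)
qed

lemma hq_eq_iff:
  assumes p: "p \<in> free_carrier n" "q \<in> free_carrier n"
  shows "hq p = hq q \<longleftrightarrow> p - q \<in> kerJ"
proof
  note d = free_carrier_diff[OF p] and u = free_carrier_uminus[OF p(2)]
  assume "hq p = hq q"
  hence "hq (p + - q) = hq (q + - q)" using hq_facts(3)[OF p(1) u] hq_facts(3)[OF p(2) u] by simp
  thus "p - q \<in> kerJ" using d by (simp add: kerJ_def)
next
  assume "p - q \<in> kerJ"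
  hence "hq (p - q + q) = hq (0 + q)"
    using hq_facts(3)[OF free_carrier_diff[OF p] p(2)] hq_facts(3)[OF free_carrier_0 p(2)] by (simp add: kerJ_def)
  thus "hq p = hq q" by simp
qed

lemma relations: "cyclotomic_relations d n g kerJ"
proof
  note z = free_carrier_0[of n]
  interpret C: ring "cyclotomic_sergeev n g" by (rule hq_facts)
  have hc: "hq p \<in> carrier (cyclotomic_sergeev n g)" if "p \<in> free_carrier n" for p using that by (simp add: hq_facts(2))
  show "0 \<in> kerJ" by (simp add: kerJ_def z)
  show "p + q \<in> kerJ" if "p \<in> kerJ" "q \<in> kerJ" for p q
    using that hq_facts(3)[of p q] hq_facts(3)[OF z z] by (simp add: kerJ_def free_carrier_add)
  show "q * p \<in> kerJ" if "p \<in> kerJ" "q \<in> free_carrier n" for p q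
    using that hq_facts(4)[of q p] hq_facts(4)[OF that(2) z] by (simp add: kerJ_def free_carrier_mult)
  show "p * q \<in> kerJ" if "p \<in> kerJ" "q \<in> free_carrier n" for p q
    using that hq_facts(4)[of p q] hq_facts(4)[OF z that(2)] by (simp add: kerJ_def free_carrier_mult)
  show "p - q \<in> kerJ" if r: "sergeev_rel n p q" for p q
  proof -
    have c: "p - q \<in> free_carrier n" using rel_carrier[OF r] free_carrier_diff by blast
    have "h1 (p - q) = h1 0" using h1_facts(7)[OF c] rel_in_ideal1[OF r] by simp
    thus ?thesis using c by (simp add: kerJ_def hq_def)
  qed
  have "h1 gpoly \<in> cyclotomic_ideal n g"
    unfolding cyclotomic_ideal_def eval_gpoly
    by (rule ring.genideal_self'[OF h1_facts(1) h1_carrier[OF gpoly_carrier]])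
  thus "gpoly \<in> kerJ" using hq_facts(6)[OF gpoly_carrier] by (simp add: kerJ_def gpoly_carrier)
  show "annih p" if "p \<in> kerJ" for p by (rule kerJ_annih[OF that])
qed

definition EC :: "'f sergeev_free set" where
  "EC = {p \<in> free_carrier n. (\<forall>w\<in>keys p. even (odd_letters w)) \<and> (\<forall>y\<in>free_carrier n. y * p - p * y \<in> kerJ)}"

lemma even_center_carrier: "carrier (even_center (cyclotomic_sergeev n g)) = hq ` EC"
proof -
  have ev: "even_part (cyclotomic_sergeev n g) = hq ` {p \<in> free_carrier n. \<forall>w\<in>keys p. even (odd_letters w)}"
    by (simp add: cyclotomic_sergeev_def affine_sergeev_def quot_superalgebra_def free_sergeev_def image_image hq_def[abs_def] h1_def[abs_def])
  have comm: "hq p \<otimes>\<^bsub>cyclotomic_sergeev n g\<^esub> hq y = hq y \<otimes>\<^bsub>cyclotomic_sergeev n g\<^esub> hq p \<longleftrightarrow> y * p - p * y \<in> kerJ"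
    if "p \<in> free_carrier n" "y \<in> free_carrier n" for p y
    unfolding hq_facts(4)[OF that] hq_facts(4)[OF that(2,1)]
      hq_eq_iff[OF free_carrier_mult[OF that(2,1)] free_carrier_mult[OF that], symmetric]
    by (rule eq_commute)
  have "z \<in> algebra_center (cyclotomic_sergeev n g) \<inter> even_part (cyclotomic_sergeev n g) \<longleftrightarrow> z \<in> hq ` EC" for z
  proof
    assume z: "z \<in> algebra_center (cyclotomic_sergeev n g) \<inter> even_part (cyclotomic_sergeev n g)"
    then obtain p where p: "p \<in> free_carrier n" "\<forall>w\<in>keys p. even (odd_letters w)" "z = hq p" unfolding ev by blast
    have "y * p - p * y \<in> kerJ" if "y \<in> free_carrier n" for y
      using z that comm[OF p(1) that] unfolding p(3) algebra_center_def hq_facts(2) by blast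
    thus "z \<in> hq ` EC" using p unfolding EC_def by blast
  next
    assume "z \<in> hq ` EC"
    then obtain p where p: "p \<in> free_carrier n" "\<forall>w\<in>keys p. even (odd_letters w)" "z = hq p"
      "\<forall>y\<in>free_carrier n. y * p - p * y \<in> kerJ" unfolding EC_def by blast
    have "z \<otimes>\<^bsub>cyclotomic_sergeev n g\<^esub> y = y \<otimes>\<^bsub>cyclotomic_sergeev n g\<^esub> z" if "y \<in> carrier (cyclotomic_sergeev n g)" for y
      using that comm[OF p(1)] p(4) unfolding p(3) hq_facts(2) by blast
    thus "z \<in> algebra_center (cyclotomic_sergeev n g) \<inter> even_part (cyclotomic_sergeev n g)"
      using p unfolding algebra_center_def ev hq_facts(2) by blast
  qed
  thus ?thesis unfolding even_center_def by auto
qed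

lemma EC_carrier: "p \<in> EC \<Longrightarrow> p \<in> free_carrier n" by (simp add: EC_def)

lemma EC_0: "0 \<in> EC" by (simp add: EC_def free_carrier_0 kerJ_def)

lemma EC_add: "p \<in> EC \<Longrightarrow> q \<in> EC \<Longrightarrow> p + q \<in> EC"
proof -
  interpret J: cyclotomic_relations d n g kerJ by (rule relations)
  assume p: "p \<in> EC" and q: "q \<in> EC"
  have "y * (p + q) - (p + q) * y \<in> kerJ" if "y \<in> free_carrier n" for y
  proof -
    have "(y * p - p * y) + (y * q - q * y) \<in> kerJ" using p q that by (intro J.J_add) (auto simp: EC_def)
    thus ?thesis by (simp add: algebra_simps)
  qed
  moreover have "\<forall>w\<in>keys (p + q). even (odd_letters w)" using p q keys_add[of p q] by (auto simp: EC_def)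
  ultimately show ?thesis using p q by (simp add: EC_def free_carrier_add)
qed

lemma EC_const: "p \<in> EC \<Longrightarrow> Poly_Mapping.single 0 a * p \<in> EC"
proof -
  interpret J: cyclotomic_relations d n g kerJ by (rule relations)
  assume p: "p \<in> EC"
  let ?c = "Poly_Mapping.single 0 a :: 'f sergeev_free"
  have "y * (?c * p) - (?c * p) * y \<in> kerJ" if "y \<in> free_carrier n" for y
  proof -
    have "?c * (y * p - p * y) \<in> kerJ" using p that by (intro J.J_left free_carrier_const) (auto simp: EC_def)
    moreover have "y * (?c * p) = ?c * (y * p)" unfolding mult.assoc[symmetric] const_commute[of a y] ..
    ultimately show ?thesis by (simp add: right_diff_distrib mult.assoc)
  qed
  moreover have "\<forall>w\<in>keys (?c * p). even (odd_letters w)"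
    using p keys_mult[of ?c p] by (auto simp: EC_def split: if_splits)
  ultimately show ?thesis using p by (simp add: EC_def free_carrier_mult free_carrier_const)
qed

lemma even_center_fields:
  "add (even_center C) = add C" "zero (even_center C) = zero C" "smult (even_center C) = smult C"
  by (simp_all add: even_center_def)

lemma vectorspace_even_center: "vectorspace class_ring (even_center (cyclotomic_sergeev n g))"
proof -
  let ?V = "even_center (cyclotomic_sergeev n g)"
  have add: "hq p \<oplus>\<^bsub>cyclotomic_sergeev n g\<^esub> hq q = hq (p + q)" if "p \<in> EC" "q \<in> EC" for p q
    using hq_facts(3) EC_carrier that by blast
  have sm: "a \<odot>\<^bsub>cyclotomic_sergeev n g\<^esub> hq p = hq (Poly_Mapping.single 0 a * p)" if "p \<in> EC" for p a
    using hq_facts(7) EC_carrier that by blast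
  note e = even_center_carrier even_center_fields hq_facts(5)
  have "abelian_group ?V"
  proof (rule abelian_groupI)
    fix x assume "x \<in> carrier ?V"
    then obtain p where p: "p \<in> EC" "x = hq p" by (auto simp: e)
    have m: "- p \<in> EC" using EC_const[OF p(1), of "-1"] by (simp add: single_uminus)
    show "\<exists>y\<in>carrier ?V. y \<oplus>\<^bsub>?V\<^esub> x = \<zero>\<^bsub>?V\<^esub>"
      by (intro bexI[of _ "hq (- p)"]) (use m p in \<open>simp_all add: e add\<close>)
  qed (auto simp: e add EC_0 EC_add ac_simps intro!: imageI)
  moreover have "cring (class_ring :: 'f ring)" by (rule domain.axioms(1)[OF field.axioms(1)[OF class_field]])
  ultimately have "module class_ring ?V"
    by (intro moduleI)
      (auto simp: e add sm EC_0 EC_add EC_const distrib_left distrib_right single_add mult_single mult.assoc[symmetric] intro!: imageI)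
  thus ?thesis by (rule vectorspace.intro[OF _ class_field])
qed

lemma even_center_dim:
  assumes two: "(2 :: 'f) \<noteq> 0"
  shows "vectorspace.fin_dim class_ring (even_center (cyclotomic_sergeev n g)) \<and>
    vectorspace.dim class_ring (even_center (cyclotomic_sergeev n g)) \<le> card (hat_colored_partitions d n)"
proof -
  interpret J: cyclotomic_relations d n g kerJ by (rule relations)
  let ?V = "even_center (cyclotomic_sergeev n g)"
  \<comment> \<open>The representative is arbitrary: two of them differ by an element of
    \<open>kerJ\<close>, which sends \<open>v0\<close> to zero.\<close>
  define \<phi> where "\<phi> \<beta> z = coef (ap (evalf opl (SOME p. p \<in> EC \<and> hq p = z)) v0) (rep \<beta>)" for \<beta> z
  have \<phi>: "\<phi> \<beta> (hq p) = coef (ap (evalf opl p) v0) (rep \<beta>)" if p: "p \<in> EC" for \<beta> p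
  proof -
    define q where "q = (SOME q. q \<in> EC \<and> hq q = hq p)"
    have "\<exists>q. q \<in> EC \<and> hq q = hq p" using p by blast
    hence q: "q \<in> EC \<and> hq q = hq p" unfolding q_def by (rule someI_ex)
    hence "annih (q - p)" using hq_eq_iff EC_carrier p kerJ_annih by blast
    hence "ap (evalf opl (q - p)) v0 = 0" using v0_Bs unfolding annih_def by blast
    hence "ap (evalf opl q) v0 = ap (evalf opl p) v0" by (simp add: evalf_diff)
    thus ?thesis by (simp add: \<phi>_def q_def[symmetric])
  qed
  note e = even_center_carrier even_center_fields hq_facts(5)
  show ?thesis
  proof (rule dim_le_card_functionals[OF vectorspace_even_center finite_hat])
    fix \<beta> x y assume "x \<in> carrier ?V" "y \<in> carrier ?V"
    then obtain p q where p: "p \<in> EC" "x = hq p" and q: "q \<in> EC" "y = hq q" by (auto simp: e)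
    show "\<phi> \<beta> (x \<oplus>\<^bsub>?V\<^esub> y) = \<phi> \<beta> x + \<phi> \<beta> y"
      using p q hq_facts(3)[OF EC_carrier EC_carrier] by (simp add: e \<phi> EC_add evalf_add lookup_add)
  next
    fix \<beta> a x assume "x \<in> carrier ?V"
    then obtain p where p: "p \<in> EC" "x = hq p" by (auto simp: e)
    show "\<phi> \<beta> (a \<odot>\<^bsub>?V\<^esub> x) = a * \<phi> \<beta> x"
      using p hq_facts(7)[OF EC_carrier] by (simp add: e \<phi> EC_const evalf_mult)
  next
    fix x assume "x \<in> carrier ?V" and z: "\<And>\<beta>. \<beta> \<in> hat_colored_partitions d n \<Longrightarrow> \<phi> \<beta> x = 0"
    then obtain p where p: "p \<in> EC" "x = hq p" by (auto simp: e)
    have "p \<in> kerJ"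
    proof (rule J.even_central_zero[OF _ _ _ two])
      fix y assume "y \<in> sergeev_gens n"
      hence "(gen y :: 'f sergeev_free) \<in> free_carrier n" by (intro free_carrier_single) simp
      thus "gen y * p - p * gen y \<in> kerJ" using p(1) unfolding EC_def by blast
    next
      fix \<beta> assume "\<beta> \<in> hat_colored_partitions d n"
      thus "coef (ap (evalf opl p) v0) (rep \<beta>) = 0" using z[of \<beta>] p \<phi>[OF p(1)] by simp
    qed (use p in \<open>simp_all add: EC_def\<close>)
    thus "x = \<zero>\<^bsub>?V\<^esub>" using p by (simp add: e kerJ_def)
  qed
qed

end

theorem corollary5p5:
  fixes n d :: nat and a :: "nat \<Rightarrow> 'f::field" and g :: "'f poly"
  assumes "CHAR('f) \<noteq> 2" and "n \<ge> 1" and "d \<ge> 2" and "even d"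
    and "a d = 1"
    and "g = (\<Sum>t = 0..d div 2. monom (a (d - 2 * t)) (d - 2 * t))"
  shows "vectorspace.fin_dim class_ring (even_center (cyclotomic_sergeev n g)) \<and>
    vectorspace.dim class_ring (even_center (cyclotomic_sergeev n g))
      \<le> card (hat_colored_partitions d n)"
proof -
  have c: "coeff g k = (\<Sum>t = 0..d div 2. if d - 2 * t = k then a (d - 2 * t) else 0)" for k
    by (simp add: assms(6) coeff_sum)
  \<comment> \<open>As \<open>d > 0\<close>, the exponent \<open>d - 2 * t\<close> equals
    \<open>d\<close> for \<open>t = 0\<close> alone.\<close>
  have "coeff g d = (\<Sum>t = 0..d div 2. if t = 0 then 1 else 0)"
    unfolding c by (rule sum.cong[OF refl]) (use assms(3,5) in auto)
  hence lead: "coeff g d = 1" by simp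
  have deg: "degree g = d"
  proof (rule antisym)
    show "degree g \<le> d"
      by (rule degree_le) (auto simp: c intro!: sum.neutral)
    show "d \<le> degree g" by (rule le_degree) (simp add: lead)
  qed
  have odd: "coeff g k = 0" if "odd k" for k
    unfolding c by (rule sum.neutral) (use that assms(4) in auto)
  have two: "(2 :: 'f) \<noteq> 0"
  proof
    assume "(2 :: 'f) = 0"
    hence "of_nat 2 = (0 :: 'f)" by simp
    hence dvd: "CHAR('f) dvd 2" by (simp only: of_nat_eq_0_iff_char_dvd)
    hence "CHAR('f) \<le> 2" by (rule dvd_imp_le) simp
    moreover have "CHAR('f) \<noteq> 0"
    proof
      assume "CHAR('f) = 0"
      with dvd have "0 dvd (2 :: nat)" by (simp only:)
      thus False by simp
    qed
    moreover have "CHAR('f) \<noteq> 1" by (metis of_nat_1 of_nat_CHAR zero_neq_one)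
    ultimately show False using assms(1) by linarith
  qed
  interpret cyclotomic_space d g n
    by unfold_locales (use assms(2-4) lead deg odd in auto)
  show ?thesis by (rule even_center_dim[OF two])
qed

end
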